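(* The excluded minors for the class of split matroids are exactly the matroids $S_0$, $S_1$, $S_2$, $S_3$, and $S_4$ (up to isomorphism). That is, a matroid is split if and only if it has no minor isomorphic to any of $S_0,S_1,S_2,S_3,S_4$, and each of these five matroids is not split while all of its proper minors are split.
   Context: Polyhedral notions. A polytope is the convex hull of a finite set of points in $\mathbb{R}^n$. A split of a polytope $P$ is a collection $\mathcal{C}$ of polytopes (cells) such that: the empty polytope is in $\mathcal{C}$; every vertex of every $Q\in\mathcal{C}$ is a vertex of $P$; every face of every $Q\in\mathcal{C}$ is in $\mathcal{C}$; the intersection of any two distinct members of $\mathcal{C}$ is a face of both; $\bigcup_{C\in\mathcal{C}}C=P$; and $\mathcal{C}$ has exactly two maximal members. The affine subspace spanned by the intersection of the two maximal cells is a split hyperplane of $P$. Split matroids. Let $M$ be a matroid of rank $r$ on ground set $\{1,\dots,n\}$, identifying subsets with their characteristic vectors in $\mathbb{R}^n$. The matroid polytope $P(M)$ is the convex hull of the characteristic vectors of the bases of $M$. The hypersimplex $\Delta(r,n)$ is the convex hull of all $0/1$-vectors in $\mathbb{R}^n$ with exactly $r$ ones. For a flat $F$ of $M$, let $H(F)=\{x\in\mathbb{R}^n:\sum_{i\in F}x_i=r(F)\}$. A flat $F$ is a flacet of $M$ if $H(F)\cap P(M)$ is a facet of $P(M)$ and $F$ is minimal under inclusion with respect to this property. A flacet $F$ is a split flacet if $H(F)\cap\Delta(r,n)$ spans a split hyperplane of $\Delta(r,n)$. Let $A$ be the affine subspace spanned by $P(M)$. $M$ is a split matroid if for any two distinct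 split flacets $F_1,F_2$ of $M$, no point of $H(F_1)\cap H(F_2)$ lies in the relative interior of $A\cap[0,1]^n$. The matroids. $M(\mathcal{W}_2)$ is the cycle matroid of the graph obtained from a triangle by adding an edge parallel to one of its edges; equivalently, the rank-$2$ matroid on $4$ elements with no loops and exactly one parallel pair. $S_0=M(\mathcal{W}_2)\oplus M(\mathcal{W}_2)$. The matroids $S_1,\dots,S_4$ are rank-$3$ matroids on $6$ elements with no loops: - $S_1$: parallel classes $\{a,b\},\{x,y\},\{c\},\{d\}$, and the four points $a,x,c,d$ have no three collinear (its simplification is $U_{3,4}$). - $S_2=S_1^{*}$: a parallel pair $\{p,p'\}$ and elements $a,b,x,y$, where the only nontrivial lines (rank-$2$ flats with at least three points up to parallelism) are $\{p,p',a,b\}$ and $\{p,p',x,y\}$. - $S_3$: elements $a,b,x,y,c,d$ with $x,y$ parallel, the only nontrivial lines being $\{a,b,x,y\}$ and $\{a,c,d\}$ (two three-point lines through $a$, with a doubled point $x$ on one line other than the intersection point). - $S_4$: elements $a,b,x,y,c,d$ with $x,y$ parallel, the only nontrivial line being $\{a,b,x,y\}$, and $c,d$ off this line with no further collinearities. *)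

theory Defs
  imports "HOL-Analysis.Analysis"
begin

record 'a matroid =
  ground :: "'a set"
  indeps :: "'a set set"

definition is_matroid :: "'a matroid \<Rightarrow> bool" where
  "is_matroid M \<longleftrightarrow>
     finite (ground M) \<and>
     indeps M \<subseteq> Pow (ground M) \<and>
     {} \<in> indeps M \<and>
     (\<forall>I\<in>indeps M. \<forall>J. J \<subseteq> I \<longrightarrow> J \<in> indeps M) \<and>
     (\<forall>I\<in>indeps M. \<forall>J\<in>indeps M. card I < card J \<longrightarrow> (\<exists>e\<in>J - I. insert e I \<in> indeps M))"

definition bases :: "'a matroid \<Rightarrow> 'a set set" where
  "bases M = {B \<in> indeps M. \<forall>I\<in>indeps M. B \<subseteq> I \<longrightarrow> I = B}"

definition mrank :: "'a matroid \<Rightarrow> 'a set \<Rightarrow> nat" where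
  "mrank M X = Max (card ` {I \<in> indeps M. I \<subseteq> X})"

definition flat :: "'a matroid \<Rightarrow> 'a set \<Rightarrow> bool" where
  "flat M F \<longleftrightarrow> F \<subseteq> ground M \<and> (\<forall>e\<in>ground M - F. mrank M F < mrank M (insert e F))"

definition delete :: "'a matroid \<Rightarrow> 'a set \<Rightarrow> 'a matroid" where
  "delete M D = \<lparr>ground = ground M - D, indeps = {I \<in> indeps M. I \<inter> D = {}}\<rparr>"

definition contract :: "'a matroid \<Rightarrow> 'a set \<Rightarrow> 'a matroid" where
  "contract M C =
     \<lparr>ground = ground M - C,
      indeps = {I. I \<subseteq> ground M - C \<and> mrank M (I \<union> C) = card I + mrank M C}\<rparr>"

definition minor :: "'a matroid \<Rightarrow> 'a matroid \<Rightarrow> bool" where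
  "minor N M \<longleftrightarrow>
     (\<exists>C D. C \<subseteq> ground M \<and> D \<subseteq> ground M \<and> C \<inter> D = {} \<and> N = delete (contract M C) D)"

definition proper_minor :: "'a matroid \<Rightarrow> 'a matroid \<Rightarrow> bool" where
  "proper_minor N M \<longleftrightarrow> minor N M \<and> ground N \<noteq> ground M"

definition matroid_iso :: "'a matroid \<Rightarrow> 'b matroid \<Rightarrow> bool" (infix \<open>\<simeq>\<^sub>m\<close> 50) where
  "M \<simeq>\<^sub>m N \<longleftrightarrow>
     (\<exists>f. bij_betw f (ground M) (ground N) \<and>
          (\<forall>I. I \<subseteq> ground M \<longrightarrow> (I \<in> indeps M \<longleftrightarrow> f ` I \<in> indeps N)))"

definition direct_sum :: "'a matroid \<Rightarrow> 'b matroid \<Rightarrow> ('a + 'b) matroid" where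
  "direct_sum M N =
     \<lparr>ground = ground M <+> ground N,
      indeps = {I <+> J | I J. I \<in> indeps M \<and> J \<in> indeps N}\<rparr>"

definition maximal_cell :: "'v set set \<Rightarrow> 'v set \<Rightarrow> bool" where
  "maximal_cell \<C> Q \<longleftrightarrow> Q \<in> \<C> \<and> (\<forall>R\<in>\<C>. Q \<subseteq> R \<longrightarrow> R = Q)"

definition polytope_split :: "'v::euclidean_space set \<Rightarrow> 'v set set \<Rightarrow> bool" where
  "polytope_split P \<C> \<longleftrightarrow>
     (\<forall>Q\<in>\<C>. polytope Q) \<and>
     {} \<in> \<C> \<and>
     (\<forall>Q\<in>\<C>. \<forall>v. v extreme_point_of Q \<longrightarrow> v extreme_point_of P) \<and>
     (\<forall>Q\<in>\<C>. \<forall>F. F face_of Q \<longrightarrow> F \<in> \<C>) \<and>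
     (\<forall>Q\<in>\<C>. \<forall>R\<in>\<C>. Q \<noteq> R \<longrightarrow> Q \<inter> R face_of Q \<and> Q \<inter> R face_of R) \<and>
     \<Union>\<C> = P \<and>
     card {Q. maximal_cell \<C> Q} = 2"

definition split_hyperplane :: "'v::euclidean_space set \<Rightarrow> 'v set \<Rightarrow> bool" where
  "split_hyperplane P H \<longleftrightarrow>
     (\<exists>\<C> Q R. polytope_split P \<C> \<and> maximal_cell \<C> Q \<and> maximal_cell \<C> R \<and> Q \<noteq> R \<and>
        H = affine hull (Q \<inter> R))"

text \<open>
  A matroid whose ground set \<open>E\<close> is contained in a finite type \<open>'a\<close> has its polytope in
  \<open>\<real>\<^sup>E\<close>, which is realised as the coordinate subspace of the vectors of \<open>real ^ 'a\<close> that vanish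
  outside \<open>E\<close>.  This lets a matroid and its minors live over the same type.
\<close>

definition coord_space :: "'a::finite set \<Rightarrow> (real ^ 'a) set" where
  "coord_space E = {x. \<forall>i. i \<notin> E \<longrightarrow> x $ i = 0}"

definition char_vec :: "'a::finite set \<Rightarrow> real ^ 'a" where
  "char_vec X = (\<chi> i. if i \<in> X then 1 else 0)"

definition matroid_polytope :: "'a::finite matroid \<Rightarrow> (real ^ 'a) set" where
  "matroid_polytope M = convex hull (char_vec ` bases M)"

definition hypersimplex :: "nat \<Rightarrow> 'a::finite set \<Rightarrow> (real ^ 'a) set" where
  "hypersimplex r E = convex hull (char_vec ` {X. X \<subseteq> E \<and> card X = r})"

definition unit_cube :: "'a::finite set \<Rightarrow> (real ^ 'a) set" where
  "unit_cube E = {x \<in> coord_space E. \<forall>i\<in>E. 0 \<le> x $ i \<and> x $ i \<le> 1}"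

definition flat_hyperplane :: "'a::finite matroid \<Rightarrow> 'a set \<Rightarrow> (real ^ 'a) set" where
  "flat_hyperplane M F = {x \<in> coord_space (ground M). (\<Sum>i\<in>F. x $ i) = real (mrank M F)}"

text \<open>
  If the matroid is disconnected, several flats can define the same facet (one may add to
  a flat the ground sets of other components).  Minimality selects one of them: it is
  minimality among the flats that define the given facet, not among the flats that define
  some facet.
\<close>

definition flacet :: "'a::finite matroid \<Rightarrow> 'a set \<Rightarrow> bool" where
  "flacet M F \<longleftrightarrow>
     flat M F \<and>
     flat_hyperplane M F \<inter> matroid_polytope M facet_of matroid_polytope M \<and>
     (\<forall>G. flat M G \<and> G \<subset> F \<longrightarrow>
        flat_hyperplane M G \<inter> matroid_polytope M \<noteq> flat_hyperplane M F \<inter> matroid_polytope M)"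

definition split_flacet :: "'a::finite matroid \<Rightarrow> 'a set \<Rightarrow> bool" where
  "split_flacet M F \<longleftrightarrow>
     flacet M F \<and>
     (let \<Delta> = hypersimplex (mrank M (ground M)) (ground M)
      in split_hyperplane \<Delta> (affine hull (flat_hyperplane M F \<inter> \<Delta>)))"

definition split_matroid :: "'a::finite matroid \<Rightarrow> bool" where
  "split_matroid M \<longleftrightarrow>
     is_matroid M \<and>
     (\<forall>F G. split_flacet M F \<and> split_flacet M G \<and> F \<noteq> G \<longrightarrow>
        flat_hyperplane M F \<inter> flat_hyperplane M G \<inter>
          rel_interior (affine hull (matroid_polytope M) \<inter> unit_cube (ground M)) = {})"

definition excluded_minor :: "'a::finite matroid \<Rightarrow> bool" where
  "excluded_minor M \<longleftrightarrow>
     is_matroid M \<and> \<not> split_matroid M \<and> (\<forall>N. proper_minor N M \<longrightarrow> split_matroid N)"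

text \<open>
  The loopless matroid of rank \<open>r\<close> (at most 3) on a whole finite type, whose parallel classes
  with more than one element are \<open>\<P>\<close> and whose nontrivial lines (as subsets of the ground set,
  all parallel elements included) are \<open>\<L>\<close>.
\<close>

definition points_lines_matroid :: "nat \<Rightarrow> 'a::finite set set \<Rightarrow> 'a set set \<Rightarrow> 'a matroid" where
  "points_lines_matroid r \<P> \<L> =
     \<lparr>ground = UNIV,
      indeps = {I. card I \<le> r \<and> (\<forall>P\<in>\<P>. card (I \<inter> P) \<le> 1) \<and> (\<forall>L\<in>\<L>. card (I \<inter> L) \<le> 2)}\<rparr>"

datatype elt4 = Elt4_p | Elt4_p' | Elt4_q | Elt4_r

instance elt4 :: finite
proof
  have "(UNIV :: elt4 set) = {Elt4_p, Elt4_p', Elt4_q, Elt4_r}"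
    by (auto intro: elt4.exhaust)
  then show "finite (UNIV :: elt4 set)"
    by (metis finite.emptyI finite_insert)
qed

datatype elt6 = Elt_a | Elt_b | Elt_c | Elt_d | Elt_x | Elt_y

instance elt6 :: finite
proof
  have "(UNIV :: elt6 set) = {Elt_a, Elt_b, Elt_c, Elt_d, Elt_x, Elt_y}"
    by (auto intro: elt6.exhaust)
  then show "finite (UNIV :: elt6 set)"
    by (metis finite.emptyI finite_insert)
qed

definition MW2 :: "elt4 matroid" where
  "MW2 = points_lines_matroid 2 {{Elt4_p, Elt4_p'}} {}"

definition S0 :: "(elt4 + elt4) matroid" where
  "S0 = direct_sum MW2 MW2"

definition S1 :: "elt6 matroid" where
  "S1 = points_lines_matroid 3 {{Elt_a, Elt_b}, {Elt_x, Elt_y}} {}"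

text \<open>The dual of \<open>S1\<close>; the parallel pair consists of \<open>c\<close> and \<open>d\<close>.\<close>

definition S2 :: "elt6 matroid" where
  "S2 = points_lines_matroid 3 {{Elt_c, Elt_d}}
          {{Elt_c, Elt_d, Elt_a, Elt_b}, {Elt_c, Elt_d, Elt_x, Elt_y}}"

definition S3 :: "elt6 matroid" where
  "S3 = points_lines_matroid 3 {{Elt_x, Elt_y}}
          {{Elt_a, Elt_b, Elt_x, Elt_y}, {Elt_a, Elt_c, Elt_d}}"

definition S4 :: "elt6 matroid" where
  "S4 = points_lines_matroid 3 {{Elt_x, Elt_y}} {{Elt_a, Elt_b, Elt_x, Elt_y}}"

definition iso_to_some_S :: "'a matroid \<Rightarrow> bool" where
  "iso_to_some_S M \<longleftrightarrow> M \<simeq>\<^sub>m S0 \<or> M \<simeq>\<^sub>m S1 \<or> M \<simeq>\<^sub>m S2 \<or> M \<simeq>\<^sub>m S3 \<or> M \<simeq>\<^sub>m S4"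

end

theory Submission
  imports Defs
begin

text \<open>
  Call a pair of sets a certificate if the face of the matroid polytope that it cuts out has
  codimension at least two and meets the relative interior of \<open>A \<inter> [0,1]\<^sup>n\<close>. A matroid is split iff it
  has no certificate: a face of codimension two lies in two facets, and a facet meeting that interior
  comes from a split flacet; conversely, if two flacet hyperplanes meet at an interior point, then
  moving towards it from one facet either reaches it or leaves that facet through such a face.

  The bases of the face form a matroid, a direct sum of pieces without new loops and coloops. In
  the fundamental graph of one of its bases, a shortest chain of links between three pieces has, by
  pivoting, at most two vertices in the middle piece; together with partners inside the pieces this
  gives six elements, on which one of \<open>S1\<close>, ..., \<open>S4\<close> is seen. If no three pieces are chained, two
  disjoint links give \<open>S0\<close>. Conversely, each of the five matroids has a certificate, and nested
  certificates lift from minors one element at a time.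
\<close>

section \<open>Rank, closure and symmetric exchange\<close>

text \<open>Two points shape the first half. The face is used only through
  \<open>symmetric_exchange\<close>, which survives restriction to tight bases; it is never turned
  into a matroid, and its components are read off from sets that meet all its bases equally often.
  And a swap leaving the face loses membership in \<open>X\<close> or \<open>Y\<close> and gains
  none, so links between pieces are directed by \<open>level\<close>. Sorting three pieces by level
  turns the fundamental graph on the six chosen elements into an upper triangular 3 by 3 pattern
  with full diagonal, and at least two entries above the diagonal are present.

  The obstacle in lifting a certificate is that the restored element must not be a loop or coloop of
  the extended face without being one of \<open>M\<close>. The repairing swap needs a partner that
  agrees with it on both sets; with \<open>X \<subseteq> Y\<close> only three membership patterns
  occur, and each has a partner. Hence the certificates of the five matroids are chosen nested.

  That none of the five is a proper minor of another is a matter of size and connectivity: only a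
  six-element one inside \<open>S0\<close> has to be excluded, and it is connected while the
  summands of \<open>S0\<close> have four elements.\<close>

definition symmetric_exchange :: "'a set set \<Rightarrow> bool" where
  "symmetric_exchange \<F> \<longleftrightarrow>
     (\<forall>B1\<in>\<F>. \<forall>B2\<in>\<F>. \<forall>v\<in>B1 - B2. \<exists>e\<in>B2 - B1.
        insert e (B1 - {v}) \<in> \<F> \<and> insert v (B2 - {e}) \<in> \<F>)"

lemma symmetric_exchangeE:
  assumes "symmetric_exchange \<F>" "B1 \<in> \<F>" "B2 \<in> \<F>" "v \<in> B1" "v \<notin> B2"
  obtains e where "e \<in> B2" "e \<notin> B1" "insert e (B1 - {v}) \<in> \<F>" "insert v (B2 - {e}) \<in> \<F>"
  using assms unfolding symmetric_exchange_def by (metis Diff_iff)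

text \<open>Written additively to avoid subtraction of natural numbers. Tightness after a swap is
  read off from it.\<close>

lemma card_swap_Int:
  assumes "finite B" "b \<in> B" "e \<notin> B"
  shows "card (insert e (B - {b}) \<inter> X) + of_bool (b \<in> X) = card (B \<inter> X) + of_bool (e \<in> X)"
proof -
  have "insert e (B - {b}) \<inter> X = (if e \<in> X then insert e (B \<inter> X - {b}) else B \<inter> X - {b})"
    by auto
  moreover have "card (B \<inter> X - {b}) + of_bool (b \<in> X) = card (B \<inter> X)"
  proof (cases "b \<in> X")
    case True
    then show ?thesis using card_Suc_Diff1[of "B \<inter> X" b] assms by simp
  qed simp
  ultimately show ?thesis
    using assms by (auto simp: card_insert_if)
qed

definition tight :: "'a matroid \<Rightarrow> 'a set \<Rightarrow> 'a set \<Rightarrow> bool" where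
  "tight M X B \<longleftrightarrow> card (B \<inter> X) = mrank M X"

text \<open>Nonsplitness is witnessed by two sets \<open>X\<close>, \<open>Y\<close>: \<open>covered\<close> says that the face of the matroid
  polytope on which both rank inequalities are tight contains a point that is interior to the cube
  (up to loops and coloops), and \<open>degenerate\<close> forces this face to have codimension at least two.\<close>

definition face :: "'a matroid \<Rightarrow> 'a set \<Rightarrow> 'a set \<Rightarrow> 'a set set" where
  "face M X Y = {B \<in> bases M. tight M X B \<and> tight M Y B}"

definition covered :: "'a matroid \<Rightarrow> 'a set \<Rightarrow> 'a set \<Rightarrow> bool" where
  "covered M X Y \<longleftrightarrow>
     face M X Y \<noteq> {} \<and> \<Union>(bases M) \<subseteq> \<Union>(face M X Y) \<and> \<Inter>(face M X Y) \<subseteq> \<Inter>(bases M)"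

definition degenerate :: "'a matroid \<Rightarrow> 'a set \<Rightarrow> 'a set \<Rightarrow> bool" where
  "degenerate M X Y \<longleftrightarrow>
     (\<exists>B\<in>bases M. \<not> tight M X B) \<and> (\<exists>B\<in>bases M. tight M X B \<and> \<not> tight M Y B)"

locale fin_matroid =
  fixes M :: "'a matroid"
  assumes is_matroid: "is_matroid M"
begin

abbreviation "E \<equiv> ground M"
abbreviation "r \<equiv> mrank M"

lemma finite_ground: "finite E"
  and indep_subset_ground: "I \<in> indeps M \<Longrightarrow> I \<subseteq> E"
  and indep_empty: "{} \<in> indeps M"
  and indep_subset: "I \<in> indeps M \<Longrightarrow> J \<subseteq> I \<Longrightarrow> J \<in> indeps M"
  and augment: "I \<in> indeps M \<Longrightarrow> J \<in> indeps M \<Longrightarrow> card I < card J \<Longrightarrow>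
    \<exists>e\<in>J - I. insert e I \<in> indeps M"
  using is_matroid unfolding is_matroid_def by blast+

lemma finite_indep: "I \<in> indeps M \<Longrightarrow> finite I"
  using finite_ground indep_subset_ground finite_subset by blast

lemma finite_indeps: "finite (indeps M)"
  by (rule finite_subset[of _ "Pow E"]) (auto simp: finite_ground dest: indep_subset_ground)

lemma card_le_rank: "I \<in> indeps M \<Longrightarrow> I \<subseteq> X \<Longrightarrow> card I \<le> r X"
  unfolding mrank_def by (rule Max_ge) (auto simp: finite_indeps)

lemma rank_witness: obtains I where "I \<in> indeps M" "I \<subseteq> X" "card I = r X"
proof -
  have "r X \<in> card ` {I \<in> indeps M. I \<subseteq> X}"
    unfolding mrank_def by (rule Max_in) (use indep_empty finite_indeps in auto)
  with that show thesis by auto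
qed

lemma rank_mono: "X \<subseteq> Y \<Longrightarrow> r X \<le> r Y"
  by (metis card_le_rank rank_witness subset_trans)

lemma rank_le_card: "finite X \<Longrightarrow> r X \<le> card X"
  by (metis card_mono rank_witness)

lemma rank_indep: "I \<in> indeps M \<Longrightarrow> r I = card I"
  by (metis antisym card_le_rank finite_indep order_refl rank_le_card)

lemma rank_empty: "r {} = 0"
  using rank_le_card[of "{}"] by simp

lemma indep_iff_rank: "I \<subseteq> E \<Longrightarrow> I \<in> indeps M \<longleftrightarrow> r I = card I"
  by (metis card_subset_eq finite_ground finite_subset rank_indep rank_witness)

lemma indep_extend:
  assumes "I \<in> indeps M" "I \<subseteq> X"
  obtains J where "J \<in> indeps M" "I \<subseteq> J" "J \<subseteq> X" "card J = r X"
proof -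
  have "\<exists>J\<in>indeps M. I \<subseteq> J \<and> J \<subseteq> X \<and> card J = r X"
    using assms
  proof (induction "r X - card I" arbitrary: I)
    case 0
    then have "card I = r X" using card_le_rank[of I X] by simp
    then show ?case using 0 by blast
  next
    case (Suc n)
    obtain K where K: "K \<in> indeps M" "K \<subseteq> X" "card K = r X" by (rule rank_witness)
    have "card I < card K" using Suc.hyps(2) K by simp
    with augment Suc.prems K obtain e where e: "e \<in> K - I" "insert e I \<in> indeps M" by blast
    have "n = r X - card (insert e I)" "insert e I \<subseteq> X"
      using Suc.prems Suc.hyps(2) e K finite_indep[of I] by auto
    from Suc.hyps(1)[OF this(1) e(2) this(2)] show ?case by blast
  qed
  with that show thesis by blast
qed

lemma rank_submodular: "r (X \<union> Y) + r (X \<inter> Y) \<le> r X + r Y"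
proof -
  obtain I where I: "I \<in> indeps M" "I \<subseteq> X \<inter> Y" "card I = r (X \<inter> Y)" by (rule rank_witness)
  then obtain J where J: "J \<in> indeps M" "I \<subseteq> J" "J \<subseteq> X \<union> Y" "card J = r (X \<union> Y)"
    using indep_extend[of I "X \<union> Y"] by blast
  have fin: "finite J" using J finite_indep by blast
  have "card J + card (J \<inter> X \<inter> Y) = card (J \<inter> X) + card (J \<inter> Y)"
  proof -
    have "J \<inter> X \<union> J \<inter> Y = J" "(J \<inter> X) \<inter> (J \<inter> Y) = J \<inter> X \<inter> Y" using J by auto
    then show ?thesis using card_Un_Int[of "J \<inter> X" "J \<inter> Y"] fin by simp
  qed
  moreover have "card I \<le> card (J \<inter> X \<inter> Y)" using I J fin by (intro card_mono) auto
  moreover have "card (J \<inter> X) \<le> r X" "card (J \<inter> Y) \<le> r Y"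
    using J indep_subset by (auto intro!: card_le_rank)
  ultimately show ?thesis using I J by linarith
qed

lemma rank_insert_le: "r (insert e X) \<le> Suc (r X)"
  using rank_submodular[of X "{e}"] rank_le_card[of "{e}"] by simp

section \<open>Closure, bases and fundamental circuits\<close>

definition cl :: "'a set \<Rightarrow> 'a set" where
  "cl X = {e \<in> E. r (insert e X) = r X}"

lemma subset_cl: "X \<subseteq> E \<Longrightarrow> X \<subseteq> cl X"
  unfolding cl_def by (auto simp: insert_absorb)

lemma rank_Un_cl:
  assumes "S \<subseteq> cl X" shows "r (X \<union> S) = r X"
proof (rule antisym)
  show "r (X \<union> S) \<le> r X"
  proof (rule ccontr)
    assume less: "\<not> r (X \<union> S) \<le> r X"
    obtain I where I: "I \<in> indeps M" "I \<subseteq> X" "card I = r X" by (rule rank_witness)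
    obtain J where J: "J \<in> indeps M" "J \<subseteq> X \<union> S" "card J = r (X \<union> S)" by (rule rank_witness)
    obtain e where e: "e \<in> J - I" "insert e I \<in> indeps M"
      using augment[of I J] I J less by auto
    have "card (insert e I) \<le> r (insert e X)" using e I by (intro card_le_rank) auto
    then have "r X < r (insert e X)" using e I finite_indep by fastforce
    then have "e \<notin> X" by (metis insert_absorb less_irrefl)
    then have "e \<in> cl X" using e J assms by blast
    then show False using \<open>r X < r (insert e X)\<close> unfolding cl_def by simp
  qed
qed (simp add: rank_mono)

lemma cl_mono:
  assumes "X \<subseteq> Y" shows "cl X \<subseteq> cl Y"
proof
  fix e assume e: "e \<in> cl X"
  have "r (insert e Y) + r (Y \<inter> insert e X) \<le> r Y + r (insert e X)"
    using rank_submodular[of Y "insert e X"] assms by (simp add: sup.absorb1)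
  moreover have "r X \<le> r (Y \<inter> insert e X)" using assms by (intro rank_mono) auto
  moreover have "r Y \<le> r (insert e Y)" by (rule rank_mono) auto
  ultimately show "e \<in> cl Y" using e unfolding cl_def by auto
qed

lemma cl_trans:
  assumes "S \<subseteq> cl X" shows "cl S \<subseteq> cl X"
proof
  fix e assume e: "e \<in> cl S"
  then have "e \<in> cl (X \<union> S)" using cl_mono[of S "X \<union> S"] by blast
  then have "r (insert e (X \<union> S)) = r X" using rank_Un_cl[OF assms] unfolding cl_def by simp
  moreover have "r (insert e X) \<le> r (insert e (X \<union> S))" by (rule rank_mono) auto
  moreover have "r X \<le> r (insert e X)" by (rule rank_mono) auto
  ultimately show "e \<in> cl X" using e unfolding cl_def by auto
qed

lemma insert_indep_iff:
  assumes "I \<in> indeps M" "e \<in> E" "e \<notin> I"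
  shows "insert e I \<in> indeps M \<longleftrightarrow> e \<notin> cl I"
proof -
  have "insert e I \<in> indeps M \<longleftrightarrow> r (insert e I) = Suc (r I)"
    using assms indep_subset_ground by (subst indep_iff_rank) (auto simp: rank_indep finite_indep)
  moreover have "r I \<le> r (insert e I)" by (rule rank_mono) auto
  ultimately show ?thesis using rank_insert_le[of e I] assms unfolding cl_def by auto
qed

lemma spans_if_card_eq_rank:
  assumes "I \<in> indeps M" "I \<subseteq> X" "card I = r X" "X \<subseteq> E"
  shows "X \<subseteq> cl I"
proof
  fix e assume e: "e \<in> X"
  have "r (insert e I) \<le> r X" "r I \<le> r (insert e I)" using assms e by (auto intro!: rank_mono)
  then show "e \<in> cl I" using assms e unfolding cl_def by (auto simp: rank_indep)
qed

lemma base_iff: "B \<in> bases M \<longleftrightarrow> B \<in> indeps M \<and> card B = r E"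
proof
  assume B: "B \<in> bases M"
  then have "B \<in> indeps M" unfolding bases_def by blast
  moreover obtain J where "J \<in> indeps M" "B \<subseteq> J" "card J = r E"
    using indep_extend[OF calculation] indep_subset_ground calculation by metis
  ultimately show "B \<in> indeps M \<and> card B = r E" using B unfolding bases_def by blast
next
  assume B: "B \<in> indeps M \<and> card B = r E"
  have "I = B" if I: "I \<in> indeps M" "B \<subseteq> I" for I
  proof -
    have "card I \<le> card B" using B card_le_rank[OF I(1) indep_subset_ground[OF I(1)]] by simp
    then show "I = B" using card_seteq[OF finite_indep[OF I(1)] I(2)] by simp
  qed
  then have "\<forall>I\<in>indeps M. B \<subseteq> I \<longrightarrow> I = B" by blast
  with B show "B \<in> bases M" unfolding bases_def by fastforce
qed

lemma base_indep: "B \<in> bases M \<Longrightarrow> B \<in> indeps M"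
  and base_card: "B \<in> bases M \<Longrightarrow> card B = r E"
  using base_iff by blast+

lemma base_subset_ground: "B \<in> bases M \<Longrightarrow> B \<subseteq> E"
  and finite_base: "B \<in> bases M \<Longrightarrow> finite B"
  by (simp_all add: base_indep finite_indep indep_subset_ground)

lemma base_extend:
  assumes "I \<in> indeps M" obtains B where "B \<in> bases M" "I \<subseteq> B"
proof -
  obtain J where J: "J \<in> indeps M" "I \<subseteq> J" "J \<subseteq> E" "card J = r E"
    by (rule indep_extend[OF assms indep_subset_ground[OF assms]])
  then have "J \<in> bases M" by (simp add: base_iff)
  then show thesis by (rule that[OF _ J(2)])
qed

lemma bases_nonempty: "bases M \<noteq> {}"
  using base_extend[OF indep_empty] by auto

lemma cl_base: "B \<in> bases M \<Longrightarrow> cl B = E"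
  using spans_if_card_eq_rank[of B E] base_subset_ground base_iff unfolding cl_def by blast

lemma base_swap_iff:
  assumes "B \<in> bases M" "b \<in> B" "e \<in> E"
  shows "insert e (B - {b}) \<in> bases M \<longleftrightarrow> e \<notin> cl (B - {b})"
proof (cases "e \<in> B - {b}")
  case True
  then have "insert e (B - {b}) = B - {b}" by blast
  moreover have "card (B - {b}) < card B" using assms finite_base card_Diff1_less by metis
  moreover have "e \<in> cl (B - {b})"
    using True assms base_subset_ground subset_cl[of "B - {b}"] by blast
  ultimately show ?thesis using base_card[of B] base_card[of "B - {b}"] assms by auto
next
  case False
  have "card (insert e (B - {b})) = r E"
    using False assms(2) finite_base[OF assms(1)] card_Suc_Diff1[of B b] base_card[OF assms(1)] by simp
  then have "insert e (B - {b}) \<in> bases M \<longleftrightarrow> insert e (B - {b}) \<in> indeps M"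
    using base_iff by blast
  moreover have "B - {b} \<in> indeps M" using indep_subset[OF base_indep[OF assms(1)]] by blast
  ultimately show ?thesis using insert_indep_iff[of "B - {b}" e] False assms(3) by blast
qed

lemma base_card_Int_le: "B \<in> bases M \<Longrightarrow> card (B \<inter> X) \<le> r X"
  using card_le_rank[of "B \<inter> X" X] indep_subset[OF base_indep, of B "B \<inter> X"] by auto

lemma base_card_Int_eq: obtains B where "B \<in> bases M" "card (B \<inter> X) = r X"
proof -
  obtain I where I: "I \<in> indeps M" "I \<subseteq> X" "card I = r X" by (rule rank_witness)
  obtain B where B: "B \<in> bases M" "I \<subseteq> B" by (rule base_extend[OF I(1)])
  have "card I \<le> card (B \<inter> X)" using I B finite_base by (intro card_mono) auto
  then have "card (B \<inter> X) = r X" using base_card_Int_le[OF B(1), of X] I by simp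
  then show thesis by (rule that[OF B(1)])
qed

text \<open>For a base \<open>B\<close> and \<open>v\<close> outside it, this is the fundamental
  circuit of \<open>v\<close> with \<open>v\<close> itself removed, described by swaps instead of
  minimal dependence.\<close>

definition fundamental :: "'a set \<Rightarrow> 'a \<Rightarrow> 'a set" where
  "fundamental B v = {e \<in> B. insert v (B - {e}) \<in> bases M}"

lemma fundamental_subset: "e \<in> cl S \<Longrightarrow> B \<in> bases M \<Longrightarrow> S \<subseteq> B \<Longrightarrow> fundamental B e \<subseteq> S"
proof
  fix y assume S: "e \<in> cl S" "B \<in> bases M" "S \<subseteq> B" and y: "y \<in> fundamental B e"
  have e: "e \<in> E" using S unfolding cl_def by simp
  show "y \<in> S"
  proof (rule ccontr)
    assume "y \<notin> S"
    then have "e \<in> cl (B - {y})" using S cl_mono[of S "B - {y}"] by blast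
    then show False using y base_swap_iff[OF S(2), of y e] e unfolding fundamental_def by blast
  qed
qed

text \<open>A smallest subset \<open>T\<close> of \<open>B\<close> spanning \<open>v\<close>
  consists of swap partners of \<open>v\<close>. Dropping \<open>e\<close> from \<open>T\<close>
  loses \<open>v\<close>, so \<open>v\<close> may replace \<open>e\<close> in \<open>T\<close> and
  then spans \<open>e\<close> again; if \<open>v\<close> were spanned by \<open>B - {e}\<close>, so
  would be \<open>e\<close>.\<close>

lemma in_cl_fundamental:
  assumes B: "B \<in> bases M" and v: "v \<in> E" "v \<notin> B"
  shows "v \<in> cl (fundamental B v)"
proof -
  have fin: "finite B" using B finite_base by blast
  have "\<exists>T. T \<subseteq> B \<and> v \<in> cl T" using cl_base B v by blast
  then obtain T where T: "T \<subseteq> B" "v \<in> cl T" and min: "\<And>S. S \<subseteq> B \<Longrightarrow> v \<in> cl S \<Longrightarrow> card T \<le> card S"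
    using ex_has_least_nat[of "\<lambda>T. T \<subseteq> B \<and> v \<in> cl T" _ card] by metis
  have fT: "finite T" using T(1) fin finite_subset by blast
  have TE: "T \<subseteq> E" using T(1) base_subset_ground[OF B] by blast
  have indT: "S \<in> indeps M" if "S \<subseteq> T" for S
    using indep_subset[OF base_indep[OF B]] that T(1) by blast
  have "T \<subseteq> fundamental B v"
  proof
    fix e assume e: "e \<in> T"
    have "card (T - {e}) < card T" using fT e by (rule card_Diff1_less)
    then have "v \<notin> cl (T - {e})" using min[of "T - {e}"] T(1) by force
    moreover have vT: "v \<notin> T" using v T(1) by blast
    ultimately have ind: "insert v (T - {e}) \<in> indeps M"
      using insert_indep_iff[OF indT[of "T - {e}"] v(1)] by blast
    have "r (insert v T) = card T" using T(2) rank_indep[OF indT[of T]] unfolding cl_def by simp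
    moreover have "card (insert v (T - {e})) = card T"
      using e fT vT card_Suc_Diff1[OF fT e] by simp
    ultimately have "insert v T \<subseteq> cl (insert v (T - {e}))"
      using TE v(1) by (intro spans_if_card_eq_rank[OF ind]) auto
    then have 1: "e \<in> cl (insert v (T - {e}))" using e by blast
    have eB: "e \<in> B" using e T(1) by blast
    then have "insert e (B - {e}) = B" by blast
    then have 2: "e \<notin> cl (B - {e})"
      using base_swap_iff[OF B eB, of e] e TE B by auto
    have "v \<notin> cl (B - {e})"
    proof
      assume "v \<in> cl (B - {e})"
      moreover have "T - {e} \<subseteq> cl (B - {e})"
        using subset_cl[of "B - {e}"] T(1) base_subset_ground[OF B] by blast
      ultimately have "insert v (T - {e}) \<subseteq> cl (B - {e})" by blast
      from cl_trans[OF this] 1 2 show False by blast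
    qed
    then show "e \<in> fundamental B v"
      using base_swap_iff[OF B eB v(1)] eB unfolding fundamental_def by simp
  qed
  then show ?thesis using T(2) cl_mono by blast
qed

text \<open>The element \<open>v\<close> lies outside the hyperplane \<open>cl (B1 - {v})\<close>
  but is spanned by \<open>fundamental B2 v\<close>. Hence some element of the latter is outside the
  hyperplane as well, and this \<open>e\<close> works for both swaps.\<close>

lemma symmetric_exchange_bases: "symmetric_exchange (bases M)"
  unfolding symmetric_exchange_def
proof (intro ballI)
  fix B1 B2 v assume B: "B1 \<in> bases M" "B2 \<in> bases M" and v: "v \<in> B1 - B2"
  have vE: "v \<in> E" using B v base_subset_ground by blast
  have "v \<notin> cl (B1 - {v})"
    using base_swap_iff[OF B(1), of v v] v vE B by (auto simp: insert_absorb)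
  then have "\<not> fundamental B2 v \<subseteq> cl (B1 - {v})"
    using in_cl_fundamental[OF B(2) vE] cl_trans v by blast
  then obtain e where e: "e \<in> fundamental B2 v" "e \<notin> cl (B1 - {v})" by blast
  have eE: "e \<in> E" using e B base_subset_ground unfolding fundamental_def by blast
  have "e \<notin> B1"
    using e v subset_cl[of "B1 - {v}"] B base_subset_ground unfolding fundamental_def by blast
  then show "\<exists>e\<in>B2 - B1. insert e (B1 - {v}) \<in> bases M \<and> insert v (B2 - {e}) \<in> bases M"
    using e v B eE base_swap_iff[OF B(1), of v e] unfolding fundamental_def by blast
qed

text \<open>A symmetric exchange preserves the sum of the two intersection numbers with \<open>X\<close>, so if both
  are maximal, they stay maximal.\<close>

lemma symmetric_exchange_tight:
  assumes ex: "symmetric_exchange \<F>" and sub: "\<F> \<subseteq> bases M"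
  shows "symmetric_exchange {B \<in> \<F>. tight M X B}"
  unfolding symmetric_exchange_def
proof (intro ballI)
  fix B1 B2 v assume B: "B1 \<in> {B \<in> \<F>. tight M X B}" "B2 \<in> {B \<in> \<F>. tight M X B}" and v: "v \<in> B1 - B2"
  obtain e where e: "e \<in> B2" "e \<notin> B1" "insert e (B1 - {v}) \<in> \<F>" "insert v (B2 - {e}) \<in> \<F>"
    by (rule symmetric_exchangeE[OF ex, of B1 B2 v]) (use B v in auto)
  have fin: "finite B1" "finite B2" using B sub finite_base by auto
  have "insert e (B1 - {v}) \<in> bases M" "insert v (B2 - {e}) \<in> bases M" using e(3,4) sub by auto
  note le = this[THEN base_card_Int_le, of X]
  have "v \<in> B1" "v \<notin> B2" using v by auto
  from card_swap_Int[OF fin(1) this(1) e(2), of X] card_swap_Int[OF fin(2) e(1) this(2), of X]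
  have "tight M X (insert e (B1 - {v}))" "tight M X (insert v (B2 - {e}))"
    using le B unfolding tight_def by auto
  then show "\<exists>e\<in>B2 - B1. insert e (B1 - {v}) \<in> {B \<in> \<F>. tight M X B} \<and>
      insert v (B2 - {e}) \<in> {B \<in> \<F>. tight M X B}"
    using e by blast
qed

text \<open>Exchange \<open>B\<close> against \<open>B'\<close> at some \<open>b\<close> in
  \<open>Z\<close> that \<open>B'\<close> misses. If the incoming \<open>e\<close> is outside
  \<open>Z\<close>, this is the crossing swap. Otherwise the other half of the symmetric exchange
  moves \<open>B'\<close> closer to \<open>B\<close> and keeps its intersection number with
  \<open>Z\<close>, so induction applies.\<close>

lemma crossing_swap:
  assumes ex: "symmetric_exchange \<F>" and sub: "\<F> \<subseteq> bases M"
    and "B \<in> \<F>" "B' \<in> \<F>" "card (B' \<inter> Z) < card (B \<inter> Z)"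
  shows "\<exists>b e. b \<in> B \<and> b \<in> Z \<and> e \<in> E \<and> e \<notin> B \<and> e \<notin> Z \<and> insert e (B - {b}) \<in> \<F>"
  using assms(4,5)
proof (induction "card (B - B')" arbitrary: B' rule: less_induct)
  case less
  have fin: "finite B" "finite B'" using finite_base[OF subsetD[OF sub]] less.prems assms(3) by auto
  have "\<not> B \<inter> Z \<subseteq> B' \<inter> Z"
  proof
    assume "B \<inter> Z \<subseteq> B' \<inter> Z"
    then have "card (B \<inter> Z) \<le> card (B' \<inter> Z)" using fin by (intro card_mono) auto
    then show False using less.prems by simp
  qed
  then obtain b where b: "b \<in> B" "b \<in> Z" "b \<notin> B'" by blast
  obtain e where e: "e \<in> B'" "e \<notin> B" "insert e (B - {b}) \<in> \<F>" "insert b (B' - {e}) \<in> \<F>"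
    by (rule symmetric_exchangeE[OF ex assms(3) less.prems(1) b(1,3)])
  show ?case
  proof (cases "e \<in> Z")
    case False
    moreover have "e \<in> E" using e(1) base_subset_ground[OF subsetD[OF sub less.prems(1)]] by auto
    ultimately show ?thesis using b e by blast
  next
    case True
    have "B - insert b (B' - {e}) = B - B' - {b}" using e by auto
    then have "card (B - insert b (B' - {e})) < card (B - B')"
      using card_Diff1_less[of "B - B'" b] b fin by simp
    moreover have "card (insert b (B' - {e}) \<inter> Z) < card (B \<inter> Z)"
      using card_swap_Int[OF fin(2) e(1) b(3), of Z] True b less.prems by simp
    ultimately show ?thesis using less.hyps[OF _ e(4)] by blast
  qed
qed

end

section \<open>Fundamental graphs\<close>

context fin_matroid
begin

text \<open>Edges of the fundamental graph of \<open>B\<close>, which is bipartite between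
  \<open>B\<close> and its complement. For a represented matroid this is the nonzero pattern of the
  standard matrix with rows \<open>B\<close>, which motivates the two pivot lemmas.\<close>

definition adj :: "'a set \<Rightarrow> 'a \<Rightarrow> 'a \<Rightarrow> bool" where
  "adj B b e \<longleftrightarrow> b \<in> B \<and> e \<in> E \<and> e \<notin> B \<and> insert e (B - {b}) \<in> bases M"

lemma base_exchange:
  assumes "B1 \<in> bases M" "B2 \<in> bases M" "v \<in> B1" "v \<notin> B2"
  obtains e where "e \<in> B2" "e \<notin> B1" "insert e (B1 - {v}) \<in> bases M" "insert v (B2 - {e}) \<in> bases M"
  by (rule symmetric_exchangeE[OF symmetric_exchange_bases assms]) (rule that)

text \<open>The counterpart of a 2 by 2 determinant with exactly one zero entry, which cannot
  vanish. The exchange is between \<open>insert e (B - {u})\<close> and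
  \<open>insert v (B - {b})\<close>; the alternative \<open>x = u\<close> would produce an edge from
  \<open>u\<close> to \<open>v\<close>.\<close>

lemma adj_pivot_new:
  assumes B: "B \<in> bases M" and be: "adj B b e" and bv: "adj B b v" and ue: "adj B u e"
    and uv: "\<not> adj B u v"
  shows "adj (insert e (B - {b})) u v"
proof -
  have d: "b \<noteq> u" "e \<noteq> v" "u \<in> B" "b \<in> B" "e \<notin> B" "v \<notin> B" "v \<in> E"
    using assms unfolding adj_def by auto
  have 1: "insert e (B - {u}) \<in> bases M" and 2: "insert v (B - {b}) \<in> bases M"
    using bv ue unfolding adj_def by auto
  have "b \<in> insert e (B - {u})" "b \<notin> insert v (B - {b})" using d by auto
  then obtain x where x: "x \<in> insert v (B - {b})" "x \<notin> insert e (B - {u})"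
      "insert x (insert e (B - {u}) - {b}) \<in> bases M" "insert b (insert v (B - {b}) - {x}) \<in> bases M"
    by (rule base_exchange[OF 1 2])
  have "x = v \<or> x = u" using x(1,2) by auto
  moreover have "x \<noteq> u"
  proof
    assume "x = u"
    moreover have "insert b (insert v (B - {b}) - {u}) = insert v (B - {u})" using d by auto
    ultimately show False using x(4) uv d unfolding adj_def by auto
  qed
  ultimately have "x = v" by blast
  moreover have "insert v (insert e (B - {u}) - {b}) = insert v (insert e (B - {b}) - {u})"
    using d by auto
  ultimately show ?thesis using x(3) d unfolding adj_def by auto
qed

text \<open>In matrix terms a pivot changes the entry at \<open>u\<close>, \<open>v\<close> by a
  multiple of the product of the entries at \<open>b\<close>, \<open>v\<close> and at
  \<open>u\<close>, \<open>e\<close>; if one of these is zero, the entry keeps its status. In both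
  directions the exchange \<open>x = u\<close> would supply both edges that \<open>n\<close> forbids
  to coexist.\<close>

lemma adj_pivot_same:
  assumes B: "B \<in> bases M" and be: "adj B b e" and u: "u \<in> B" "u \<noteq> b" and v: "v \<in> E" "v \<notin> B" "v \<noteq> e"
    and n: "\<not> (adj B b v \<and> adj B u e)"
  shows "adj (insert e (B - {b})) u v \<longleftrightarrow> adj B u v"
proof -
  have d: "b \<in> B" "e \<notin> B" "e \<in> E" and 2: "insert e (B - {b}) \<in> bases M"
    using be unfolding adj_def by auto
  show ?thesis
  proof
    assume "adj B u v"
    then have 1: "insert v (B - {u}) \<in> bases M" unfolding adj_def by simp
    have "b \<in> insert v (B - {u})" "b \<notin> insert e (B - {b})" using d u v by auto
    then obtain x where x: "x \<in> insert e (B - {b})" "x \<notin> insert v (B - {u})"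
      "insert x (insert v (B - {u}) - {b}) \<in> bases M" "insert b (insert e (B - {b}) - {x}) \<in> bases M"
      by (rule base_exchange[OF 1 2])
    have "x = e \<or> x = u" using x(1,2) by auto
    moreover have "x \<noteq> u"
    proof
      assume xu: "x = u"
      have "insert u (insert v (B - {u}) - {b}) = insert v (B - {b})"
        "insert b (insert e (B - {b}) - {u}) = insert e (B - {u})" using d u v by auto
      then show False using x(3,4) n d u v unfolding xu adj_def by auto
    qed
    moreover have "insert e (insert v (B - {u}) - {b}) = insert v (insert e (B - {b}) - {u})"
      using d u v by auto
    ultimately show "adj (insert e (B - {b})) u v" using x(3) d u v unfolding adj_def by auto
  next
    assume "adj (insert e (B - {b})) u v"
    then have 1: "insert v (insert e (B - {b}) - {u}) \<in> bases M" unfolding adj_def by simp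
    have "e \<in> insert v (insert e (B - {b}) - {u})" using d u v by auto
    then obtain x where x: "x \<in> B" "x \<notin> insert v (insert e (B - {b}) - {u})"
      "insert x (insert v (insert e (B - {b}) - {u}) - {e}) \<in> bases M" "insert e (B - {x}) \<in> bases M"
      by (rule base_exchange[OF 1 B _ d(2)])
    have "x = b \<or> x = u" using x(1,2) by auto
    moreover have "x \<noteq> u"
    proof
      assume xu: "x = u"
      have "insert u (insert v (insert e (B - {b}) - {u}) - {e}) = insert v (B - {b})"
        using d u v by auto
      then show False using x(3,4) n d u v unfolding xu adj_def by auto
    qed
    moreover have "insert b (insert v (insert e (B - {b}) - {u}) - {e}) = insert v (B - {u})"
      using d u v by auto
    ultimately show "adj B u v" using x(3) d u v unfolding adj_def by auto
  qed
qed

end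

section \<open>Pieces of a covered face and chains of links between them\<close>

locale covered_face = fin_matroid +
  fixes X Y :: "'a set"
  assumes covered: "covered M X Y"
begin

abbreviation "\<F> \<equiv> face M X Y"

lemma face_base: "B \<in> \<F> \<Longrightarrow> B \<in> bases M"
  unfolding face_def by simp

lemma symmetric_exchange_face: "symmetric_exchange \<F>"
proof -
  have "symmetric_exchange {B \<in> {B \<in> bases M. tight M X B}. tight M Y B}"
    by (intro symmetric_exchange_tight symmetric_exchange_bases) auto
  then show ?thesis unfolding face_def by simp
qed

definition level :: "'a \<Rightarrow> nat" where
  "level v = of_bool (v \<in> X) + of_bool (v \<in> Y)"

text \<open>In a face basis both intersections are already maximal, so a swap can only lose
  membership in \<open>X\<close> and, separately, in \<open>Y\<close>. Hence equality of the sums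
  forces both memberships to agree, and the single number \<open>level\<close> decides whether the
  swap stays in the face.\<close>

lemma adj_level:
  assumes "B \<in> \<F>" "adj B b e"
  shows "level e \<le> level b" "insert e (B - {b}) \<in> \<F> \<longleftrightarrow> level b = level e"
proof -
  have B: "B \<in> bases M" "card (B \<inter> X) = r X" "card (B \<inter> Y) = r Y"
    using assms(1) unfolding face_def tight_def by auto
  have d: "b \<in> B" "e \<notin> B" "insert e (B - {b}) \<in> bases M" using assms(2) unfolding adj_def by auto
  note 1 = card_swap_Int[OF finite_base[OF B(1)] d(1,2), of X]
    card_swap_Int[OF finite_base[OF B(1)] d(1,2), of Y]
    base_card_Int_le[OF d(3), of X] base_card_Int_le[OF d(3), of Y]
  then show "level e \<le> level b" using B unfolding level_def by (auto split: if_splits)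
  show "insert e (B - {b}) \<in> \<F> \<longleftrightarrow> level b = level e"
    using 1 B d(3) unfolding level_def face_def tight_def by (auto split: if_splits)
qed

text \<open>Equivalence under all separators of the face: the connected components of the matroid
  whose bases are \<open>\<F>\<close>, described without reference to any of its bases.\<close>

definition separator :: "'a set \<Rightarrow> bool" where
  "separator Z \<longleftrightarrow> (\<forall>B\<in>\<F>. \<forall>B'\<in>\<F>. card (B \<inter> Z) = card (B' \<inter> Z))"

definition same_piece :: "'a \<Rightarrow> 'a \<Rightarrow> bool" (infix \<open>\<doteq>\<close> 50) where
  "u \<doteq> v \<longleftrightarrow> (\<forall>Z. separator Z \<longrightarrow> (u \<in> Z \<longleftrightarrow> v \<in> Z))"

lemma same_piece_refl [simp]: "u \<doteq> u"
  and same_piece_sym: "u \<doteq> v \<Longrightarrow> v \<doteq> u"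
  and same_piece_trans: "u \<doteq> v \<Longrightarrow> v \<doteq> w \<Longrightarrow> u \<doteq> w"
  unfolding same_piece_def by auto

lemma same_piece_level: "u \<doteq> v \<Longrightarrow> level u = level v"
proof -
  have "separator X" "separator Y" unfolding separator_def face_def tight_def by auto
  then show "u \<doteq> v \<Longrightarrow> level u = level v" unfolding same_piece_def level_def by auto
qed

lemma swap_same_piece:
  assumes "B \<in> \<F>" "b \<in> B" "e \<notin> B" "insert e (B - {b}) \<in> \<F>"
  shows "b \<doteq> e"
  unfolding same_piece_def
proof (intro allI impI)
  fix Z assume "separator Z"
  then have "card (insert e (B - {b}) \<inter> Z) = card (B \<inter> Z)"
    using assms unfolding separator_def by blast
  then show "b \<in> Z \<longleftrightarrow> e \<in> Z"
    using card_swap_Int[OF finite_base[OF face_base[OF assms(1)]] assms(2,3), of Z]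
    by (simp add: of_bool_def split: if_splits)
qed

lemma adj_same_piece_iff:
  assumes "B \<in> \<F>" "adj B b e"
  shows "b \<doteq> e \<longleftrightarrow> level b = level e" "b \<doteq> e \<longleftrightarrow> insert e (B - {b}) \<in> \<F>"
  using assms adj_level[OF assms] swap_same_piece[OF assms(1)] same_piece_level
  unfolding adj_def by blast+

lemma adj_level_less:
  assumes "B \<in> \<F>" "adj B b e" "\<not> b \<doteq> e" shows "level e < level b"
  using adj_level(1)[OF assms(1,2)] adj_same_piece_iff(1)[OF assms(1,2)] assms(3) by auto

definition linked :: "'a set \<Rightarrow> 'a \<Rightarrow> 'a \<Rightarrow> bool" where
  "linked B u v \<longleftrightarrow> adj B u v \<or> adj B v u"

lemma linked_sym: "linked B u v \<Longrightarrow> linked B v u"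
  unfolding linked_def by auto

text \<open>The element \<open>b\<close> is no coloop of \<open>M\<close>, so by the covering
  assumption some face basis avoids it. Exchanging \<open>b\<close> towards that basis stays in the
  face and therefore in the piece of \<open>b\<close>.\<close>

lemma partner_of_base_element:
  assumes B: "B \<in> \<F>" and be: "adj B b e"
  shows "\<exists>e'. adj B b e' \<and> b \<doteq> e'"
proof -
  have b: "b \<in> B" "insert e (B - {b}) \<in> bases M" "b \<notin> insert e (B - {b})"
    using be unfolding adj_def by auto
  then have "b \<notin> \<Inter>(bases M)" by blast
  then have "b \<notin> \<Inter>\<F>" using covered unfolding covered_def by blast
  then obtain B' where B': "B' \<in> \<F>" "b \<notin> B'" by blast
  obtain x where x: "x \<in> B'" "x \<notin> B" "insert x (B - {b}) \<in> \<F>"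
    by (rule symmetric_exchangeE[OF symmetric_exchange_face B B'(1) b(1) B'(2)])
  have "x \<in> E" using x(1) base_subset_ground[OF face_base[OF B'(1)]] by blast
  then have "adj B b x" using x b face_base unfolding adj_def by simp
  then show ?thesis using swap_same_piece[OF B b(1) x(2,3)] by blast
qed

text \<open>Dual argument: \<open>e\<close> is no loop of \<open>M\<close>, so some face basis
  contains it.\<close>

lemma partner_of_cobase_element:
  assumes B: "B \<in> \<F>" and be: "adj B b e"
  shows "\<exists>b'. adj B b' e \<and> b' \<doteq> e"
proof -
  have e: "e \<notin> B" "insert e (B - {b}) \<in> bases M" "e \<in> insert e (B - {b})"
    using be unfolding adj_def by auto
  then have "e \<in> \<Union>(bases M)" by blast
  then have "e \<in> \<Union>\<F>" using covered unfolding covered_def by blast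
  then obtain B' where B': "B' \<in> \<F>" "e \<in> B'" by blast
  obtain x where x: "x \<in> B" "x \<notin> B'" "insert e (B - {x}) \<in> \<F>"
    by (rule symmetric_exchangeE[OF symmetric_exchange_face B'(1) B B'(2) e(1)])
  then have "adj B x e" using e be face_base unfolding adj_def by simp
  then show ?thesis using swap_same_piece[OF B x(1) e(1) x(3)] by blast
qed

definition edge :: "'a set \<Rightarrow> 'a \<Rightarrow> 'a \<Rightarrow> bool" where
  "edge B b e \<longleftrightarrow> adj B b e \<and> b \<doteq> e"

lemma linked_edge:
  assumes B: "B \<in> \<F>" and "linked B u v"
  shows "\<exists>b e. edge B b e \<and> (u = b \<or> u = e)"
  using assms partner_of_base_element[OF B] partner_of_cobase_element[OF B]
  unfolding linked_def edge_def by blast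

text \<open>The set reached from \<open>u\<close> along links inside pieces is crossed by no swap
  within the face. By \<open>crossing_swap\<close> it meets all bases of the face equally often, so
  it is a separator, and a separator cannot contain \<open>u\<close> without
  \<open>v\<close>.\<close>

lemma same_piece_reach:
  assumes B: "B \<in> \<F>" and uv: "u \<doteq> v"
  shows "(u, v) \<in> {(x, y). linked B x y \<and> x \<doteq> y}\<^sup>*" (is "_ \<in> ?R\<^sup>*")
proof -
  let ?Z = "{w. (u, w) \<in> ?R\<^sup>*}"
  have step: "x \<in> ?Z \<longleftrightarrow> y \<in> ?Z" if "(x, y) \<in> ?R" for x y
  proof -
    have "(y, x) \<in> ?R" using that linked_sym same_piece_sym by blast
    then show ?thesis using that by (auto intro: rtrancl_into_rtrancl)
  qed
  have sw: "b \<in> ?Z \<longleftrightarrow> e \<in> ?Z" if "b \<in> B" "e \<in> E" "e \<notin> B" "insert e (B - {b}) \<in> \<F>" for b e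
  proof (rule step)
    have "adj B b e" using that face_base unfolding adj_def by simp
    then show "(b, e) \<in> ?R" using swap_same_piece[OF B that(1,3,4)] unfolding linked_def by simp
  qed
  have sub: "\<F> \<subseteq> bases M" using face_base by blast
  \<comment> \<open>\<open>crossing_swap\<close> yields one inequality only; applying it to the
    complement as well and using equal basis sizes gives equality.\<close>
  have ge: "card (B \<inter> Z) \<le> card (B' \<inter> Z)" if B': "B' \<in> \<F>" and Z: "Z = ?Z \<or> Z = - ?Z" for B' Z
  proof (rule ccontr)
    assume "\<not> card (B \<inter> Z) \<le> card (B' \<inter> Z)"
    then have "card (B' \<inter> Z) < card (B \<inter> Z)" by simp
    then obtain b e where be: "b \<in> B" "b \<in> Z" "e \<in> E" "e \<notin> B" "e \<notin> Z" "insert e (B - {b}) \<in> \<F>"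
      using crossing_swap[OF symmetric_exchange_face sub B B'] by blast
    from Z show False using sw[OF be(1,3,4,6)] be(2,5) by (elim disjE) simp_all
  qed
  have eq: "card (B' \<inter> ?Z) = card (B \<inter> ?Z)" if B': "B' \<in> \<F>" for B'
  proof -
    have split: "card A = card (A \<inter> ?Z) + card (A \<inter> - ?Z)" if "finite A" for A
      using that card_Int_Diff[of A ?Z] by (simp add: Diff_eq)
    have "card B' = card B" using B B' face_base base_card by simp
    moreover have "finite B" "finite B'" using B B' face_base finite_base by auto
    ultimately have "card (B' \<inter> ?Z) + card (B' \<inter> - ?Z) = card (B \<inter> ?Z) + card (B \<inter> - ?Z)"
      using split[of B] split[of B'] by simp
    then show ?thesis using ge[OF B', of ?Z] ge[OF B', of "- ?Z"] by auto
  qed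
  then have "separator ?Z" unfolding separator_def by simp
  then have "u \<in> ?Z \<longleftrightarrow> v \<in> ?Z" using uv unfolding same_piece_def by blast
  then show ?thesis by simp
qed

text \<open>The vertices \<open>p 1\<close>, ..., \<open>p m\<close> lie in the middle piece,
  \<open>p 0\<close> and \<open>p (Suc m)\<close> in two further pieces; so \<open>m\<close> counts
  inner vertices, not links.\<close>

definition piece_path :: "'a set \<Rightarrow> (nat \<Rightarrow> 'a) \<Rightarrow> nat \<Rightarrow> bool" where
  "piece_path B p m \<longleftrightarrow> B \<in> \<F> \<and> 1 \<le> m \<and> (\<forall>i\<le>m. linked B (p i) (p (Suc i))) \<and>
     (\<forall>i. 1 \<le> i \<longrightarrow> i \<le> m \<longrightarrow> p i \<doteq> p 1) \<and>
     \<not> p 0 \<doteq> p 1 \<and> \<not> p (Suc m) \<doteq> p 1 \<and> \<not> p 0 \<doteq> p (Suc m)"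

lemma piece_path_if:
  assumes "B \<in> \<F>" "1 \<le> m" "\<And>i. i \<le> m \<Longrightarrow> linked B (p i) (p (Suc i))"
    and inner: "\<And>i. 1 \<le> i \<Longrightarrow> i \<le> m \<Longrightarrow> p i \<doteq> c"
    and ends: "\<not> p 0 \<doteq> c" "\<not> p (Suc m) \<doteq> c" "\<not> p 0 \<doteq> p (Suc m)"
  shows "piece_path B p m"
proof -
  have c: "c \<doteq> p 1" using inner[of 1] assms(2) same_piece_sym by simp
  have "\<not> p 0 \<doteq> p 1" "\<not> p (Suc m) \<doteq> p 1"
    using ends c same_piece_sym same_piece_trans by blast+
  moreover have "p i \<doteq> p 1" if "1 \<le> i" "i \<le> m" for i
    using inner[OF that] c same_piece_trans by blast
  ultimately show ?thesis using assms unfolding piece_path_def by simp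
qed

lemma piece_pathI:
  assumes B: "B \<in> \<F>" and l: "linked B u v" "linked B w z" and n: "\<not> u \<doteq> v" "\<not> w \<doteq> z" "\<not> u \<doteq> z"
    and vw: "v \<doteq> w"
  shows "\<exists>p m. piece_path B p m"
proof -
  let ?R = "{(x, y). linked B x y \<and> x \<doteq> y}"
  obtain n where "(v, w) \<in> ?R ^^ n" using same_piece_reach[OF B vw] rtrancl_imp_relpow by blast
  then obtain f where f: "f 0 = v" "f n = w" "\<And>i. i < n \<Longrightarrow> (f i, f (Suc i)) \<in> ?R"
    unfolding relpow_fun_conv by blast
  have fv: "f i \<doteq> v" if "i \<le> n" for i
    using that
  proof (induction i)
    case (Suc i)
    then have "f i \<doteq> f (Suc i)" using f(3)[of i] by simp
    then show ?case using Suc same_piece_sym same_piece_trans by (metis Suc_leD)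
  qed (simp add: f)
  \<comment> \<open>The inner path \<open>f 0\<close>, ..., \<open>f n\<close> is shifted by one to
    make room for \<open>u\<close> at position 0, so there are \<open>Suc n\<close> inner
    vertices.\<close>
  define p where "p = (\<lambda>i. if i = 0 then u else if i \<le> Suc n then f (i - 1) else z)"
  have "linked B (p i) (p (Suc i))" if "i \<le> Suc n" for i
  proof -
    consider "i = 0" | "0 < i" "i \<le> n" | "i = Suc n" using \<open>i \<le> Suc n\<close> by linarith
    then show ?thesis
    proof cases
      case 2
      then have "(f (i - 1), f (Suc (i - 1))) \<in> ?R" by (intro f(3)) simp
      then show ?thesis using 2 unfolding p_def by simp
    qed (use l f in \<open>simp_all add: p_def\<close>)
  qed
  moreover have "\<not> z \<doteq> v" using n(2) vw same_piece_sym same_piece_trans by blast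
  ultimately have "piece_path B p (Suc n)"
    using B n(1,3) fv f(1) unfolding piece_path_def p_def by auto
  then show ?thesis by blast
qed

text \<open>A shortest path is chordless, and pivoting on its first inner edge would make its two outer
  neighbours adjacent; hence at most two of its vertices lie in the middle piece.\<close>

lemma short_piece_path:
  assumes "piece_path B p m"
  shows "\<exists>B p m. piece_path B p m \<and> m \<le> 2"
proof -
  define Q where "Q m \<longleftrightarrow> (\<exists>B p. piece_path B p m)" for m
  have "Q m" using assms unfolding Q_def by blast
  define k where "k = (LEAST m. Q m)"
  have "Q k" unfolding k_def using \<open>Q m\<close> by (rule LeastI)
  have least: "k \<le> m" if "piece_path B p m" for B p m
    unfolding k_def using that by (intro Least_le) (auto simp: Q_def)
  from \<open>Q k\<close> obtain B p where path: "piece_path B p k" unfolding Q_def by blast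
  have "k \<le> 2"
  proof (rule ccontr)
    assume "\<not> k \<le> 2"
    then have k3: "3 \<le> k" by simp
    have B: "B \<in> \<F>" and l: "\<And>i. i \<le> k \<Longrightarrow> linked B (p i) (p (Suc i))"
      and inner: "\<And>i. 1 \<le> i \<Longrightarrow> i \<le> k \<Longrightarrow> p i \<doteq> p 1"
      and ends: "\<not> p 0 \<doteq> p 1" "\<not> p (Suc k) \<doteq> p 1" "\<not> p 0 \<doteq> p (Suc k)"
      using path unfolding piece_path_def by auto
    have BM: "B \<in> bases M" using face_base[OF B] .
    have chordless: "\<not> linked B (p i) (p j)"
      if ij: "Suc (Suc i) \<le> j" "j \<le> Suc k" "(i, j) \<noteq> (0, Suc k)" for i j
    proof
      assume c: "linked B (p i) (p j)"
      \<comment> \<open>The chord bypasses the \<open>d\<close> vertices strictly between positions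
        \<open>i\<close> and \<open>j\<close>. The excluded pair of both ends is the only one that
        would leave no inner vertex.\<close>
      define d where "d = j - Suc i"
      define q where "q = (\<lambda>n. if n \<le> i then p n else p (n + d))"
      have d: "1 \<le> d" "d < k" "j = Suc i + d" using ij unfolding d_def by auto
      have "linked B (q n) (q (Suc n))" if "n \<le> k - d" for n
      proof -
        consider "n < i" | "n = i" | "i < n" by linarith
        then show ?thesis
        proof cases
          case 1
          then show ?thesis using l[of n] ij d unfolding q_def by simp
        next
          case 2
          then show ?thesis using c d unfolding q_def by simp
        next
          case 3
          then show ?thesis using l[of "n + d"] that d unfolding q_def by simp
        qed
      qed
      moreover have q: "q n \<doteq> p 1" if "1 \<le> n" "n \<le> k - d" for n
        using inner[of n] inner[of "n + d"] that d ij unfolding q_def by auto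
      moreover have "q 0 = p 0" "q (Suc (k - d)) = p (Suc k)"
        using d ij unfolding q_def by auto
      ultimately have "piece_path B q (k - d)"
        using B ends d by (intro piece_path_if[where c = "p 1"]) simp_all
      then show False using least[of B q "k - d"] d by simp
    qed
    have l01: "linked B (p 0) (p 1)" and l12: "linked B (p 1) (p 2)" and l23: "linked B (p 2) (p 3)"
      using l[of 0] l[of 1] l[of 2] k3 by (simp_all add: numeral_2_eq_2 numeral_3_eq_3)
    have "p 2 \<doteq> p 1" "p 3 \<doteq> p 1" using inner k3 by simp_all
    \<comment> \<open>Since \<open>k\<close> is at least 3, \<open>p 3\<close> is still an inner
      vertex, so the pair 0, 3 is among the forbidden chords.\<close>
    have n03: "\<not> linked B (p 0) (p 3)" using chordless[of 0 3] k3 by simp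
    have n1: "\<not> linked B (p 1) (p i)" if "3 \<le> i" "i \<le> Suc k" for i
      using chordless[of 1 i] that by simp
    have ne: "p i \<noteq> p 1" "p i \<noteq> p 2" if i: "3 \<le> i" "i \<le> Suc k" for i
    proof -
      show "p i \<noteq> p 2" using n1[OF i] l12 by metis
      show "p i \<noteq> p 1"
      proof (cases "i = Suc k")
        case False
        then have "\<not> linked B (p 0) (p i)" using chordless[of 0 i] i by simp
        then show ?thesis using l01 by metis
      qed (use ends in auto)
    qed
    have ne0: "p 0 \<noteq> p 1" "p 0 \<noteq> p 2"
      using ends \<open>p 2 \<doteq> p 1\<close> by auto
    obtain b e where be: "adj B b e" "b = p 1 \<and> e = p 2 \<or> b = p 2 \<and> e = p 1"
      using l12 unfolding linked_def by blast
    \<comment> \<open>The pivot runs along an edge inside the middle piece, so the new basis stays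
      in the face and the pieces are the same as before.\<close>
    define B' where "B' = insert e (B - {b})"
    have "b \<doteq> e" using be(2) \<open>p 2 \<doteq> p 1\<close> same_piece_sym by blast
    then have B': "B' \<in> \<F>" using adj_same_piece_iff(2)[OF B be(1)] unfolding B'_def by simp
    have bB: "b \<in> B" "e \<notin> B" using be(1) unfolding adj_def by auto
    have "linked B' (p 0) (p 3)"
      using be(2)
    proof
      assume h: "b = p 1 \<and> e = p 2"
      have "adj B b (p 0)" "adj B (p 3) e"
        using l01 l23 h bB unfolding linked_def adj_def by auto
      then have "adj B' (p 3) (p 0)"
        using adj_pivot_new[OF BM be(1), of "p 0" "p 3"] n03 unfolding B'_def linked_def by blast
      then show ?thesis unfolding linked_def by simp
    next
      assume h: "b = p 2 \<and> e = p 1"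
      have "adj B (p 0) e" "adj B b (p 3)"
        using l01 l23 h bB unfolding linked_def adj_def by auto
      then have "adj B' (p 0) (p 3)"
        using adj_pivot_new[OF BM be(1), of "p 3" "p 0"] n03 unfolding B'_def linked_def by blast
      then show ?thesis unfolding linked_def by simp
    qed
    \<comment> \<open>Links from \<open>p 3\<close> onwards survive the pivot: one end of the pivot
      edge is \<open>p 1\<close>, which has no link to \<open>p i\<close> or
      \<open>p (Suc i)\<close>, so one of the two entries in the pivot correction is zero.\<close>
    moreover have "linked B' (p i) (p (Suc i))" if i: "3 \<le> i" "i \<le> k" for i
    proof -
      have far: "adj B' u v" if uv: "adj B u v" and mem: "u = p i \<and> v = p (Suc i) \<or> v = p i \<and> u = p (Suc i)" for u v
      proof -
        have nl: "\<not> linked B (p 1) u" "\<not> linked B (p 1) v" and "u \<noteq> b" "v \<noteq> e"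
          using mem n1[of i] n1[of "Suc i"] ne[of i] ne[of "Suc i"] be(2) i by auto
        moreover have "u \<in> B" "v \<in> E" "v \<notin> B" using uv unfolding adj_def by auto
        moreover have "\<not> (adj B b v \<and> adj B u e)" using nl be(2) unfolding linked_def by blast
        ultimately show ?thesis using adj_pivot_same[OF BM be(1)] uv unfolding B'_def by blast
      qed
      then show ?thesis using l[of i] i unfolding linked_def by blast
    qed
    \<comment> \<open>Dropping \<open>p 1\<close> and \<open>p 2\<close> leaves \<open>k - 2\<close>
      inner vertices, contrary to minimality.\<close>
    moreover define q where "q = (\<lambda>n. if n = 0 then p 0 else p (n + 2))"
    ultimately have "linked B' (q n) (q (Suc n))" if "n \<le> k - 2" for n
      using that k3 by (auto simp: q_def numeral_3_eq_3)
    moreover have "q n \<doteq> p 1" if "1 \<le> n" "n \<le> k - 2" for n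
      using inner[of "n + 2"] that unfolding q_def by simp
    moreover have "Suc (k - 2) + 2 = Suc k" using k3 by simp
    then have "q 0 = p 0" "q 1 = p 3" "q (Suc (k - 2)) = p (Suc k)"
      unfolding q_def by (simp_all add: numeral_3_eq_3)
    ultimately have "piece_path B' q (k - 2)"
      using B' ends k3 by (intro piece_path_if[where c = "p 1"]) simp_all
    then show False using least[of B' q "k - 2"] k3 by simp
  qed
  with path show ?thesis by blast
qed

end

section \<open>The five matroids and minors on a subset\<close>

lemma card_le_one_Int:
  assumes "finite I" "x \<in> I" "y \<in> I" "x \<in> Z" "y \<in> Z" "card (I \<inter> Z) \<le> 1"
  shows "x = y"
  using card_le_Suc0_iff_eq[of "I \<inter> Z"] assms by auto

text \<open>If no element of \<open>J\<close> augments \<open>I\<close>, counting finds an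
  \<open>e\<close> in \<open>J\<close> that is neither in \<open>I\<close> nor parallel to anything
  in \<open>I\<close>. It must be blocked by a line \<open>L\<close>, so \<open>I\<close> is a pair
  of points on \<open>L\<close>; every other element of \<open>J\<close> is blocked within the same
  line, and \<open>J\<close> has at most two elements after all.\<close>

lemma points_lines_is_matroid:
  fixes \<P> \<L> :: "'a::finite set set"
  assumes r: "r \<le> 3"
    and PP: "\<And>P P'. P \<in> \<P> \<Longrightarrow> P' \<in> \<P> \<Longrightarrow> P \<inter> P' \<noteq> {} \<Longrightarrow> P = P'"
    and PL: "\<And>P L. P \<in> \<P> \<Longrightarrow> L \<in> \<L> \<Longrightarrow> P \<inter> L \<noteq> {} \<Longrightarrow> P \<subseteq> L"
    and LL: "\<And>L L' x y. L \<in> \<L> \<Longrightarrow> L' \<in> \<L> \<Longrightarrow> L \<noteq> L' \<Longrightarrow> {x, y} \<subseteq> L \<inter> L' \<Longrightarrow> x \<noteq> y \<Longrightarrow>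
      \<exists>P\<in>\<P>. {x, y} \<subseteq> P"
  shows "is_matroid (points_lines_matroid r \<P> \<L>)"
proof -
  define indep where "indep = (\<lambda>I::'a set. card I \<le> r \<and> (\<forall>P\<in>\<P>. card (I \<inter> P) \<le> 1) \<and> (\<forall>L\<in>\<L>. card (I \<inter> L) \<le> 2))"
  define par where "par = (\<lambda>x y. \<exists>P\<in>\<P>. {x, y} \<subseteq> P)"
  have par_trans: "par x z" if "par x y" "par y z" for x y z
    using that PP unfolding par_def by blast
  have par_sym: "par x y" if "par y x" for x y
    using that unfolding par_def by (simp add: insert_commute)
  have not_par: "x = y" if "indep I" "x \<in> I" "y \<in> I" "par x y" for I x y
  proof -
    obtain P where "P \<in> \<P>" "x \<in> P" "y \<in> P" using \<open>par x y\<close> unfolding par_def by blast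
    then show ?thesis using that card_le_one_Int[of I x y P] unfolding indep_def by simp
  qed
  have sub: "indep J" if "indep I" "J \<subseteq> I" for I J
  proof -
    have "card (J \<inter> Z) \<le> card (I \<inter> Z)" "card J \<le> card I" for Z
      using that(2) by (auto intro!: card_mono)
    then show ?thesis using that(1) unfolding indep_def by (meson le_trans)
  qed
  have ins: "indep (insert e I)"
    if I: "indep I" "card I < r" "e \<notin> I" and np: "\<And>i. i \<in> I \<Longrightarrow> \<not> par e i"
      and nl: "\<And>L. L \<in> \<L> \<Longrightarrow> e \<in> L \<Longrightarrow> card (I \<inter> L) \<le> 1" for e I
  proof -
    have "card (insert e I \<inter> P) \<le> 1" if P: "P \<in> \<P>" for P
    proof (cases "e \<in> P")
      case True
      then have "insert e I \<inter> P = {e}" using np P unfolding par_def by auto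
      then show ?thesis by simp
    qed (use I(1) P in \<open>auto simp: indep_def\<close>)
    moreover have "card (insert e I \<inter> L) \<le> 2" if L: "L \<in> \<L>" for L
    proof (cases "e \<in> L")
      case True
      then show ?thesis using nl[OF L True] card_insert_le_m1[of 2 "I \<inter> L" e] by simp
    qed (use I(1) L in \<open>auto simp: indep_def\<close>)
    ultimately show ?thesis using I(2,3) unfolding indep_def by simp
  qed
  have aug: "\<exists>e\<in>J - I. indep (insert e I)" if I: "indep I" and J: "indep J" and c: "card I < card J" for I J
  proof (rule ccontr)
    assume no: "\<not> (\<exists>e\<in>J - I. indep (insert e I))"
    have Jr: "card J \<le> r" using J unfolding indep_def by simp
    have bad: "(\<exists>i\<in>I. par e i) \<or> (\<exists>L\<in>\<L>. e \<in> L \<and> 2 \<le> card (I \<inter> L))" if "e \<in> J" "e \<notin> I" for e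
    proof (rule ccontr)
      assume h: "\<not> ?thesis"
      have "indep (insert e I)"
      proof (rule ins[OF I])
        show "card I < r" using c Jr by simp
        show "\<not> par e i" if "i \<in> I" for i using h that by blast
        show "card (I \<inter> L) \<le> 1" if "L \<in> \<L>" "e \<in> L" for L
          using h that by (metis not_less_eq_eq numeral_2_eq_2 One_nat_def)
      qed (use that in simp)
      then show False using no that by blast
    qed
    have small: "card (I \<inter> L) \<le> card I" for L by (intro card_mono) auto
    define near where "near = (\<lambda>i. {e \<in> J. e = i \<or> par e i})"
    have near: "card (near i) \<le> 1" for i
    proof -
      have "x = y" if "x \<in> near i" "y \<in> near i" for x y
        using that not_par[OF J, of x y] par_trans[of x i y] par_sym unfolding near_def by blast
      then show ?thesis by (simp add: card_le_Suc0_iff_eq)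
    qed
    have all_near: "card J \<le> card I" if "J \<subseteq> (\<Union>i\<in>I. near i)"
    proof -
      have "card J \<le> card (\<Union>i\<in>I. near i)" using that by (intro card_mono) auto
      also have "\<dots> \<le> (\<Sum>i\<in>I. card (near i))" by (intro card_UN_le) auto
      also have "\<dots> \<le> (\<Sum>i\<in>I. 1)" using near by (intro sum_mono)
      finally show ?thesis by simp
    qed
    have "\<not> J \<subseteq> (\<Union>i\<in>I. near i)" using all_near c by auto
    then obtain e where e: "e \<in> J" "\<And>i. i \<in> I \<Longrightarrow> e \<noteq> i \<and> \<not> par e i" unfolding near_def by auto
    then obtain L where L: "L \<in> \<L>" "e \<in> L" "2 \<le> card (I \<inter> L)" using bad by blast
    have "card I \<le> 2" using c Jr r by simp
    then have "card (I \<inter> L) = card I" "card I = 2" using small[of L] L by auto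
    then have IL: "I \<subseteq> L" by (metis card_subset_eq finite inf.absorb_iff2 inf.cobounded1 inf_commute)
    obtain i k where ik: "I = {i, k}" "i \<noteq> k" using \<open>card I = 2\<close> by (auto simp: card_2_iff)
    have "J \<subseteq> L"
    proof
      fix f assume f: "f \<in> J"
      show "f \<in> L"
      proof (cases "f \<in> I")
        case False
        from bad[OF f False] show ?thesis
        proof
          assume "\<exists>i\<in>I. par f i"
          then show ?thesis using IL PL[OF _ L(1)] unfolding par_def by blast
        next
          assume "\<exists>L'\<in>\<L>. f \<in> L' \<and> 2 \<le> card (I \<inter> L')"
          then obtain L' where L': "L' \<in> \<L>" "f \<in> L'" "2 \<le> card (I \<inter> L')" by blast
          then have "card (I \<inter> L') = card I" using small[of L'] \<open>card I = 2\<close> by simp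
          then have "I \<subseteq> L'" by (metis card_subset_eq finite inf.absorb_iff2 inf.cobounded1 inf_commute)
          moreover have "\<not> par i k" using not_par[OF I, of i k] ik by auto
          ultimately have "L' = L" using LL[OF L'(1) L(1), of i k] IL ik unfolding par_def by blast
          then show ?thesis using L' by simp
        qed
      qed (use IL in blast)
    qed
    then have "J \<inter> L = J" by blast
    moreover have "card (J \<inter> L) \<le> 2" using J L(1) unfolding indep_def by blast
    ultimately show False using c \<open>card I = 2\<close> by simp
  qed
  have e: "indep {}" unfolding indep_def by simp
  have "indeps (points_lines_matroid r \<P> \<L>) = {I. indep I}" "ground (points_lines_matroid r \<P> \<L>) = UNIV"
    unfolding points_lines_matroid_def indep_def by simp_all
  then show ?thesis unfolding is_matroid_def using e sub aug by auto
qed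

lemma is_matroid_MW2: "is_matroid MW2"
  and is_matroid_S1: "is_matroid S1"
  and is_matroid_S2: "is_matroid S2"
  and is_matroid_S3: "is_matroid S3"
  and is_matroid_S4: "is_matroid S4"
  unfolding MW2_def S1_def S2_def S3_def S4_def
  by (rule points_lines_is_matroid; force)+

lemma vimage_Plus: "I = Inl -` I <+> Inr -` I"
  by (auto simp: Plus_def) (metis rangeI sum.exhaust)

lemma indeps_direct_sum_iff:
  "I \<in> indeps (direct_sum M N) \<longleftrightarrow> Inl -` I \<in> indeps M \<and> Inr -` I \<in> indeps N"
proof
  assume "I \<in> indeps (direct_sum M N)"
  then obtain A B where AB: "I = A <+> B" "A \<in> indeps M" "B \<in> indeps N"
    unfolding direct_sum_def by auto
  have "Inl -` (A <+> B) = A" "Inr -` (A <+> B) = B" by auto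
  then show "Inl -` I \<in> indeps M \<and> Inr -` I \<in> indeps N" using AB by simp
next
  assume "Inl -` I \<in> indeps M \<and> Inr -` I \<in> indeps N"
  then show "I \<in> indeps (direct_sum M N)" using vimage_Plus[of I] unfolding direct_sum_def by auto
qed

lemma direct_sum_is_matroid:
  assumes "is_matroid M" "is_matroid N"
  shows "is_matroid (direct_sum M N)"
proof -
  interpret M: fin_matroid M by (unfold_locales) (rule assms)
  interpret N: fin_matroid N by (unfold_locales) (rule assms)
  note mem = indeps_direct_sum_iff
  show ?thesis
    unfolding is_matroid_def
  proof (intro conjI ballI allI impI)
    show "finite (ground (direct_sum M N))"
      using M.finite_ground N.finite_ground by (simp add: direct_sum_def)
    show "indeps (direct_sum M N) \<subseteq> Pow (ground (direct_sum M N))"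
      using M.indep_subset_ground N.indep_subset_ground by (fastforce simp: direct_sum_def)
    show "{} \<in> indeps (direct_sum M N)" unfolding mem by (simp add: M.indep_empty N.indep_empty)
    show "J \<in> indeps (direct_sum M N)" if "I \<in> indeps (direct_sum M N)" "J \<subseteq> I" for I J
      using that M.indep_subset[of "Inl -` I" "Inl -` J"] N.indep_subset[of "Inr -` I" "Inr -` J"]
      unfolding mem by (simp add: vimage_mono)
    fix I J assume I: "I \<in> indeps (direct_sum M N)" and J: "J \<in> indeps (direct_sum M N)"
      and c: "card I < card J"
    have card: "card K = card (Inl -` K) + card (Inr -` K)" if "K \<in> indeps (direct_sum M N)" for K
      using that vimage_Plus[of K] card_Plus[of "Inl -` K" "Inr -` K"] M.finite_indep N.finite_indep
      unfolding mem by simp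
    from c card[OF I] card[OF J]
    have "card (Inl -` I) < card (Inl -` J) \<or> card (Inr -` I) < card (Inr -` J)" by linarith
    then show "\<exists>e\<in>J - I. insert e I \<in> indeps (direct_sum M N)"
    proof
      assume "card (Inl -` I) < card (Inl -` J)"
      then obtain e where "e \<in> Inl -` J - Inl -` I" "insert e (Inl -` I) \<in> indeps M"
        using M.augment I J unfolding mem by blast
      moreover have "Inl -` insert (Inl e) I = insert e (Inl -` I)" "Inr -` insert (Inl e) I = Inr -` I"
        by auto
      ultimately show ?thesis using I unfolding mem by (intro bexI[of _ "Inl e"]) auto
    next
      assume "card (Inr -` I) < card (Inr -` J)"
      then obtain e where "e \<in> Inr -` J - Inr -` I" "insert e (Inr -` I) \<in> indeps N"
        using N.augment I J unfolding mem by blast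
      moreover have "Inr -` insert (Inr e) I = insert e (Inr -` I)" "Inl -` insert (Inr e) I = Inl -` I"
        by auto
      ultimately show ?thesis using I unfolding mem by (intro bexI[of _ "Inr e"]) auto
    qed
  qed
qed

lemma is_matroid_S0: "is_matroid S0"
  unfolding S0_def by (intro direct_sum_is_matroid is_matroid_MW2)

lemma UNIV_elt6: "(UNIV :: elt6 set) = {Elt_a, Elt_b, Elt_c, Elt_d, Elt_x, Elt_y}"
  by (auto intro: elt6.exhaust)

lemma UNIV_elt4: "(UNIV :: elt4 set) = {Elt4_p, Elt4_p', Elt4_q, Elt4_r}"
  by (auto intro: elt4.exhaust)

text \<open>Replaces a statement about all triples by twenty closed instances, which simplification
  can evaluate once the six names are assigned.\<close>

lemma all_elt6_triples:
  assumes "card (J :: elt6 set) = 3"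
    "P {Elt_a, Elt_b, Elt_c}" "P {Elt_a, Elt_b, Elt_d}" "P {Elt_a, Elt_b, Elt_x}" "P {Elt_a, Elt_b, Elt_y}"
    "P {Elt_a, Elt_c, Elt_d}" "P {Elt_a, Elt_c, Elt_x}" "P {Elt_a, Elt_c, Elt_y}"
    "P {Elt_a, Elt_d, Elt_x}" "P {Elt_a, Elt_d, Elt_y}" "P {Elt_a, Elt_x, Elt_y}"
    "P {Elt_b, Elt_c, Elt_d}" "P {Elt_b, Elt_c, Elt_x}" "P {Elt_b, Elt_c, Elt_y}"
    "P {Elt_b, Elt_d, Elt_x}" "P {Elt_b, Elt_d, Elt_y}" "P {Elt_b, Elt_x, Elt_y}"
    "P {Elt_c, Elt_d, Elt_x}" "P {Elt_c, Elt_d, Elt_y}" "P {Elt_c, Elt_x, Elt_y}"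
    "P {Elt_d, Elt_x, Elt_y}"
  shows "P J"
proof -
  \<comment> \<open>Listing the members of \<open>J\<close> in a fixed order lets the 64 membership
    cases simplify to explicit sets.\<close>
  define l where "l = filter (\<lambda>v. v \<in> J) [Elt_a, Elt_b, Elt_c, Elt_d, Elt_x, Elt_y]"
  have "x \<in> set [Elt_a, Elt_b, Elt_c, Elt_d, Elt_x, Elt_y]" for x by (cases x) simp_all
  then have J: "set l = J" unfolding l_def set_filter by blast
  have "distinct l" unfolding l_def by (intro distinct_filter) simp
  then have "length l = 3" using assms(1) distinct_card[of l] unfolding J by simp
  moreover have "length l = 3 \<longrightarrow> P (set l)"
    by (cases "Elt_a \<in> J"; cases "Elt_b \<in> J"; cases "Elt_c \<in> J"; cases "Elt_d \<in> J";
        cases "Elt_x \<in> J"; cases "Elt_y \<in> J"; simp add: l_def assms(2-))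
  ultimately show ?thesis unfolding J by blast
qed

section \<open>Minors cut out by a basis and a set of elements\<close>

context fin_matroid
begin

text \<open>Basis elements outside \<open>W\<close> are contracted and the other outside elements
  deleted, so that \<open>B \<inter> W\<close> is a basis of the minor and the fundamental graph is
  restricted to \<open>W\<close>.\<close>

definition basis_minor :: "'a set \<Rightarrow> 'a set \<Rightarrow> 'a matroid" where
  "basis_minor B W = delete (contract M (B - W)) (E - B - W)"

lemma basis_minor:
  assumes "B \<in> bases M" "W \<subseteq> E"
  shows "minor (basis_minor B W) M" "ground (basis_minor B W) = W"
    "I \<in> indeps (basis_minor B W) \<longleftrightarrow> I \<subseteq> W \<and> I \<union> (B - W) \<in> indeps M"
proof -
  have BE: "B \<subseteq> E" using base_subset_ground[OF assms(1)] .
  show "minor (basis_minor B W) M"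
    unfolding minor_def basis_minor_def using BE by (intro exI[of _ "B - W"] exI[of _ "E - B - W"]) auto
  show "ground (basis_minor B W) = W"
    unfolding basis_minor_def delete_def contract_def using BE assms(2) by auto
  have "B - W \<in> indeps M" using indep_subset[OF base_indep[OF assms(1)]] by blast
  then have rC: "r (B - W) = card (B - W)" by (rule rank_indep)
  have iff: "r (I \<union> (B - W)) = card I + r (B - W) \<longleftrightarrow> I \<union> (B - W) \<in> indeps M" if I: "I \<subseteq> W"
  proof -
    have "I \<subseteq> E" "finite (B - W)" "I \<inter> (B - W) = {}"
      using I assms(2) finite_base[OF assms(1)] by auto
    moreover from this(1) have "finite I" "I \<union> (B - W) \<subseteq> E"
      using finite_subset[OF _ finite_ground] BE by auto
    ultimately show ?thesis using indep_iff_rank[of "I \<union> (B - W)"] rC card_Un_disjoint[of I "B - W"] by simp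
  qed
  show "I \<in> indeps (basis_minor B W) \<longleftrightarrow> I \<subseteq> W \<and> I \<union> (B - W) \<in> indeps M"
  proof (cases "I \<subseteq> W")
    case True
    then have "I \<subseteq> E - (B - W)" "I \<inter> (E - B - W) = {}" using assms(2) by auto
    then show ?thesis using iff[OF True] True
      unfolding basis_minor_def delete_def contract_def by simp
  next
    case False
    then obtain x where "x \<in> I" "x \<notin> W" by blast
    then have "\<not> (I \<subseteq> E - (B - W) \<and> I \<inter> (E - B - W) = {})" by blast
    then show ?thesis using False unfolding basis_minor_def delete_def contract_def by auto
  qed
qed

lemma basis_minor_iso:
  fixes g :: "'b \<Rightarrow> 'a"
  assumes B: "B \<in> bases M" and g: "inj g" "range g \<subseteq> E" and S: "ground S = UNIV"
    and iff: "\<And>J. g ` J \<union> (B - range g) \<in> indeps M \<longleftrightarrow> J \<in> indeps S"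
  shows "basis_minor B (range g) \<simeq>\<^sub>m S"
proof -
  define f where "f = inv g"
  have fg: "f (g x) = x" for x unfolding f_def using g(1) by simp
  have "bij_betw f (range g) UNIV"
    unfolding bij_betw_def inj_on_def using fg by (auto simp: image_iff)
  moreover have "I \<in> indeps (basis_minor B (range g)) \<longleftrightarrow> f ` I \<in> indeps S" if I: "I \<subseteq> range g" for I
  proof -
    have "g (f y) = y" if "y \<in> I" for y using that I fg by (metis imageE subsetD)
    then have "g ` f ` I = I" by (simp add: image_image)
    then show ?thesis using iff[of "f ` I"] basis_minor(3)[OF B g(2), of I] I by simp
  qed
  ultimately show ?thesis
    unfolding matroid_iso_def basis_minor(2)[OF B g(2)] S by blast
qed

text \<open>A matroid is determined by its bases, so it suffices to compare sets of full size
  \<open>k\<close>. In the forward direction the set is completed inside \<open>range g\<close>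
  together with the contracted elements, which has full rank because it contains
  \<open>B\<close>.\<close>

lemma indep_by_triples:
  fixes g :: "'b \<Rightarrow> 'a"
  assumes B: "B \<in> bases M" and g: "inj g" and k: "card (B \<inter> range g) = k"
    and S: "is_matroid S" "ground S = UNIV" "mrank S UNIV = k"
    and iff: "\<And>J. card J = k \<Longrightarrow> g ` J \<union> (B - range g) \<in> bases M \<longleftrightarrow> J \<in> indeps S"
    and gE: "range g \<subseteq> E"
  shows "g ` J \<union> (B - range g) \<in> indeps M \<longleftrightarrow> J \<in> indeps S"
proof -
  interpret S: fin_matroid S by unfold_locales (rule S(1))
  let ?C = "B - range g"
  have fin: "finite B" using finite_base[OF B] .
  show ?thesis
  proof
    assume J: "g ` J \<union> ?C \<in> indeps M"
    have "g ` J \<union> ?C \<subseteq> range g \<union> ?C" by blast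
    then obtain I where I: "I \<in> indeps M" "g ` J \<union> ?C \<subseteq> I" "I \<subseteq> range g \<union> ?C" "card I = r (range g \<union> ?C)"
      using indep_extend[OF J] by metis
    have "r E \<le> r (range g \<union> ?C)"
      using card_le_rank[OF base_indep[OF B], of "range g \<union> ?C"] base_card[OF B] by auto
    then have cI: "card I = card B"
      using I(4) card_le_rank[OF I(1) indep_subset_ground[OF I(1)]] base_card[OF B] by simp
    then have IB: "I \<in> bases M" using I(1) base_iff base_card[OF B] by simp
    define K where "K = g -` I"
    have gK: "g ` K = I \<inter> range g" unfolding K_def by auto
    have eq: "g ` K \<union> ?C = I" "I - range g = ?C" using I(2,3) gK by auto
    have "card K = card (I \<inter> range g)" using gK card_image[of g K] g inj_on_subset by (metis subset_UNIV)
    moreover have "card I = card (I \<inter> range g) + card ?C"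
      using eq(2) card_Int_Diff[OF finite_indep[OF I(1)], of "range g"] by simp
    moreover have "card B = card (B \<inter> range g) + card ?C" using card_Int_Diff[OF fin] by simp
    ultimately have "card K = k" using cI k by simp
    then have "K \<in> indeps S" using iff[of K] IB eq(1) by simp
    moreover have "J \<subseteq> K" using I(2) unfolding K_def by blast
    ultimately show "J \<in> indeps S" by (rule S.indep_subset)
  next
    assume "J \<in> indeps S"
    then obtain K where K: "K \<in> bases S" "J \<subseteq> K" by (rule S.base_extend)
    then have "card K = k" using S.base_card S S.base_indep by simp
    then have "g ` K \<union> ?C \<in> bases M" using iff K S.base_indep by simp
    from base_indep[OF this] show "g ` J \<union> ?C \<in> indeps M"
      by (rule indep_subset) (use K(2) in auto)
  qed
qed

end

section \<open>Minors\<close>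

lemma ground_delete [simp]: "ground (delete M D) = ground M - D"
  and indeps_delete: "I \<in> indeps (delete M D) \<longleftrightarrow> I \<in> indeps M \<and> I \<inter> D = {}"
  by (simp_all add: delete_def)

lemma ground_contract [simp]: "ground (contract M C) = ground M - C"
  by (simp add: contract_def)

lemma mrank_delete: "Z \<inter> D = {} \<Longrightarrow> mrank (delete M D) Z = mrank M Z"
proof -
  assume "Z \<inter> D = {}"
  then have "{I \<in> indeps (delete M D). I \<subseteq> Z} = {I \<in> indeps M. I \<subseteq> Z}"
    by (auto simp: indeps_delete)
  then show ?thesis unfolding mrank_def by simp
qed

lemma delete_insert: "delete M (insert e D) = delete (delete M D) {e}"
  by (auto simp: delete_def)

context fin_matroid
begin

lemma is_matroid_delete: "is_matroid (delete M D)"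
  unfolding is_matroid_def
proof (intro conjI ballI allI impI)
  show "finite (ground (delete M D))" using finite_ground by simp
  show "indeps (delete M D) \<subseteq> Pow (ground (delete M D))"
    using indep_subset_ground by (fastforce simp: indeps_delete)
  show "{} \<in> indeps (delete M D)" by (simp add: indeps_delete indep_empty)
  show "J \<in> indeps (delete M D)" if "I \<in> indeps (delete M D)" "J \<subseteq> I" for I J
    using that indep_subset[of I J] by (auto simp: indeps_delete)
  show "\<exists>e\<in>J - I. insert e I \<in> indeps (delete M D)"
    if "I \<in> indeps (delete M D)" "J \<in> indeps (delete M D)" "card I < card J" for I J
  proof -
    have "I \<in> indeps M" "J \<in> indeps M" using that by (simp_all add: indeps_delete)
    from augment[OF this that(3)] obtain e where e: "e \<in> J - I" "insert e I \<in> indeps M" by blast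
    have "e \<notin> D" using that(2) e(1) by (auto simp: indeps_delete)
    then have "insert e I \<in> indeps (delete M D)" using that(1) e(2) by (simp add: indeps_delete)
    then show ?thesis using e(1) by blast
  qed
qed

text \<open>A fixed maximal independent subset \<open>K\<close> of \<open>C\<close> stands in for
  \<open>C\<close>, turning independence in the contraction into plain independence in
  \<open>M\<close>.\<close>

lemma indep_contract_iff:
  assumes C: "C \<subseteq> E" and K: "K \<in> indeps M" "K \<subseteq> C" "card K = r C"
  shows "I \<in> indeps (contract M C) \<longleftrightarrow> I \<subseteq> E - C \<and> I \<union> K \<in> indeps M"
proof (cases "I \<subseteq> E - C")
  case True
  have "C \<subseteq> cl K" using spans_if_card_eq_rank K C by blast
  then have "C \<subseteq> cl (I \<union> K)" using cl_mono[of K "I \<union> K"] by blast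
  then have "r (I \<union> C) = r (I \<union> K)"
    using rank_Un_cl[of C "I \<union> K"] K(2) by (simp add: Un_assoc sup.absorb2)
  moreover have "card (I \<union> K) = card I + card K"
    using True K finite_indep[OF K(1)] finite_ground by (intro card_Un_disjoint) (auto intro: finite_subset)
  moreover have "I \<union> K \<in> indeps M \<longleftrightarrow> r (I \<union> K) = card (I \<union> K)"
    using True K(2) C by (intro indep_iff_rank) blast
  ultimately show ?thesis using True K(3) unfolding contract_def by simp
qed (simp add: contract_def)

lemma is_matroid_contract:
  assumes C: "C \<subseteq> E" shows "is_matroid (contract M C)"
proof -
  obtain K where K: "K \<in> indeps M" "K \<subseteq> C" "card K = r C" by (rule rank_witness)
  note iff = indep_contract_iff[OF C K]
  show ?thesis
    unfolding is_matroid_def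
  proof (intro conjI ballI allI impI)
    show "finite (ground (contract M C))" using finite_ground by simp
    show "indeps (contract M C) \<subseteq> Pow (ground (contract M C))" using iff by auto
    show "{} \<in> indeps (contract M C)" using K by (simp add: iff)
    show "J \<in> indeps (contract M C)" if "I \<in> indeps (contract M C)" "J \<subseteq> I" for I J
    proof -
      have "I \<union> K \<in> indeps M" "I \<subseteq> E - C" using that(1) by (simp_all add: iff)
      moreover have "J \<union> K \<subseteq> I \<union> K" using that(2) by blast
      ultimately show ?thesis using that(2) indep_subset unfolding iff by blast
    qed
    show "\<exists>e\<in>J - I. insert e I \<in> indeps (contract M C)"
      if I: "I \<in> indeps (contract M C)" and J: "J \<in> indeps (contract M C)" and c: "card I < card J" for I J
    proof -
      have ind: "I \<union> K \<in> indeps M" "J \<union> K \<in> indeps M" and sub: "I \<subseteq> E - C" "J \<subseteq> E - C"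
        using I J by (simp_all add: iff)
      have "finite K" "finite I" "finite J"
        using finite_indep[OF ind(1)] finite_indep[OF ind(2)] by simp_all
      moreover have "I \<inter> K = {}" "J \<inter> K = {}" using sub K(2) by auto
      ultimately have "card (I \<union> K) < card (J \<union> K)" using c by (simp add: card_Un_disjoint)
      then obtain e where e: "e \<in> J \<union> K - (I \<union> K)" "insert e (I \<union> K) \<in> indeps M"
        using augment[OF ind] by blast
      then have "insert e I \<in> indeps (contract M C)" using sub unfolding iff by auto
      then show ?thesis using e by blast
    qed
  qed
qed

lemma mrank_contract:
  assumes C: "C \<subseteq> E" and Z: "Z \<subseteq> E - C"
  shows "mrank (contract M C) Z + r C = r (Z \<union> C)"
proof -
  interpret N: fin_matroid "contract M C" by unfold_locales (rule is_matroid_contract[OF C])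
  obtain K where K: "K \<in> indeps M" "K \<subseteq> C" "card K = r C" by (rule rank_witness)
  note iff = indep_contract_iff[OF C K]
  have fK: "finite K" by (rule finite_indep[OF K(1)])
  show ?thesis
  proof (rule antisym)
    obtain I where I: "I \<in> indeps (contract M C)" "I \<subseteq> Z" "card I = mrank (contract M C) Z"
      by (rule N.rank_witness)
    then have ind: "I \<union> K \<in> indeps M" by (simp add: iff)
    have "card (I \<union> K) = card I + card K"
      using finite_indep[OF ind] I(2) Z K(2) by (intro card_Un_disjoint) auto
    moreover have "card (I \<union> K) \<le> r (Z \<union> C)" using ind I(2) K(2) by (intro card_le_rank) auto
    ultimately show "mrank (contract M C) Z + r C \<le> r (Z \<union> C)" using I(3) K(3) by simp
  next
    have "K \<subseteq> Z \<union> C" using K(2) by blast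
    then obtain J where J: "J \<in> indeps M" "K \<subseteq> J" "J \<subseteq> Z \<union> C" "card J = r (Z \<union> C)"
      by (rule indep_extend[OF K(1)])
    have fJ: "finite J" by (rule finite_indep[OF J(1)])
    have "J \<inter> C \<in> indeps M" using indep_subset[OF J(1)] by blast
    then have "card (J \<inter> C) \<le> card K" using card_le_rank[of "J \<inter> C" C] K(3) by simp
    then have JC: "J \<inter> C = K" using card_seteq[of "J \<inter> C" K] fJ J(2) K(2) by auto
    then have eq: "(J - C) \<union> K = J" by blast
    have "J - C \<in> indeps (contract M C)" using J(3) Z J(1) unfolding iff eq by auto
    moreover have "J - C \<subseteq> Z" using J(3) by blast
    ultimately have "card (J - C) \<le> mrank (contract M C) Z" by (rule N.card_le_rank)
    moreover have "card J = card K + card (J - C)" using card_Int_Diff[OF fJ, of C] JC by simp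
    ultimately show "r (Z \<union> C) \<le> mrank (contract M C) Z + r C" using J(4) K(3) by simp
  qed
qed

lemma contract_insert:
  assumes C: "insert e C \<subseteq> E" and e: "e \<notin> C"
  shows "contract M (insert e C) = contract (contract M C) {e}"
proof -
  have C': "C \<subseteq> E" using C by blast
  have "r (I \<union> insert e C) = card I + r (insert e C) \<longleftrightarrow>
      mrank (contract M C) (I \<union> {e}) = card I + mrank (contract M C) {e}" if "I \<subseteq> E - C - {e}" for I
  proof -
    have "I \<union> {e} \<subseteq> E - C" "{e} \<subseteq> E - C" using that C e by auto
    note this[THEN mrank_contract[OF C']]
    then show ?thesis by auto
  qed
  moreover have "E - insert e C = E - C - {e}" by blast
  ultimately have "{I. I \<subseteq> E - insert e C \<and> r (I \<union> insert e C) = card I + r (insert e C)} =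
      {I. I \<subseteq> E - C - {e} \<and> mrank (contract M C) (I \<union> {e}) = card I + mrank (contract M C) {e}}"
    by (intro Collect_cong) metis
  then show ?thesis
    unfolding contract_def[of M "insert e C"] contract_def[of "contract M C" "{e}"]
      \<open>E - insert e C = E - C - {e}\<close> ground_contract by (rule arg_cong)
qed

end

lemma is_matroid_minor: "minor N M \<Longrightarrow> is_matroid M \<Longrightarrow> is_matroid N"
  unfolding minor_def by (metis fin_matroid.intro fin_matroid.is_matroid_contract fin_matroid.is_matroid_delete)

lemma minor_refl: "is_matroid M \<Longrightarrow> minor M M"
proof -
  assume "is_matroid M"
  then interpret fin_matroid M by unfold_locales
  have "I \<in> indeps (contract M {}) \<longleftrightarrow> I \<in> indeps M" for I
    using indep_contract_iff[of "{}" "{}" I] indep_empty rank_empty indep_subset_ground by auto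
  then have "delete (contract M {}) {} = M"
    by (intro matroid.equality) (auto simp: indeps_delete contract_def delete_def)
  then show "minor M M" unfolding minor_def by (metis empty_subsetI Int_empty_left)
qed

text \<open>An induction principle that undoes a minor one element at a time: first the deletions,
  for an arbitrary matroid \<open>L\<close>, then the contractions.\<close>

lemma minor_lift_induct:
  assumes M: "is_matroid M" and minor: "minor N M" and N: "P N"
    and c: "\<And>M e. is_matroid M \<Longrightarrow> e \<in> ground M \<Longrightarrow> P (contract M {e}) \<Longrightarrow> P M"
    and d: "\<And>M e. is_matroid M \<Longrightarrow> e \<in> ground M \<Longrightarrow> P (delete M {e}) \<Longrightarrow> P M"
  shows "P M"
proof -
  obtain C D where CD: "C \<subseteq> ground M" "D \<subseteq> ground M" "C \<inter> D = {}" "N = delete (contract M C) D"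
    using minor unfolding minor_def by blast
  interpret fin_matroid M by unfold_locales (rule M)
  have C0: "contract M {} = M"
    using indep_contract_iff[of "{}" "{}"] indep_empty rank_empty indep_subset_ground
    by (intro matroid.equality) (auto simp: contract_def)
  have del: "P L" if "finite D" "is_matroid L" "D \<subseteq> ground L" "P (delete L D)" for L :: "'a matroid" and D
    using that
  proof (induction D)
    case empty
    have "delete L {} = L" by (simp add: delete_def)
    then show ?case using empty by simp
  next
    case (insert e D)
    interpret L: fin_matroid L by unfold_locales (rule insert.prems)
    have "P (delete L D)"
    proof (rule d[OF L.is_matroid_delete])
      show "e \<in> ground (delete L D)" using insert by simp
      show "P (delete (delete L D) {e})" using insert.prems(3) unfolding delete_insert[of L e D] .
    qed
    then show ?case using insert by simp
  qed
  have con: "P M" if "finite C" "C \<subseteq> ground M" "P (contract M C)" for C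
    using that
  proof (induction C)
    case empty
    then show ?case by (simp add: C0)
  next
    case (insert e C)
    have "P (contract M C)"
    proof (rule c)
      show "is_matroid (contract M C)" using insert.prems(1) by (intro is_matroid_contract) simp
      show "e \<in> ground (contract M C)" using insert by simp
      show "P (contract (contract M C) {e})"
        using insert.prems(2) unfolding contract_insert[OF insert.prems(1) insert.hyps(2)] .
    qed
    then show ?case using insert by simp
  qed
  have "P (contract M C)"
    using del[of D "contract M C"] CD N is_matroid_contract[of C] finite_subset[OF _ finite_ground] by auto
  then show "P M" by (rule con[OF finite_subset[OF CD(1) finite_ground] CD(1)])
qed

context fin_matroid
begin

text \<open>Constant intersection makes the ranks of \<open>Z \<inter> E\<close> and
  \<open>E - Z\<close> add up to the rank of \<open>M\<close>. Maximal extensions of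
  \<open>I\<close> and \<open>J\<close> on the two sides then span \<open>E\<close> with the right
  number of elements, so their union is independent.\<close>

lemma separated_indep:
  assumes sep: "\<And>B B'. B \<in> bases M \<Longrightarrow> B' \<in> bases M \<Longrightarrow> card (B \<inter> Z) = card (B' \<inter> Z)"
    and I: "I \<in> indeps M" "I \<subseteq> Z" and J: "J \<in> indeps M" "J \<subseteq> - Z"
  shows "I \<union> J \<in> indeps M"
proof -
  obtain B where B: "B \<in> bases M" using bases_nonempty by blast
  have fB: "finite B" by (rule finite_base[OF B])
  obtain B1 where B1: "B1 \<in> bases M" "card (B1 \<inter> (Z \<inter> E)) = r (Z \<inter> E)" by (rule base_card_Int_eq)
  obtain B2 where B2: "B2 \<in> bases M" "card (B2 \<inter> (E - Z)) = r (E - Z)" by (rule base_card_Int_eq)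
  have split: "card A = card (A \<inter> Z) + card (A \<inter> (E - Z))" if "A \<in> bases M" for A
  proof -
    have "A - Z = A \<inter> (E - Z)" using base_subset_ground[OF that] by blast
    then show ?thesis using card_Int_Diff[OF finite_base[OF that], of Z] by simp
  qed
  have "B1 \<inter> (Z \<inter> E) = B1 \<inter> Z" using base_subset_ground[OF B1(1)] by blast
  then have rZ: "r (Z \<inter> E) = card (B \<inter> Z)" using B1 sep[OF B1(1) B] by simp
  have "card (B2 \<inter> (E - Z)) = card (B \<inter> (E - Z))"
    using split[OF B2(1)] split[OF B] sep[OF B2(1) B] base_card[OF B2(1)] base_card[OF B] by simp
  then have rest: "r (Z \<inter> E) + r (E - Z) = r E" using rZ B2(2) split[OF B] base_card[OF B] by simp
  have "I \<subseteq> Z \<inter> E" "J \<subseteq> E - Z" using I J indep_subset_ground by auto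
  then obtain I' J' where I': "I' \<in> indeps M" "I \<subseteq> I'" "I' \<subseteq> Z \<inter> E" "card I' = r (Z \<inter> E)"
      and J': "J' \<in> indeps M" "J \<subseteq> J'" "J' \<subseteq> E - Z" "card J' = r (E - Z)"
    using indep_extend[OF I(1)] indep_extend[OF J(1)] by metis
  have "Z \<inter> E \<subseteq> cl (I' \<union> J')"
    using spans_if_card_eq_rank[OF I'(1,3,4)] cl_mono[of I' "I' \<union> J'"] by blast
  moreover have "E - Z \<subseteq> cl (I' \<union> J')"
    using spans_if_card_eq_rank[OF J'(1,3,4)] cl_mono[of J' "I' \<union> J'"] by blast
  ultimately have "E \<subseteq> cl (I' \<union> J')" by blast
  then have "r (I' \<union> J' \<union> E) = r (I' \<union> J')" by (rule rank_Un_cl)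
  moreover have sub: "I' \<union> J' \<subseteq> E" using I'(3) J'(3) by blast
  ultimately have "r (I' \<union> J') = card I' + card J'" using rest I'(4) J'(4) by (simp add: sup.absorb2)
  also have "\<dots> = card (I' \<union> J')"
    using I'(1,3) J'(1,3) finite_indep by (subst card_Un_disjoint) auto
  finally have "I' \<union> J' \<in> indeps M" using indep_iff_rank[OF sub] by simp
  then show ?thesis by (rule indep_subset) (use I' J' in blast)
qed

end

section \<open>Minors with three diagonal edges\<close>

lemma mrank_eqI:
  assumes "is_matroid S" "I \<in> indeps S" "card I = k" "\<And>J. J \<in> indeps S \<Longrightarrow> card J \<le> k"
  shows "mrank S UNIV = k"
proof -
  interpret fin_matroid S by unfold_locales (rule assms)
  obtain K where K: "K \<in> indeps S" "K \<subseteq> UNIV" "card K = mrank S UNIV" by (rule rank_witness)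
  have "k \<le> mrank S UNIV" using card_le_rank[OF assms(2), of UNIV] assms(3) by simp
  then show ?thesis using assms(4)[OF K(1)] K(3) by simp
qed

lemma mrank_MW2: "mrank MW2 UNIV = 2"
  by (rule mrank_eqI[OF is_matroid_MW2, of "{Elt4_p, Elt4_q}"]) (auto simp: MW2_def points_lines_matroid_def)

lemma mrank_S1: "mrank S1 UNIV = 3"
  by (rule mrank_eqI[OF is_matroid_S1, of "{Elt_a, Elt_c, Elt_d}"]) (auto simp: S1_def points_lines_matroid_def)

lemma mrank_S2: "mrank S2 UNIV = 3"
  by (rule mrank_eqI[OF is_matroid_S2, of "{Elt_c, Elt_a, Elt_x}"]) (auto simp: S2_def points_lines_matroid_def)

lemma mrank_S3: "mrank S3 UNIV = 3"
  by (rule mrank_eqI[OF is_matroid_S3, of "{Elt_a, Elt_x, Elt_c}"]) (auto simp: S3_def points_lines_matroid_def)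

lemma mrank_S4: "mrank S4 UNIV = 3"
  by (rule mrank_eqI[OF is_matroid_S4, of "{Elt_a, Elt_x, Elt_c}"]) (auto simp: S4_def points_lines_matroid_def)

lemma ground_S: "ground MW2 = UNIV" "ground S0 = UNIV" "ground S1 = UNIV" "ground S2 = UNIV"
    "ground S3 = UNIV" "ground S4 = UNIV"
  by (simp_all add: MW2_def S0_def S1_def S2_def S3_def S4_def points_lines_matroid_def direct_sum_def)

lemma all_elt4_pairs:
  assumes "card (J :: elt4 set) = 2"
    "P {Elt4_p, Elt4_p'}" "P {Elt4_p, Elt4_q}" "P {Elt4_p, Elt4_r}"
    "P {Elt4_p', Elt4_q}" "P {Elt4_p', Elt4_r}" "P {Elt4_q, Elt4_r}"
  shows "P J"
proof -
  define l where "l = filter (\<lambda>v. v \<in> J) [Elt4_p, Elt4_p', Elt4_q, Elt4_r]"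
  have "x \<in> set [Elt4_p, Elt4_p', Elt4_q, Elt4_r]" for x by (cases x) simp_all
  then have J: "set l = J" unfolding l_def set_filter by blast
  have "distinct l" unfolding l_def by (intro distinct_filter) simp
  then have "length l = 2" using assms(1) distinct_card[of l] unfolding J by simp
  moreover have "length l = 2 \<longrightarrow> P (set l)"
    by (cases "Elt4_p \<in> J"; cases "Elt4_p' \<in> J"; cases "Elt4_q \<in> J"; cases "Elt4_r \<in> J";
        simp add: l_def assms(2-))
  ultimately show ?thesis unfolding J by blast
qed

context fin_matroid
begin

lemma swap_two_same:
  assumes B: "B \<in> bases M" and be: "adj B b e" and u: "u \<in> B" "u \<noteq> b" and v: "v \<in> E" "v \<notin> B" "v \<noteq> e"
    and n: "\<not> (adj B b v \<and> adj B u e)"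
  shows "insert v (insert e (B - {b, u})) \<in> bases M \<longleftrightarrow> adj B u v"
proof -
  have "e \<notin> B" using be unfolding adj_def by simp
  then have "insert v (insert e (B - {b}) - {u}) = insert v (insert e (B - {b, u}))" using u by auto
  then show ?thesis
    using adj_pivot_same[OF assms] \<open>e \<notin> B\<close> u v unfolding adj_def by auto
qed

lemma swap_two_new:
  assumes B: "B \<in> bases M" and be: "adj B b e" and bv: "adj B b v" and ue: "adj B u e"
    and uv: "\<not> adj B u v"
  shows "insert v (insert e (B - {b, u})) \<in> bases M"
proof -
  have "u \<in> B" "e \<notin> B" using be ue unfolding adj_def by auto
  then have "insert v (insert e (B - {b}) - {u}) = insert v (insert e (B - {b, u}))" by auto
  then show ?thesis using adj_pivot_new[OF assms] unfolding adj_def by simp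
qed

text \<open>The pattern of a 3 by 3 matrix with full diagonal and zeros below it; the entries above
  the diagonal, from \<open>b1\<close> to \<open>e2\<close> and \<open>e3\<close> and from
  \<open>b2\<close> to \<open>e3\<close>, are left open.\<close>

definition diag3 :: "'a set \<Rightarrow> 'a \<Rightarrow> 'a \<Rightarrow> 'a \<Rightarrow> 'a \<Rightarrow> 'a \<Rightarrow> 'a \<Rightarrow> bool" where
  "diag3 B b1 e1 b2 e2 b3 e3 \<longleftrightarrow> B \<in> bases M \<and> adj B b1 e1 \<and> adj B b2 e2 \<and> adj B b3 e3 \<and>
     \<not> adj B b2 e1 \<and> \<not> adj B b3 e1 \<and> \<not> adj B b3 e2 \<and> distinct [b1, b2, b3, e1, e2, e3]"

text \<open>All twenty triples are determined by the three possible links, except \<open>{b3, e2, e3}\<close> when all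
  links are present; this is what distinguishes \<open>S3\<close> from \<open>S4\<close>.\<close>

lemma diag3_table:
  fixes B b1 e1 b2 e2 b3 e3
  assumes diag: "diag3 B b1 e1 b2 e2 b3 e3"
  defines "t \<equiv> \<lambda>x y z. insert x (insert y (insert z (B - {b1, b2, b3}))) \<in> bases M"
  shows "t b1 b2 b3" "t e1 b2 b3" "t b1 e2 b3" "t b1 b2 e3"
    "t e2 b2 b3 \<longleftrightarrow> adj B b1 e2" "t e3 b2 b3 \<longleftrightarrow> adj B b1 e3" "t b1 e3 b3 \<longleftrightarrow> adj B b2 e3"
    "\<not> t b1 e1 b3" "\<not> t b1 b2 e1" "\<not> t b1 b2 e2"
    "t b1 e2 e3" "\<not> t b1 e1 e2" "\<not> t b1 e1 e3"
    "\<not> t b2 e1 e2" "t b2 e1 e3" "t b2 e2 e3 \<longleftrightarrow> adj B b1 e2"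
    "t b3 e1 e2" "t b3 e1 e3 \<longleftrightarrow> adj B b2 e3"
    "t e1 e2 e3"
    "\<not> (adj B b1 e2 \<and> adj B b2 e3) \<Longrightarrow> t b3 e2 e3 \<longleftrightarrow> adj B b1 e3"
    "adj B b1 e2 \<Longrightarrow> adj B b2 e3 \<Longrightarrow> \<not> adj B b1 e3 \<Longrightarrow> t b3 e2 e3"
proof -
  have B: "B \<in> bases M" and a: "adj B b1 e1" "adj B b2 e2" "adj B b3 e3"
    and na: "\<not> adj B b2 e1" "\<not> adj B b3 e1" "\<not> adj B b3 e2"
    and dist: "distinct [b1, b2, b3, e1, e2, e3]" using diag unfolding diag3_def by auto
  have mem: "b1 \<in> B" "b2 \<in> B" "b3 \<in> B" "e1 \<notin> B" "e2 \<notin> B" "e3 \<notin> B" "e1 \<in> E" "e2 \<in> E" "e3 \<in> E"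
    using a unfolding adj_def by auto
  let ?C = "B - {b1, b2, b3}"
  have C: "B - {b1} = insert b2 (insert b3 ?C)" "B - {b2} = insert b1 (insert b3 ?C)"
    "B - {b3} = insert b1 (insert b2 ?C)" "B - {b1, b2} = insert b3 ?C" "B - {b1, b3} = insert b2 ?C"
    "B - {b2, b3} = insert b1 ?C" "insert b1 (insert b2 (insert b3 ?C)) = B"
    using mem dist by auto
  have C': "B - {b2, b1} = insert b3 ?C" "B - {b3, b1} = insert b2 ?C" "B - {b3, b2} = insert b1 ?C"
    using C by (simp_all add: insert_commute)
  note [simp] = insert_commute
  have adj1: "t v b2 b3 \<longleftrightarrow> adj B b1 v" "t b1 v b3 \<longleftrightarrow> adj B b2 v" "t b1 b2 v \<longleftrightarrow> adj B b3 v"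
    if "v = e1 \<or> v = e2 \<or> v = e3" for v
    using that mem unfolding t_def adj_def C by (auto simp: insert_commute)
  show "t b1 b2 b3" using B C(7) unfolding t_def by simp
  show "t e1 b2 b3" "t b1 e2 b3" "t b1 b2 e3" "t e2 b2 b3 \<longleftrightarrow> adj B b1 e2" "t e3 b2 b3 \<longleftrightarrow> adj B b1 e3"
    "t b1 e3 b3 \<longleftrightarrow> adj B b2 e3" "\<not> t b1 e1 b3" "\<not> t b1 b2 e1" "\<not> t b1 b2 e2"
    using adj1 a na by blast+
  \<comment> \<open>A generic two-element swap: the pivot on \<open>b\<close>, \<open>e\<close>
    leaves the entry at \<open>u\<close>, \<open>v\<close> alone, and \<open>k\<close> names the one
    of the three basis elements that stays.\<close>
  have sw: "t k e v \<longleftrightarrow> adj B u v"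
    if "adj B b e" "u \<in> B" "u \<noteq> b" "v \<in> E" "v \<notin> B" "v \<noteq> e" "\<not> (adj B b v \<and> adj B u e)"
      "B - {b, u} = insert k ?C" for k b e u v
    using swap_two_same[OF B that(1-7)] unfolding that(8) t_def by (simp add: insert_commute)
  have sym: "t x y z = t x z y" for x y z unfolding t_def by (simp add: insert_commute)
  show "t b1 e2 e3" "\<not> t b1 e1 e2" "\<not> t b1 e1 e3"
    using sw[of b2 e2 b3 e3 b1] sw[of b2 e2 b3 e1 b1] sw[of b3 e3 b2 e1 b1] a na mem dist C C' sym by auto
  show "\<not> t b2 e1 e2" "t b2 e1 e3" "t b2 e2 e3 \<longleftrightarrow> adj B b1 e2"
    using sw[of b1 e1 b3 e2 b2] sw[of b1 e1 b3 e3 b2] sw[of b3 e3 b1 e2 b2] a na mem dist C C' sym by auto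
  show "t b3 e1 e2" "t b3 e1 e3 \<longleftrightarrow> adj B b2 e3"
    using sw[of b1 e1 b2 e2 b3] sw[of b1 e1 b2 e3 b3] a na mem dist C C' sym by auto
  show "t b3 e2 e3 \<longleftrightarrow> adj B b1 e3" if "\<not> (adj B b1 e2 \<and> adj B b2 e3)"
    using sw[of b2 e2 b1 e3 b3] a mem dist C' that by auto
  show "t b3 e2 e3" if "adj B b1 e2" "adj B b2 e3" "\<not> adj B b1 e3"
    using swap_two_new[OF B a(2) that(2,1,3)] unfolding C' t_def by (simp add: insert_commute)
  \<comment> \<open>For the full triple, pivot on the first diagonal entry; because column
    \<open>e1\<close> is zero below it, the remaining 2 by 2 block is unchanged.\<close>
  define B' where "B' = insert e1 (B - {b1})"
  have B': "B' \<in> bases M" using a(1) unfolding adj_def B'_def by simp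
  have "adj B' b2 e2" "adj B' b3 e3" "\<not> adj B' b3 e2"
    using adj_pivot_same[OF B a(1), of b2 e2] adj_pivot_same[OF B a(1), of b3 e3]
      adj_pivot_same[OF B a(1), of b3 e2] a na mem dist unfolding B'_def by auto
  then have "insert e3 (insert e2 (B' - {b2, b3})) \<in> bases M"
    using swap_two_same[OF B', of b2 e2 b3 e3] dist mem by (auto simp: adj_def)
  moreover have "B' - {b2, b3} = insert e1 ?C" using mem dist unfolding B'_def by auto
  ultimately show "t e1 e2 e3" unfolding t_def by (simp add: insert_commute)
qed

lemma diag3_iso:
  fixes g :: "elt6 \<Rightarrow> 'a"
  assumes diag: "diag3 B b1 e1 b2 e2 b3 e3" and g: "inj g" "range g = {b1, b2, b3, e1, e2, e3}"
    and S: "is_matroid S" "ground S = UNIV" "mrank S UNIV = 3"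
    and iff: "\<And>J. card J = 3 \<Longrightarrow> g ` J \<union> (B - {b1, b2, b3}) \<in> bases M \<longleftrightarrow> J \<in> indeps S"
  shows "\<exists>N. minor N M \<and> N \<simeq>\<^sub>m S"
proof -
  have B: "B \<in> bases M" using diag unfolding diag3_def by simp
  have mem: "b1 \<in> B" "b2 \<in> B" "b3 \<in> B" "e1 \<notin> B" "e2 \<notin> B" "e3 \<notin> B" "e1 \<in> E" "e2 \<in> E" "e3 \<in> E"
    "distinct [b1, b2, b3]"
    using diag unfolding diag3_def adj_def by auto
  have gE: "range g \<subseteq> E" using g(2) mem base_subset_ground[OF B] by auto
  have 1: "B - range g = B - {b1, b2, b3}" "B \<inter> range g = {b1, b2, b3}" using g(2) mem by auto
  have "card (B \<inter> range g) = 3" using 1 mem by simp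
  from indep_by_triples[OF B g(1) this S _ gE, unfolded 1(1), OF iff]
  have "basis_minor B (range g) \<simeq>\<^sub>m S" by (intro basis_minor_iso[OF B g(1) gE S(2)]) (simp add: 1)
  then show ?thesis using basis_minor(1)[OF B gE] by blast
qed

text \<open>Any two of the three open entries connect the three edges. Exactly two entries give
  \<open>S1\<close>, \<open>S2\<close> or \<open>S3\<close> according to which one is missing; three
  give \<open>S3\<close> or \<open>S4\<close>, depending on whether the triple that the table leaves
  undecided completes to a basis.\<close>

lemma diag3_minor:
  assumes diag: "diag3 B b1 e1 b2 e2 b3 e3"
    and links: "adj B b1 e2 \<and> adj B b1 e3 \<or> adj B b1 e2 \<and> adj B b2 e3 \<or> adj B b1 e3 \<and> adj B b2 e3"
  shows "\<exists>N. minor N M \<and> iso_to_some_S N"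
proof -
  note tab = diag3_table[OF diag]
  have dist: "distinct [b1, b2, b3, e1, e2, e3]" using diag unfolding diag3_def by simp
  have "insert b1 (insert b2 (insert b3 B)) = B" and B: "B \<in> bases M"
    using diag unfolding diag3_def adj_def by auto
  then have whole: "insert b1 (insert b2 (insert b3 B)) \<in> bases M" by simp
  let ?C = "B - {b1, b2, b3}"
  consider (S1) "\<not> adj B b1 e2" "adj B b1 e3" "adj B b2 e3"
    | (S2) "adj B b1 e2" "adj B b1 e3" "\<not> adj B b2 e3"
    | (S3) "adj B b1 e2" "\<not> adj B b1 e3" "adj B b2 e3"
    | (S3') "adj B b1 e2" "adj B b1 e3" "adj B b2 e3" "insert b3 (insert e2 (insert e3 ?C)) \<notin> bases M"
    | (S4) "adj B b1 e2" "adj B b1 e3" "adj B b2 e3" "insert b3 (insert e2 (insert e3 ?C)) \<in> bases M"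
    using links by blast
  then show ?thesis
  proof cases
    case S1
    define g where "g = case_elt6 b1 e1 b3 e3 b2 e2"
    have g: "inj g" "range g = {b1, b2, b3, e1, e2, e3}"
      using dist unfolding inj_def UNIV_elt6 g_def by (auto split: elt6.splits)
    have "g ` J \<union> ?C \<in> bases M \<longleftrightarrow> J \<in> indeps S1" if "card J = 3" for J
      using that by (rule all_elt6_triples)
        (use tab whole S1 in \<open>simp_all add: g_def S1_def points_lines_matroid_def insert_commute\<close>)
    from diag3_iso[OF diag g is_matroid_S1 ground_S(3) mrank_S1 this]
    show ?thesis unfolding iso_to_some_S_def by blast
  next
    case S2
    define g where "g = case_elt6 b2 e2 b1 e1 b3 e3"
    have g: "inj g" "range g = {b1, b2, b3, e1, e2, e3}"
      using dist unfolding inj_def UNIV_elt6 g_def by (auto split: elt6.splits)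
    have "g ` J \<union> ?C \<in> bases M \<longleftrightarrow> J \<in> indeps S2" if "card J = 3" for J
      using that by (rule all_elt6_triples)
        (use tab whole S2 in \<open>simp_all add: g_def S2_def points_lines_matroid_def insert_commute\<close>)
    from diag3_iso[OF diag g is_matroid_S2 ground_S(4) mrank_S2 this]
    show ?thesis unfolding iso_to_some_S_def by blast
  next
    case S3
    define g where "g = case_elt6 b2 e2 b3 e3 b1 e1"
    have g: "inj g" "range g = {b1, b2, b3, e1, e2, e3}"
      using dist unfolding inj_def UNIV_elt6 g_def by (auto split: elt6.splits)
    have "g ` J \<union> ?C \<in> bases M \<longleftrightarrow> J \<in> indeps S3" if "card J = 3" for J
      using that by (rule all_elt6_triples)
        (use tab whole S3 in \<open>simp_all add: g_def S3_def points_lines_matroid_def insert_commute\<close>)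
    from diag3_iso[OF diag g is_matroid_S3 ground_S(5) mrank_S3 this]
    show ?thesis unfolding iso_to_some_S_def by blast
  next
    case S3'
    \<comment> \<open>The dependent triple is now \<open>b3\<close>, \<open>e2\<close>,
      \<open>e3\<close> instead of \<open>b2\<close>, \<open>b3\<close>, \<open>e3\<close>, so
      \<open>e2\<close> becomes the intersection point of the two lines.\<close>
    define g where "g = case_elt6 e2 b2 b3 e3 b1 e1"
    have g: "inj g" "range g = {b1, b2, b3, e1, e2, e3}"
      using dist unfolding inj_def UNIV_elt6 g_def by (auto split: elt6.splits)
    have "g ` J \<union> ?C \<in> bases M \<longleftrightarrow> J \<in> indeps S3" if "card J = 3" for J
      using that by (rule all_elt6_triples)
        (use tab whole S3' in \<open>simp_all add: g_def S3_def points_lines_matroid_def insert_commute\<close>)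
    from diag3_iso[OF diag g is_matroid_S3 ground_S(5) mrank_S3 this]
    show ?thesis unfolding iso_to_some_S_def by blast
  next
    case S4
    define g where "g = case_elt6 b2 e2 b3 e3 b1 e1"
    have g: "inj g" "range g = {b1, b2, b3, e1, e2, e3}"
      using dist unfolding inj_def UNIV_elt6 g_def by (auto split: elt6.splits)
    have "g ` J \<union> ?C \<in> bases M \<longleftrightarrow> J \<in> indeps S4" if "card J = 3" for J
      using that by (rule all_elt6_triples)
        (use tab whole S4 in \<open>simp_all add: g_def S4_def points_lines_matroid_def insert_commute\<close>)
    from diag3_iso[OF diag g is_matroid_S4 ground_S(6) mrank_S4 this]
    show ?thesis unfolding iso_to_some_S_def by blast
  qed
qed

text \<open>The four elements induce the path \<open>f\<close>, \<open>b\<close>, \<open>e\<close>,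
  \<open>c\<close> in the fundamental graph. As \<open>f\<close> has only the neighbour
  \<open>b\<close> there, the two are parallel in the minor, and all other pairs are bases.\<close>

lemma MW2_iff:
  assumes B: "B \<in> bases M" and a: "adj B b f" "adj B c e" "adj B b e" "\<not> adj B c f"
    and dist: "distinct [b, c, e, f]"
  shows "case_elt4 b f c e ` J \<union> (B - {b, c, e, f}) \<in> indeps M \<longleftrightarrow> J \<in> indeps MW2"
proof -
  let ?g = "case_elt4 b f c e"
  have mem: "b \<in> B" "c \<in> B" "e \<notin> B" "f \<notin> B" "e \<in> E" "f \<in> E" using a unfolding adj_def by auto
  have g: "inj ?g" "range ?g = {b, c, e, f}"
    using dist unfolding inj_def UNIV_elt4 by (auto split: elt4.splits)
  have C: "B - {b, c, e, f} = B - {b, c}" "B \<inter> {b, c, e, f} = {b, c}" using mem by auto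
  have card: "card (B \<inter> range ?g) = 2" unfolding g C using dist by simp
  have gE: "range ?g \<subseteq> E" unfolding g using mem base_subset_ground[OF B] by auto
  have B1: "B - {b} = insert c (B - {b, c})" "B - {c} = insert b (B - {b, c})" "insert b (insert c B) = B"
    using mem dist by auto
  have tab: "insert b (insert c B) \<in> bases M"
    "insert f (insert c (B - {b, c})) \<in> bases M" "insert e (insert c (B - {b, c})) \<in> bases M"
    "insert e (insert b (B - {b, c})) \<in> bases M" "insert f (insert b (B - {b, c})) \<notin> bases M"
    using a B B1 mem unfolding adj_def by auto
  have "insert e (insert f (B - {b, c})) \<in> bases M"
    using swap_two_same[OF B a(1), of c e] a mem dist by auto
  note tab = tab this
  have "?g ` J \<union> (B - range ?g) \<in> bases M \<longleftrightarrow> J \<in> indeps MW2" if "card J = 2" for J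
    using that unfolding g C
    by (rule all_elt4_pairs)
      (use tab in \<open>simp_all add: MW2_def points_lines_matroid_def insert_commute\<close>)
  from indep_by_triples[OF B g(1) card is_matroid_MW2 ground_S(1) mrank_MW2 this gE]
  show ?thesis unfolding g .
qed

text \<open>Without adjacencies between \<open>L\<close> and \<open>R\<close>, no swap from
  \<open>B \<inter> (L \<union> R)\<close> passes from one side to the other, so all bases of the
  minor meet \<open>L\<close> in equally many elements and the minor is a direct sum. Each summand
  is then tested in \<open>M\<close> with the basis elements of the other side filled in.\<close>

lemma separated_basis_minor:
  assumes B: "B \<in> bases M" and WE: "L \<union> R \<subseteq> E" and LR: "L \<inter> R = {}"
    and sep: "\<And>u v. u \<in> L \<Longrightarrow> v \<in> R \<Longrightarrow> \<not> adj B u v \<and> \<not> adj B v u"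
    and I0: "I0 \<subseteq> L" and J0: "J0 \<subseteq> R"
  shows "I0 \<union> J0 \<union> (B - (L \<union> R)) \<in> indeps M \<longleftrightarrow>
    I0 \<union> (B - L) \<in> indeps M \<and> J0 \<union> (B - R) \<in> indeps M"
proof -
  let ?N = "basis_minor B (L \<union> R)"
  note N = basis_minor[OF B WE]
  interpret N: fin_matroid ?N by unfold_locales (rule is_matroid_minor[OF N(1) is_matroid])
  have fB: "finite B" by (rule finite_base[OF B])
  have BW: "B \<inter> (L \<union> R) \<union> (B - (L \<union> R)) = B" by blast
  have BN: "B \<inter> (L \<union> R) \<in> bases ?N"
    unfolding bases_def
  proof (intro CollectI conjI ballI impI)
    show "B \<inter> (L \<union> R) \<in> indeps ?N" unfolding N(3) BW using base_indep[OF B] by blast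
    fix I assume I: "I \<in> indeps ?N" "B \<inter> (L \<union> R) \<subseteq> I"
    then have ind: "I \<union> (B - (L \<union> R)) \<in> indeps M" unfolding N(3) by blast
    have "B \<subseteq> I \<union> (B - (L \<union> R))" using I(2) by blast
    with ind B have "I \<union> (B - (L \<union> R)) = B" unfolding bases_def by blast
    moreover have "I \<subseteq> (L \<union> R)" using I(1) unfolding N(3) by blast
    ultimately show "I = B \<inter> (L \<union> R)" using I(2) by blast
  qed
  have no_cross: False
    if Z: "Z = L \<or> Z = - L" and b: "b \<in> B \<inter> (L \<union> R)" "b \<in> Z" and e: "e \<in> ground ?N" "e \<notin> B \<inter> (L \<union> R)" "e \<notin> Z"
      and sw: "insert e (B \<inter> (L \<union> R) - {b}) \<in> bases ?N" for Z b e
  proof -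
    have eW: "e \<in> (L \<union> R)" "e \<notin> B" using e N(2) by auto
    have "insert e (B \<inter> (L \<union> R) - {b}) \<union> (B - (L \<union> R)) \<in> indeps M" using N.base_indep[OF sw] unfolding N(3) by blast
    moreover have "insert e (B \<inter> (L \<union> R) - {b}) \<union> (B - (L \<union> R)) = insert e (B - {b})" using b by blast
    ultimately have ind: "insert e (B - {b}) \<in> indeps M" by simp
    have "card (insert e (B - {b})) = card B" using card_Suc_Diff1[OF fB, of b] b eW fB by simp
    then have "adj B b e" using ind eW b WE base_iff base_card[OF B] unfolding adj_def by auto
    then show False using Z b e eW sep[of b e] sep[of e b] by auto
  qed
  have le: "card (B \<inter> (L \<union> R) \<inter> Z) \<le> card (B' \<inter> Z)" if B': "B' \<in> bases ?N" and Z: "Z = L \<or> Z = - L" for B' Z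
  proof (rule ccontr)
    assume "\<not> card (B \<inter> (L \<union> R) \<inter> Z) \<le> card (B' \<inter> Z)"
    then have less: "card (B' \<inter> Z) < card (B \<inter> (L \<union> R) \<inter> Z)" by linarith
    show False
      using N.crossing_swap[OF N.symmetric_exchange_bases subset_refl BN B' less] no_cross[OF Z] by blast
  qed
  have const: "card (B' \<inter> L) = card (B \<inter> (L \<union> R) \<inter> L)" if B': "B' \<in> bases ?N" for B'
  proof -
    have split: "card A = card (A \<inter> L) + card (A \<inter> - L)" if "A \<in> bases ?N" for A
      using card_Int_Diff[OF N.finite_base[OF that], of L] by (simp add: Diff_eq)
    have "card B' = card (B \<inter> (L \<union> R))" using N.base_card[OF B'] N.base_card[OF BN] by (rule trans[OF _ sym])
    then show ?thesis
      using le[OF B' disjI1[OF refl]] le[OF B' disjI2[OF refl]] split[OF B'] split[OF BN] by linarith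
  qed
  have sepN: "I \<union> J \<in> indeps ?N" if "I \<in> indeps ?N" "I \<subseteq> L" "J \<in> indeps ?N" "J \<subseteq> R" for I J
  proof (rule N.separated_indep[of L])
    show "card (B \<inter> L) = card (B' \<inter> L)" if "B \<in> bases ?N" "B' \<in> bases ?N" for B B'
      using const[OF that(1)] const[OF that(2)] by (rule trans[OF _ sym])
    show "J \<subseteq> - L" using that(4) LR by blast
  qed (use that in blast)+
  have N_sub: "J \<in> indeps ?N" if "I \<in> indeps ?N" "J \<subseteq> I" for I J using N.indep_subset that by blast
  have BI: "B \<inter> L \<in> indeps ?N" "B \<inter> R \<in> indeps ?N" using N_sub[OF N.base_indep[OF BN]] by blast+
  have L: "I \<in> indeps ?N \<longleftrightarrow> I \<union> (B - L) \<in> indeps M" if I: "I \<subseteq> L" for I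
  proof -
    have "I \<in> indeps ?N \<longleftrightarrow> I \<union> (B \<inter> R) \<in> indeps ?N"
      using sepN[OF _ I BI(2)] N_sub[of "I \<union> (B \<inter> R)" I] by blast
    moreover have "I \<union> (B \<inter> R) \<union> (B - (L \<union> R)) = I \<union> (B - L)" "I \<union> (B \<inter> R) \<subseteq> (L \<union> R)" using I LR by blast+
    ultimately show ?thesis unfolding N(3) by simp
  qed
  have R: "I \<in> indeps ?N \<longleftrightarrow> I \<union> (B - R) \<in> indeps M" if I: "I \<subseteq> R" for I
  proof -
    have "I \<in> indeps ?N \<longleftrightarrow> (B \<inter> L) \<union> I \<in> indeps ?N"
      using sepN[OF BI(1) _ _ I] N_sub[of "(B \<inter> L) \<union> I" I] by blast
    moreover have "(B \<inter> L) \<union> I \<union> (B - (L \<union> R)) = I \<union> (B - R)" "(B \<inter> L) \<union> I \<subseteq> (L \<union> R)" using I LR by blast+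
    ultimately show ?thesis unfolding N(3) by simp
  qed
  have "I0 \<union> J0 \<union> (B - (L \<union> R)) \<in> indeps M \<longleftrightarrow> I0 \<union> J0 \<in> indeps ?N"
    unfolding N(3) using I0 J0 by blast
  also have "\<dots> \<longleftrightarrow> I0 \<in> indeps ?N \<and> J0 \<in> indeps ?N"
    using sepN[OF _ I0 _ J0] N_sub[of "I0 \<union> J0" I0] N_sub[of "I0 \<union> J0" J0] by blast
  finally show ?thesis using L[OF I0] R[OF J0] by simp
qed

lemma S0_minor:
  assumes B: "B \<in> bases M"
    and a1: "adj B b1 f1" "adj B c1 e1" "adj B b1 e1" "\<not> adj B c1 f1"
    and a2: "adj B b2 f2" "adj B c2 e2" "adj B b2 e2" "\<not> adj B c2 f2"
    and dist: "distinct [b1, c1, e1, f1, b2, c2, e2, f2]"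
    and sep: "\<And>u v. u \<in> {b1, c1, e1, f1} \<Longrightarrow> v \<in> {b2, c2, e2, f2} \<Longrightarrow> \<not> adj B u v \<and> \<not> adj B v u"
  shows "\<exists>N. minor N M \<and> N \<simeq>\<^sub>m S0"
proof -
  let ?L = "{b1, c1, e1, f1}" and ?R = "{b2, c2, e2, f2}"
  let ?W = "?L \<union> ?R"
  have WE: "?W \<subseteq> E" using a1 a2 base_subset_ground[OF B] unfolding adj_def by auto
  have LR: "?L \<inter> ?R = {}" using dist by auto
  define g1 where "g1 = case_elt4 b1 f1 c1 e1"
  define g2 where "g2 = case_elt4 b2 f2 c2 e2"
  define g where "g = case_sum g1 g2"
  have d12: "distinct [b1, c1, e1, f1]" "distinct [b2, c2, e2, f2]" using dist by auto
  have g1: "inj g1" "range g1 = ?L" using dist unfolding inj_def UNIV_elt4 g1_def by (auto split: elt4.splits)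
  have g2: "inj g2" "range g2 = ?R" using dist unfolding inj_def UNIV_elt4 g2_def by (auto split: elt4.splits)
  have rg: "range g = ?W" unfolding g_def UNIV_sum image_Un image_image using g1 g2 by simp
  have "inj g"
    unfolding g_def
  proof (rule injI)
    fix x y assume "case_sum g1 g2 x = case_sum g1 g2 y"
    moreover have "g1 u \<noteq> g2 v" for u v using LR g1(2) g2(2) by (metis disjoint_iff rangeI)
    moreover have "g2 u \<noteq> g1 v" for u v using LR g1(2) g2(2) by (metis disjoint_iff rangeI)
    ultimately show "x = y" using g1(1) g2(1) by (auto split: sum.splits dest: injD)
  qed
  moreover have "g ` J \<union> (B - range g) \<in> indeps M \<longleftrightarrow> J \<in> indeps S0" for J
  proof -
    let ?J1 = "Inl -` J" and ?J2 = "Inr -` J"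
    have gJ: "g ` J = g1 ` ?J1 \<union> g2 ` ?J2"
    proof -
      have "J = Inl ` ?J1 \<union> Inr ` ?J2" using vimage_Plus[of J] unfolding Plus_def .
      then have "g ` J = g ` Inl ` ?J1 \<union> g ` Inr ` ?J2" by (metis image_Un)
      then show ?thesis unfolding g_def image_image by simp
    qed
    have s1: "g1 ` ?J1 \<subseteq> ?L" using g1(2) by (metis image_mono subset_UNIV)
    have s2: "g2 ` ?J2 \<subseteq> ?R" using g2(2) by (metis image_mono subset_UNIV)
    have "g ` J \<union> (B - range g) \<in> indeps M \<longleftrightarrow>
        g1 ` ?J1 \<union> (B - ?L) \<in> indeps M \<and> g2 ` ?J2 \<union> (B - ?R) \<in> indeps M"
      unfolding gJ rg using separated_basis_minor[OF B WE LR sep s1 s2] by simp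
    also have "\<dots> \<longleftrightarrow> ?J1 \<in> indeps MW2 \<and> ?J2 \<in> indeps MW2"
      using MW2_iff[OF B a1 d12(1), of ?J1] MW2_iff[OF B a2 d12(2), of ?J2] unfolding g1_def g2_def by simp
    finally show ?thesis unfolding S0_def indeps_direct_sum_iff .
  qed
  ultimately have "basis_minor B (range g) \<simeq>\<^sub>m S0"
    using basis_minor_iso[OF B _ _ ground_S(2)] rg WE by blast
  then show ?thesis using basis_minor(1)[OF B WE] unfolding rg by blast
qed

end

section \<open>From a degenerate certificate to one of the five minors\<close>

context covered_face
begin

lemma edge_level: "edge B b e \<Longrightarrow> level b = level e"
  unfolding edge_def using same_piece_level by blast

text \<open>A link between different pieces strictly lowers \<open>level\<close>. With the edges
  sorted by decreasing level, the entries below the diagonal therefore vanish, and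
  \<open>diag3_minor\<close> applies.\<close>

lemma sorted_edges_minor:
  assumes B: "B \<in> \<F>" and e: "edge B b1 e1" "edge B b2 e2" "edge B b3 e3"
    and n: "\<not> b1 \<doteq> b2" "\<not> b1 \<doteq> b3" "\<not> b2 \<doteq> b3" and lev: "level b2 \<le> level b1" "level b3 \<le> level b2"
    and links: "let l12 = adj B b1 e2 \<or> adj B b2 e1; l13 = adj B b1 e3 \<or> adj B b3 e1;
        l23 = adj B b2 e3 \<or> adj B b3 e2 in l12 \<and> l13 \<or> l12 \<and> l23 \<or> l13 \<and> l23"
  shows "\<exists>N. minor N M \<and> iso_to_some_S N"
proof -
  have s: "b1 \<doteq> e1" "b2 \<doteq> e2" "b3 \<doteq> e3" using e unfolding edge_def by auto
  have up: "\<not> adj B b e" if "\<not> b \<doteq> e" "level b \<le> level e" for b e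
    using adj_level_less[OF B _ that(1)] that(2) by force
  have n': "\<not> b2 \<doteq> e1" "\<not> b3 \<doteq> e1" "\<not> b3 \<doteq> e2" "\<not> e1 \<doteq> e2" "\<not> e1 \<doteq> e3" "\<not> e2 \<doteq> e3"
    using n s same_piece_sym same_piece_trans by blast+
  have na: "\<not> adj B b2 e1" "\<not> adj B b3 e1" "\<not> adj B b3 e2"
    using up[OF n'(1)] up[OF n'(2)] up[OF n'(3)] lev edge_level[OF e(1)] edge_level[OF e(2)] by simp_all
  have "b1 \<noteq> b2" "b1 \<noteq> b3" "b2 \<noteq> b3" "e1 \<noteq> e2" "e1 \<noteq> e3" "e2 \<noteq> e3" using n n' by auto
  moreover have "{b1, b2, b3} \<inter> {e1, e2, e3} = {}" using e unfolding edge_def adj_def by auto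
  ultimately have "diag3 B b1 e1 b2 e2 b3 e3"
    using na e face_base[OF B] unfolding diag3_def edge_def by auto
  then show ?thesis by (rule diag3_minor) (use links na in \<open>auto simp: Let_def\<close>)
qed

text \<open>The middle edge of the chain may have any place in the order of levels; since
  \<open>sorted_edges_minor\<close> accepts any two of the three links, sorting loses
  nothing.\<close>

lemma three_edges_minor:
  assumes B: "B \<in> \<F>" and e: "edge B b1 e1" "edge B b2 e2" "edge B b3 e3"
    and n: "\<not> b1 \<doteq> b2" "\<not> b1 \<doteq> b3" "\<not> b2 \<doteq> b3"
    and links: "adj B b1 e2 \<or> adj B b2 e1" "adj B b2 e3 \<or> adj B b3 e2"
  shows "\<exists>N. minor N M \<and> iso_to_some_S N"
proof -
  have n': "\<not> b2 \<doteq> b1" "\<not> b3 \<doteq> b1" "\<not> b3 \<doteq> b2" using n same_piece_sym by blast+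
  consider "level b2 \<le> level b1" "level b3 \<le> level b2" | "level b3 \<le> level b1" "level b2 \<le> level b3"
    | "level b1 \<le> level b2" "level b3 \<le> level b1" | "level b3 \<le> level b2" "level b1 \<le> level b3"
    | "level b1 \<le> level b3" "level b2 \<le> level b1" | "level b2 \<le> level b3" "level b1 \<le> level b2"
    by linarith
  then show ?thesis
  proof cases
    case 1 show ?thesis by (rule sorted_edges_minor[OF B e(1,2,3) n(1,2,3) 1]) (use links in \<open>auto simp: Let_def\<close>)
  next
    case 2 show ?thesis by (rule sorted_edges_minor[OF B e(1,3,2) n(2,1) n'(3) 2]) (use links in \<open>auto simp: Let_def\<close>)
  next
    case 3 show ?thesis by (rule sorted_edges_minor[OF B e(2,1,3) n'(1) n(3,2) 3]) (use links in \<open>auto simp: Let_def\<close>)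
  next
    case 4 show ?thesis by (rule sorted_edges_minor[OF B e(2,3,1) n(3) n'(1,2) 4]) (use links in \<open>auto simp: Let_def\<close>)
  next
    case 5 show ?thesis by (rule sorted_edges_minor[OF B e(3,1,2) n'(2,3) n(1) 5]) (use links in \<open>auto simp: Let_def\<close>)
  next
    case 6 show ?thesis by (rule sorted_edges_minor[OF B e(3,2,1) n'(3,2,1) 6]) (use links in \<open>auto simp: Let_def\<close>)
  qed
qed

lemma linked_link:
  assumes "linked B u v" "edge B b e" "edge B b' e'" "u = b \<or> u = e" "v = b' \<or> v = e'"
  shows "adj B b e' \<or> adj B b' e"
  using assms unfolding linked_def edge_def adj_def by auto

lemma edge_piece: "edge B b e \<Longrightarrow> u = b \<or> u = e \<Longrightarrow> u \<doteq> b"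
  unfolding edge_def using same_piece_sym by auto

lemma piece_path_minor:
  assumes p: "piece_path B p m" and m: "m \<le> 2"
  shows "\<exists>N. minor N M \<and> iso_to_some_S N"
proof -
  have B: "B \<in> \<F>" and l: "\<And>i. i \<le> m \<Longrightarrow> linked B (p i) (p (Suc i))" and m1: "1 \<le> m"
    and inner: "\<And>i. 1 \<le> i \<Longrightarrow> i \<le> m \<Longrightarrow> p i \<doteq> p 1"
    and ends: "\<not> p 0 \<doteq> p 1" "\<not> p (Suc m) \<doteq> p 1" "\<not> p 0 \<doteq> p (Suc m)"
    using p unfolding piece_path_def by auto
  have l01: "linked B (p 0) (p 1)" and lm: "linked B (p m) (p (Suc m))" using l[of 0] l[of m] by simp_all
  obtain b0 e0 where e0: "edge B b0 e0" "p 0 = b0 \<or> p 0 = e0" using linked_edge[OF B l01] by blast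
  obtain b2 e2 where e2: "edge B b2 e2" "p (Suc m) = b2 \<or> p (Suc m) = e2"
    using linked_edge[OF B linked_sym[OF lm]] by blast
  \<comment> \<open>Diagonal edge for the middle piece: two inner vertices form it themselves, a
    single one is completed by a partner.\<close>
  obtain b1 e1 where e1: "edge B b1 e1" "p 1 = b1 \<or> p 1 = e1" "p m = b1 \<or> p m = e1"
  proof (cases "m = 1")
    case True
    then show ?thesis using that linked_edge[OF B lm] by blast
  next
    case False
    then have m2: "m = 2" using m m1 by simp
    have "linked B (p 1) (p 2)" "p 2 \<doteq> p 1" using l[of 1] inner[of 2] m2 by (simp_all add: numeral_2_eq_2)
    then consider "edge B (p 1) (p 2)" | "edge B (p 2) (p 1)"
      unfolding linked_def edge_def using same_piece_sym by blast
    then show ?thesis using that m2 by cases blast+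
  qed
  note pc = edge_piece[OF e0] edge_piece[OF e1(1,2)] edge_piece[OF e2]
  have "\<not> b0 \<doteq> b1" "\<not> b0 \<doteq> b2" "\<not> b1 \<doteq> b2"
    using ends pc same_piece_sym same_piece_trans by blast+
  then show ?thesis
    using linked_link[OF l01 e0(1) e1(1) e0(2) e1(2)] linked_link[OF lm e1(1) e2(1) e1(3) e2(2)]
    by (intro three_edges_minor[OF B e0(1) e1(1) e2(1)]) auto
qed

lemma link_minor:
  assumes "B \<in> \<F>" "linked B u v" "linked B w z" "\<not> u \<doteq> v" "\<not> w \<doteq> z" "\<not> u \<doteq> z" "v \<doteq> w"
  shows "\<exists>N. minor N M \<and> iso_to_some_S N"
  using piece_pathI[OF assms] short_piece_path piece_path_minor by blast

text \<open>Each half of \<open>degenerate\<close> supplies a swap leaving the face. The first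
  changes membership in \<open>X\<close>, the second membership in \<open>Y\<close> but not in
  \<open>X\<close>. If they touch a common piece, \<open>X\<close> separates their other ends and
  three pieces are chained. Otherwise they are the two disjoint links for \<open>S0\<close>, unless
  a link between their surroundings again produces a chain.\<close>

theorem degenerate_minor:
  assumes deg: "degenerate M X Y"
  shows "\<exists>N. minor N M \<and> iso_to_some_S N"
proof -
  obtain B where B: "B \<in> \<F>" using covered unfolding covered_def by (auto simp: ex_in_conv[symmetric])
  have BM: "B \<in> bases M" by (rule face_base[OF B])
  have tB: "card (B \<inter> X) = r X" "card (B \<inter> Y) = r Y" using B unfolding face_def tight_def by auto
  have sepX: "separator X" and sepY: "separator Y" unfolding separator_def face_def tight_def by auto
  have pX: "u \<in> X \<longleftrightarrow> v \<in> X" if "u \<doteq> v" for u v using that sepX unfolding same_piece_def by blast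
  have pY: "u \<in> Y \<longleftrightarrow> v \<in> Y" if "u \<doteq> v" for u v using that sepY unfolding same_piece_def by blast
  obtain B3 where B3: "B3 \<in> bases M" "\<not> tight M X B3" using deg unfolding degenerate_def by blast
  have "card (B3 \<inter> X) < card (B \<inter> X)" using base_card_Int_le[OF B3(1), of X] B3(2) tB unfolding tight_def by simp
  from crossing_swap[OF symmetric_exchange_bases subset_refl BM B3(1) this]
  obtain b1 e1 where 1: "b1 \<in> X" "e1 \<notin> X" "adj B b1 e1" unfolding adj_def by blast
  obtain B4 where B4: "B4 \<in> bases M" "tight M X B4" "\<not> tight M Y B4" using deg unfolding degenerate_def by blast
  \<comment> \<open>The second swap is sought among the bases tight for \<open>X\<close>, which
    keeps \<open>b2\<close> and \<open>e2\<close> on the same side of \<open>X\<close>.\<close>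
  let ?G = "{B \<in> bases M. tight M X B}"
  have G: "symmetric_exchange ?G" by (intro symmetric_exchange_tight symmetric_exchange_bases) auto
  have c: "card (B4 \<inter> Y) < card (B \<inter> Y)" using base_card_Int_le[OF B4(1), of Y] B4(3) tB unfolding tight_def by simp
  have "?G \<subseteq> bases M" "B \<in> ?G" "B4 \<in> ?G" using BM B4 tB unfolding tight_def by auto
  from crossing_swap[OF G this c]
  obtain b2 e2 where 2: "b2 \<in> Y" "e2 \<notin> Y" "adj B b2 e2" "tight M X (insert e2 (B - {b2}))"
    unfolding adj_def by blast
  have "b2 \<in> B" "e2 \<notin> B" using 2(3) unfolding adj_def by auto
  from card_swap_Int[OF finite_base[OF BM] this, of X]
  have X2: "b2 \<in> X \<longleftrightarrow> e2 \<in> X" using 2(4) tB unfolding tight_def by (simp add: of_bool_def split: if_splits)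
  have l1: "linked B b1 e1" "linked B e1 b1" and l2: "linked B b2 e2" "linked B e2 b2"
    using 1(3) 2(3) unfolding linked_def by auto
  have n1: "\<not> b1 \<doteq> e1" "\<not> e1 \<doteq> b1" using pX 1 by blast+
  have n2: "\<not> b2 \<doteq> e2" "\<not> e2 \<doteq> b2" using pY 2 by blast+
  show ?thesis
  proof (cases "b1 \<doteq> b2 \<or> b1 \<doteq> e2 \<or> e1 \<doteq> b2 \<or> e1 \<doteq> e2")
    case True
    then consider "b1 \<doteq> b2" | "b1 \<doteq> e2" | "e1 \<doteq> b2" | "e1 \<doteq> e2" by blast
    then show ?thesis
    proof cases
      case a: 1
      have "\<not> e1 \<doteq> e2" using pX 1 X2 a by blast
      then show ?thesis by (rule link_minor[OF B l1(2) l2(1) n1(2) n2(1) _ a])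
    next
      case a: 2
      have "\<not> e1 \<doteq> b2" using pX 1 X2 a by blast
      then show ?thesis by (rule link_minor[OF B l1(2) l2(2) n1(2) n2(2) _ a])
    next
      case a: 3
      have "\<not> b1 \<doteq> e2" using pX 1 X2 a by blast
      then show ?thesis by (rule link_minor[OF B l1(1) l2(1) n1(1) n2(1) _ a])
    next
      case a: 4
      have "\<not> b1 \<doteq> b2" using pX 1 X2 a by blast
      then show ?thesis by (rule link_minor[OF B l1(1) l2(2) n1(1) n2(2) _ a])
    qed
  next
    case False
    then have nn: "\<not> b1 \<doteq> b2" "\<not> b1 \<doteq> e2" "\<not> e1 \<doteq> b2" "\<not> e1 \<doteq> e2" by blast+
    \<comment> \<open>Each link is extended by a partner at either end, giving on both sides the
      path on four vertices that \<open>MW2_iff\<close> expects.\<close>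
    obtain f1 where f1: "adj B b1 f1" "b1 \<doteq> f1" using partner_of_base_element[OF B 1(3)] by blast
    obtain c1 where c1: "adj B c1 e1" "c1 \<doteq> e1" using partner_of_cobase_element[OF B 1(3)] by blast
    obtain f2 where f2: "adj B b2 f2" "b2 \<doteq> f2" using partner_of_base_element[OF B 2(3)] by blast
    obtain c2 where c2: "adj B c2 e2" "c2 \<doteq> e2" using partner_of_cobase_element[OF B 2(3)] by blast
    let ?L = "{b1, c1, e1, f1}" and ?R = "{b2, c2, e2, f2}"
    have pL: "u \<doteq> b1 \<or> u \<doteq> e1" if "u \<in> ?L" for u using that f1(2) c1(2) same_piece_sym by auto
    have pR: "v \<doteq> b2 \<or> v \<doteq> e2" if "v \<in> ?R" for v using that f2(2) c2(2) same_piece_sym by auto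
    have nLR: "\<not> u \<doteq> v" if "u \<in> {b1, e1}" "v \<in> ?R" for u v
      using pR[OF that(2)] that(1) nn same_piece_sym same_piece_trans by blast
    have nLR': "\<not> u \<doteq> v" if "u \<in> ?L" "v \<in> ?R" for u v
      using pL[OF that(1)] nLR[OF _ that(2)] same_piece_sym same_piece_trans by blast
    show ?thesis
    proof (cases "\<exists>u\<in>?L. \<exists>v\<in>?R. linked B u v")
      case True
      \<comment> \<open>The far end of the first link, \<open>u\<close> and \<open>v\<close> lie in
        three different pieces, and the two links chain them.\<close>
      then obtain u v where uv: "u \<in> ?L" "v \<in> ?R" "linked B u v" by blast
      from pL[OF uv(1)] show ?thesis
      proof
        assume "u \<doteq> b1"
        then have "b1 \<doteq> u" by (rule same_piece_sym)
        then show ?thesis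
          using nLR[OF _ uv(2), of e1] nLR'[OF uv(1,2)] by (intro link_minor[OF B l1(2) uv(3) n1(2)]) auto
      next
        assume "u \<doteq> e1"
        then have "e1 \<doteq> u" by (rule same_piece_sym)
        then show ?thesis
          using nLR[OF _ uv(2), of b1] nLR'[OF uv(1,2)] by (intro link_minor[OF B l1(1) uv(3) n1(1)]) auto
      qed
    next
      case False
      then have sep: "\<not> adj B u v \<and> \<not> adj B v u" if "u \<in> ?L" "v \<in> ?R" for u v
        using that unfolding linked_def by blast
      have "?L \<inter> ?R = {}"
      proof (rule equals0I)
        fix x assume x: "x \<in> ?L \<inter> ?R"
        from nLR'[OF IntD1[OF x] IntD2[OF x]] show False by simp
      qed
      moreover have "distinct [b1, c1, e1, f1]" "distinct [b2, c2, e2, f2]"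
      proof -
        have "b1 \<noteq> c1" "f1 \<noteq> e1" "b2 \<noteq> c2" "f2 \<noteq> e2" using n1 n2 f1(2) c1(2) f2(2) c2(2) by auto
        then show "distinct [b1, c1, e1, f1]" "distinct [b2, c2, e2, f2]"
          using f1(1) c1(1) f2(1) c2(1) unfolding adj_def by auto
      qed
      ultimately have "distinct ([b1, c1, e1, f1] @ [b2, c2, e2, f2])"
        unfolding distinct_append by simp
      then have dist: "distinct [b1, c1, e1, f1, b2, c2, e2, f2]" by simp
      \<comment> \<open>\<open>c1\<close> has the level of \<open>e1\<close> and \<open>f1\<close>
        the larger level of \<open>b1\<close>, while adjacency never raises the level.\<close>
      have "\<not> adj B c1 f1"
        using adj_level(1)[OF B, of c1 f1] adj_level_less[OF B 1(3) n1(1)]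
          same_piece_level[OF f1(2)] same_piece_level[OF c1(2)] by linarith
      moreover have "\<not> adj B c2 f2"
        using adj_level(1)[OF B, of c2 f2] adj_level_less[OF B 2(3) n2(1)]
          same_piece_level[OF f2(2)] same_piece_level[OF c2(2)] by linarith
      ultimately show ?thesis
        using S0_minor[OF BM f1(1) c1(1) 1(3) _ f2(1) c2(1) 2(3) _ dist sep]
        unfolding iso_to_some_S_def by blast
    qed
  qed
qed

end

section \<open>Lifting certificates from minors\<close>

definition nested_certificate :: "'a matroid \<Rightarrow> bool" where
  "nested_certificate M \<longleftrightarrow>
     (\<exists>X Y. X \<subseteq> Y \<and> covered M X Y \<and> (degenerate M X Y \<or> degenerate M Y X))"

lemma covered_cong:
  assumes "\<And>B. B \<in> bases M \<Longrightarrow> tight M X B \<longleftrightarrow> tight M X' B"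
    and "\<And>B. B \<in> bases M \<Longrightarrow> tight M Y B \<longleftrightarrow> tight M Y' B"
  shows "covered M X Y \<longleftrightarrow> covered M X' Y'" "degenerate M X Y \<longleftrightarrow> degenerate M X' Y'"
    "degenerate M Y X \<longleftrightarrow> degenerate M Y' X'"
proof -
  have "face M X Y = face M X' Y'" using assms unfolding face_def by blast
  then show "covered M X Y \<longleftrightarrow> covered M X' Y'" unfolding covered_def by simp
  show "degenerate M X Y \<longleftrightarrow> degenerate M X' Y'" "degenerate M Y X \<longleftrightarrow> degenerate M Y' X'"
    using assms unfolding degenerate_def by blast+
qed

lemma coveredI:
  assumes ne: "B \<in> face M X Y" and meet: "\<And>f. f \<in> \<Union>(bases M) \<Longrightarrow> \<exists>B\<in>face M X Y. f \<in> B"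
    and avoid: "\<And>f. f \<notin> \<Inter>(bases M) \<Longrightarrow> \<exists>B\<in>face M X Y. f \<notin> B"
  shows "covered M X Y"
  unfolding covered_def
proof (intro conjI subsetI)
  show "face M X Y \<noteq> {}" using ne by blast
  show "f \<in> \<Union>(face M X Y)" if "f \<in> \<Union>(bases M)" for f using meet[OF that] by blast
  show "f \<in> \<Inter>(bases M)" if "f \<in> \<Inter>(face M X Y)" for f using avoid[of f] that by blast
qed

context fin_matroid
begin

text \<open>Loops never meet a basis and coloops meet every basis, so adding the former to a set and
  removing the latter does not change which bases are tight for it.\<close>

definition trim :: "'a set \<Rightarrow> 'a set" where
  "trim Z = ((Z \<inter> E) \<union> (E - \<Union>(bases M))) - \<Inter>(bases M)"

lemma tight_trim:
  assumes "B \<in> bases M" shows "tight M (trim Z) B \<longleftrightarrow> tight M Z B"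
proof -
  let ?Co = "\<Inter>(bases M)"
  have c: "card (B \<inter> Z) = card (B \<inter> trim Z) + card (?Co \<inter> Z)" if B: "B \<in> bases M" for B
  proof -
    have "?Co \<subseteq> B" using B by blast
    then have "B \<inter> trim Z = B \<inter> Z - ?Co" "B \<inter> Z \<inter> ?Co = ?Co \<inter> Z"
      using base_subset_ground[OF B] B unfolding trim_def by auto
    then show ?thesis using card_Int_Diff[of "B \<inter> Z" ?Co] finite_base[OF B] by simp
  qed
  obtain B1 where B1: "B1 \<in> bases M" "card (B1 \<inter> Z) = r Z" by (rule base_card_Int_eq)
  obtain B2 where B2: "B2 \<in> bases M" "card (B2 \<inter> trim Z) = r (trim Z)" by (rule base_card_Int_eq)
  have "r Z = r (trim Z) + card (?Co \<inter> Z)"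
    using c[OF B1(1)] c[OF B2(1)] B1(2) B2(2) base_card_Int_le[OF B1(1), of "trim Z"]
      base_card_Int_le[OF B2(1), of Z] by linarith
  then show ?thesis using c[OF assms] unfolding tight_def by linarith
qed

text \<open>Loops may be assumed in \<open>X\<close> and coloops outside \<open>Y\<close>. Applied
  to a single-element minor, this fixes the memberships of elements that become loops or coloops
  only in the minor, and so makes their swap with the restored element preserve tightness.\<close>

lemma nested_certificate_trimmed:
  assumes "nested_certificate M"
  obtains X Y where "X \<subseteq> Y" "Y \<subseteq> E" "E - \<Union>(bases M) \<subseteq> X" "\<Inter>(bases M) \<inter> Y = {}"
    "covered M X Y" "degenerate M X Y \<or> degenerate M Y X"
proof -
  obtain X Y where XY: "X \<subseteq> Y" "covered M X Y" "degenerate M X Y \<or> degenerate M Y X"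
    using assms unfolding nested_certificate_def by blast
  have cong: "covered M (trim X) (trim Y)" "degenerate M (trim X) (trim Y) \<or> degenerate M (trim Y) (trim X)"
    using XY(2,3) covered_cong[of M X "trim X" Y "trim Y"] tight_trim by blast+
  obtain B where "B \<in> bases M" using bases_nonempty by blast
  then have "(E - \<Union>(bases M)) \<inter> \<Inter>(bases M) = {}" by blast
  then have "E - \<Union>(bases M) \<subseteq> trim X" unfolding trim_def by blast
  moreover have "trim X \<subseteq> trim Y" "trim Y \<subseteq> E" "\<Inter>(bases M) \<inter> trim Y = {}"
    using XY(1) unfolding trim_def by auto
  ultimately show thesis using that cong by blast
qed

text \<open>With this choice the face for the minor is the set of bases of the extended face containing, resp.
  avoiding, \<open>e\<close>, and \<open>e\<close> is a loop or coloop of the extended face only if it is one of \<open>M\<close>.\<close>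

definition extend :: "'a \<Rightarrow> 'a set \<Rightarrow> 'a set" where
  "extend e Z = (if e \<in> cl Z then insert e Z else Z)"

lemma extend_mono: "X \<subseteq> Y \<Longrightarrow> extend e X \<subseteq> extend e Y"
  using cl_mono[of X Y] unfolding extend_def by auto

lemma rank_insert_not_cl: "e \<in> E \<Longrightarrow> e \<notin> cl Z \<Longrightarrow> r (insert e Z) = Suc (r Z)"
  using rank_insert_le[of e Z] rank_mono[OF subset_insertI, of Z e] unfolding cl_def by auto

lemma covered_obtain:
  assumes "covered M X Y"
  obtains B where "B \<in> face M X Y"
  using assms unfolding covered_def by (auto simp: ex_in_conv[symmetric])

context
  fixes e assumes e: "e \<in> E" "{e} \<in> indeps M"
begin

lemma base_contract_iff: "B \<in> bases (contract M {e}) \<longleftrightarrow> e \<notin> B \<and> insert e B \<in> bases M"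
proof -
  have sub: "{e} \<subseteq> E" using e by simp
  interpret N: fin_matroid "contract M {e}" by unfold_locales (rule is_matroid_contract[OF sub])
  have re: "r {e} = 1" using rank_indep[OF e(2)] by simp
  have ind: "I \<in> indeps (contract M {e}) \<longleftrightarrow> I \<subseteq> E - {e} \<and> insert e I \<in> indeps M" for I
    using indep_contract_iff[OF sub e(2) subset_refl, of I] re by simp
  have rE: "mrank (contract M {e}) (E - {e}) + 1 = r E"
    using mrank_contract[OF sub, of "E - {e}"] re e(1) by (simp add: insert_absorb)
  show ?thesis
  proof (cases "e \<in> B")
    case True
    then show ?thesis using N.base_subset_ground[of B] by auto
  next
    case False
    have "card (insert e B) = card B + 1" if "insert e B \<in> indeps M"
      using finite_indep[OF that] False by simp
    then show ?thesis
      using False ind[of B] indep_subset_ground[of "insert e B"] rE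
      unfolding N.base_iff base_iff by auto
  qed
qed

text \<open>If \<open>e\<close> is spanned by \<open>Z\<close>, both the intersection and the rank
  count \<open>e\<close> once more; if not, adjoining \<open>e\<close> would raise the rank of
  \<open>Z\<close> by exactly the one that contraction takes away.\<close>

lemma tight_contract_iff:
  assumes Z: "Z \<subseteq> E - {e}" and B: "B \<in> bases (contract M {e})"
  shows "tight M (extend e Z) (insert e B) \<longleftrightarrow> tight (contract M {e}) Z B"
proof -
  have eB: "e \<notin> B" "finite B" using B base_contract_iff[of B] finite_base[of "insert e B"] by auto
  have "{e} \<subseteq> E" using e by simp
  from mrank_contract[OF this Z] have rk: "mrank (contract M {e}) Z + 1 = r (insert e Z)"
    using rank_indep[OF e(2)] by simp
  show ?thesis
  proof (cases "e \<in> cl Z")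
    case True
    have "insert e B \<inter> insert e Z = insert e (B \<inter> Z)" by blast
    then show ?thesis using True eB unfolding tight_def extend_def by (simp add: rk[symmetric])
  next
    case False
    have "insert e B \<inter> Z = B \<inter> Z" using Z by blast
    then show ?thesis using False rk rank_insert_not_cl[OF e(1) False] unfolding tight_def extend_def by auto
  qed
qed

text \<open>Every face basis of the contraction becomes one of \<open>M\<close> by adding
  \<open>e\<close>. Two repairs remain: an element that became a loop is parallel to
  \<open>e\<close> and is swapped in for it, and \<open>e\<close>, unless a coloop, must be swapped
  out once. Either way the partner has to agree with \<open>e\<close> on the extended sets.\<close>

lemma nested_certificate_of_contract:
  assumes cert: "nested_certificate (contract M {e})"
  shows "nested_certificate M"
proof -
  let ?N = "contract M {e}"
  have sub: "{e} \<subseteq> E" using e by simp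
  interpret N: fin_matroid ?N by unfold_locales (rule is_matroid_contract[OF sub])
  obtain X Y where XY: "X \<subseteq> Y" "Y \<subseteq> E - {e}" "E - {e} - \<Union>(bases ?N) \<subseteq> X"
      "covered ?N X Y" "degenerate ?N X Y \<or> degenerate ?N Y X"
    by (rule N.nested_certificate_trimmed[OF cert]) simp
  let ?X = "extend e X" and ?Y = "extend e Y"
  have XE: "X \<subseteq> E - {e}" using XY by blast
  note tX = tight_contract_iff[OF XE] and tY = tight_contract_iff[OF XY(2)]
  have face: "insert e B \<in> face M ?X ?Y" if "B \<in> face ?N X Y" for B
    using that tX tY base_contract_iff unfolding face_def by blast
  obtain B0 where B0: "B0 \<in> face ?N X Y" by (rule N.covered_obtain[OF XY(4)])
  then have B0N: "B0 \<in> bases ?N" and t0: "tight ?N X B0" "tight ?N Y B0" unfolding face_def by auto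
  have eB0: "e \<notin> B0" and B1: "insert e B0 \<in> bases M" using B0N base_contract_iff by auto
  have fB0: "finite B0" "B0 \<subseteq> E" using finite_base[OF B1] base_subset_ground[OF B1] by auto
  have B1e: "insert e B0 - {e} = B0" using eB0 by blast
  have swap: "insert y B0 \<in> bases M \<longleftrightarrow> y \<notin> cl B0" if "y \<in> E" for y
    using base_swap_iff[OF B1 _ that, of e] unfolding B1e by simp
  have ncl: "e \<notin> cl B0" using swap[OF e(1)] B1 by simp
  have moved: "insert y B0 \<in> face M ?X ?Y"
    if y: "y \<in> E" "y \<noteq> e" "insert y B0 \<in> bases M" "y \<notin> B0"
      "y \<in> ?X \<longleftrightarrow> e \<in> ?X" "y \<in> ?Y \<longleftrightarrow> e \<in> ?Y" for y
  proof -
    have "y \<notin> insert e B0" "finite (insert e B0)" using y fB0 by auto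
    from card_swap_Int[OF this(2) _ this(1), of e ?X] card_swap_Int[OF this(2) _ this(1), of e ?Y]
    have "card (insert y B0 \<inter> ?X) = card (insert e B0 \<inter> ?X)"
      "card (insert y B0 \<inter> ?Y) = card (insert e B0 \<inter> ?Y)" using y(5,6) unfolding B1e by simp_all
    then show ?thesis using face[OF B0] y(3) unfolding face_def tight_def by simp
  qed
  \<comment> \<open>If \<open>e\<close> is not in \<open>cl Z\<close>, tightness in the contraction
    means that \<open>B0\<close> already fills \<open>Z\<close> up to its rank in \<open>M\<close>,
    so nothing more from \<open>Z\<close> can be added.\<close>
  have far: "y \<notin> Z"
    if "Z \<subseteq> E - {e}" "e \<notin> cl Z" "tight ?N Z B0" "insert y B0 \<in> bases M" "y \<notin> B0" for y Z
  proof
    assume y: "y \<in> Z"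
    have "mrank ?N Z + 1 = r (insert e Z)"
      using mrank_contract[OF sub that(1)] rank_indep[OF e(2)] by simp
    then have "card (B0 \<inter> Z) = r Z" using that(3) rank_insert_not_cl[OF e(1) that(2)] unfolding tight_def by simp
    moreover have "insert y B0 \<inter> Z = insert y (B0 \<inter> Z)" using y by blast
    ultimately show False using base_card_Int_le[OF that(4), of Z] that(5) fB0 by simp
  qed
  have meet: "\<exists>B\<in>face M ?X ?Y. f \<in> B" if f: "f \<in> \<Union>(bases M)" for f
  proof (cases "f = e \<or> f \<in> \<Union>(bases ?N)")
    case True
    then show ?thesis
    proof
      assume "f = e" then show ?thesis using face[OF B0] by blast
    next
      assume "f \<in> \<Union>(bases ?N)"
      then obtain B where "B \<in> face ?N X Y" "f \<in> B" using XY(4) unfolding covered_def by blast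
      then show ?thesis using face[of B] by blast
    qed
  next
    case False
    obtain B where B: "B \<in> bases M" "f \<in> B" using f by blast
    then have fE: "f \<in> E" and find: "{f} \<in> indeps M"
      using base_subset_ground[OF B(1)] indep_subset[OF base_indep[OF B(1)], of "{f}"] by auto
    have fX: "f \<in> X" "f \<in> Y" using XY(1,3) False fE by auto
    \<comment> \<open>An independent pair would extend to a basis and put \<open>f\<close> into a
      basis of the contraction; so \<open>f\<close> is parallel to \<open>e\<close>.\<close>
    have "{e, f} \<notin> indeps M"
    proof
      assume "{e, f} \<in> indeps M"
      then obtain B' where B': "B' \<in> bases M" "{e, f} \<subseteq> B'" by (rule base_extend)
      have "insert e (B' - {e}) = B'" using B'(2) by blast
      then have "B' - {e} \<in> bases ?N" using base_contract_iff B'(1) by simp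
      then show False using False B'(2) by blast
    qed
    then have ef: "e \<in> cl {f}" using insert_indep_iff[OF find e(1)] False by auto
    have e': "e \<in> ?X" "e \<in> ?Y"
      using ef cl_mono[of "{f}" X] cl_mono[of "{f}" Y] fX unfolding extend_def by auto
    have "f \<notin> cl B0" using cl_trans[of "{f}" B0] ef ncl by blast
    moreover have "f \<notin> B0" using B0N False by blast
    moreover have "f \<in> ?X" "f \<in> ?Y" using fX unfolding extend_def by auto
    ultimately have "insert f B0 \<in> face M ?X ?Y" using moved[OF fE] False swap[OF fE] e' by auto
    then show ?thesis by blast
  qed
  have avoid: "\<exists>B\<in>face M ?X ?Y. f \<notin> B" if f: "f \<notin> \<Inter>(bases M)" for f
  proof (cases "f = e")
    case True
    have "\<exists>y\<in>E. insert y B0 \<in> bases M \<and> y \<noteq> e \<and> y \<notin> B0 \<and> (y \<in> ?X \<longleftrightarrow> e \<in> ?X) \<and> (y \<in> ?Y \<longleftrightarrow> e \<in> ?Y)"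
    proof -
      have B0cl: "B0 \<subseteq> cl B0" using subset_cl[OF fB0(2)] .
      \<comment> \<open>By nesting, \<open>e\<close> lies in both extended sets, in
        \<open>?Y\<close> only, or in neither. Accordingly the partner is taken from
        \<open>X\<close>, from \<open>Y\<close>, or from a basis avoiding \<open>e\<close>;
        \<open>far\<close> keeps it out of the sets that do not contain \<open>e\<close>.\<close>
      consider "e \<in> cl X" | "e \<notin> cl X" "e \<in> cl Y" | "e \<notin> cl Y" by blast
      then show ?thesis
      proof cases
        case 1
        then have "\<not> X \<subseteq> cl B0" using cl_trans ncl by blast
        then obtain y where y: "y \<in> X" "y \<notin> cl B0" by blast
        have "y \<in> E" "y \<noteq> e" using XE y by auto
        moreover have "e \<in> ?X" "e \<in> ?Y" "y \<in> ?X" "y \<in> ?Y"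
          using 1 y XY(1) cl_mono[OF XY(1)] unfolding extend_def by auto
        ultimately show ?thesis using y(2) B0cl swap by blast
      next
        case 2
        then have "\<not> Y \<subseteq> cl B0" using cl_trans ncl by blast
        then obtain y where y: "y \<in> Y" "y \<notin> cl B0" by blast
        have yE: "y \<in> E" "y \<noteq> e" "y \<notin> B0" using XY(2) y B0cl by auto
        have b: "insert y B0 \<in> bases M" using swap[OF yE(1)] y by simp
        have "y \<notin> X" by (rule far[OF XE 2(1) t0(1) b yE(3)])
        moreover have "e \<notin> X" "e \<notin> Y" using XE XY(2) by auto
        ultimately have "y \<notin> ?X" "e \<notin> ?X" "e \<in> ?Y" "y \<in> ?Y"
          using 2 y yE unfolding extend_def by auto
        then show ?thesis using yE b by blast
      next
        case 3
        then have 3: "e \<notin> cl X" "e \<notin> cl Y" using cl_mono[OF XY(1)] by auto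
        obtain B2 where B2: "B2 \<in> bases M" "e \<notin> B2" using f True by blast
        obtain y where y: "y \<in> B2" "y \<notin> insert e B0" "insert y (insert e B0 - {e}) \<in> bases M"
          by (rule symmetric_exchangeE[OF symmetric_exchange_bases B1 B2(1) insertI1 B2(2)])
        have b: "insert y B0 \<in> bases M" "y \<notin> B0" "y \<noteq> e" using y unfolding B1e by auto
        have "y \<notin> X" "y \<notin> Y" using far[OF XE 3(1) t0(1) b(1,2)] far[OF XY(2) 3(2) t0(2) b(1,2)] .
        moreover have "e \<notin> X" "e \<notin> Y" using XE XY(2) by auto
        moreover have "y \<in> E" using base_subset_ground[OF B2(1)] y(1) by blast
        ultimately show ?thesis using b 3 unfolding extend_def by auto
      qed
    qed
    then obtain y where "y \<in> E" "insert y B0 \<in> bases M" "y \<noteq> e" "y \<notin> B0"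
      "y \<in> ?X \<longleftrightarrow> e \<in> ?X" "y \<in> ?Y \<longleftrightarrow> e \<in> ?Y" by blast
    then have "insert y B0 \<in> face M ?X ?Y" "e \<notin> insert y B0" using moved[of y] eB0 by auto
    then show ?thesis using True by blast
  next
    case False
    show ?thesis
    proof (rule ccontr)
      assume no: "\<not> ?thesis"
      \<comment> \<open>Otherwise \<open>f\<close> would be in every basis of the contraction, but
        exchanging it out of \<open>insert e B0\<close> keeps \<open>e\<close> and so yields one
        without \<open>f\<close>.\<close>
      have "f \<in> \<Inter>(face ?N X Y)" using no face False by blast
      then have fN: "f \<in> B" if "B \<in> bases ?N" for B using XY(4) that unfolding covered_def by blast
      obtain B2 where B2: "B2 \<in> bases M" "f \<notin> B2" using f by blast
      have f1: "f \<in> insert e B0" using fN[OF B0N] by simp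
      obtain x where x: "x \<in> B2" "x \<notin> insert e B0" "insert x (insert e B0 - {f}) \<in> bases M"
        by (rule symmetric_exchangeE[OF symmetric_exchange_bases B1 B2(1) f1 B2(2)])
      have "insert e (insert x (B0 - {f})) = insert x (insert e B0 - {f})" "e \<notin> insert x (B0 - {f})"
        using False x(2) eB0 by auto
      then have "insert x (B0 - {f}) \<in> bases ?N" using base_contract_iff x(3) by simp
      from fN[OF this] show False using x(1) B2(2) by blast
    qed
  qed
  have cov: "covered M ?X ?Y" by (rule coveredI[OF face[OF B0] meet avoid])
  have up: "degenerate M (extend e A) (extend e C)"
    if "degenerate ?N A C" "A \<subseteq> E - {e}" "C \<subseteq> E - {e}" for A C
    using that(1) tight_contract_iff[OF that(2)] tight_contract_iff[OF that(3)] base_contract_iff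
    unfolding degenerate_def by blast
  have "degenerate M ?X ?Y \<or> degenerate M ?Y ?X" using XY(5) up[OF _ XE XY(2)] up[OF _ XY(2) XE] by blast
  then show ?thesis using cov extend_mono[OF XY(1)] unfolding nested_certificate_def by blast
qed

end

context
  fixes e assumes e: "e \<in> E" and not_coloop: "\<exists>B\<in>bases M. e \<notin> B"
begin

lemma base_delete_iff: "B \<in> bases (delete M {e}) \<longleftrightarrow> B \<in> bases M \<and> e \<notin> B"
proof -
  interpret N: fin_matroid "delete M {e}" by unfold_locales (rule is_matroid_delete)
  obtain B0 where B0: "B0 \<in> bases M" "e \<notin> B0" using not_coloop by blast
  have "B0 \<subseteq> E - {e}" using base_subset_ground[OF B0(1)] B0(2) by blast
  from card_le_rank[OF base_indep[OF B0(1)] this]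
  have "r (E - {e}) = r E" using base_card[OF B0(1)] rank_mono[of "E - {e}" E] by simp
  then have "mrank (delete M {e}) (E - {e}) = r E" using mrank_delete[of "E - {e}" "{e}" M] by simp
  then show ?thesis unfolding N.base_iff base_iff by (auto simp: indeps_delete)
qed

lemma tight_delete_iff:
  assumes Z: "Z \<subseteq> E - {e}" and B: "B \<in> bases (delete M {e})"
  shows "tight M (extend e Z) B \<longleftrightarrow> tight (delete M {e}) Z B"
proof -
  have "e \<notin> B" using B base_delete_iff by simp
  then have "B \<inter> extend e Z = B \<inter> Z" unfolding extend_def by auto
  moreover have "r (extend e Z) = r Z" unfolding extend_def cl_def by auto
  moreover have "mrank (delete M {e}) Z = r Z" using Z by (intro mrank_delete) blast
  ultimately show ?thesis unfolding tight_def by simp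
qed

text \<open>Dual to contraction: face bases of the deletion stay face bases, \<open>e\<close> must
  be swapped in once unless it is a loop, and an element that became a coloop must be swapped out
  for \<open>e\<close>. The partners come from \<open>fundamental B0 e\<close>.\<close>

lemma nested_certificate_of_delete:
  assumes cert: "nested_certificate (delete M {e})"
  shows "nested_certificate M"
proof -
  let ?N = "delete M {e}"
  interpret N: fin_matroid ?N by unfold_locales (rule is_matroid_delete)
  obtain X Y where XY: "X \<subseteq> Y" "Y \<subseteq> E - {e}" "\<Inter>(bases ?N) \<inter> Y = {}"
      "covered ?N X Y" "degenerate ?N X Y \<or> degenerate ?N Y X"
    by (rule N.nested_certificate_trimmed[OF cert]) simp
  let ?X = "extend e X" and ?Y = "extend e Y"
  have XE: "X \<subseteq> E - {e}" using XY by blast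
  note tX = tight_delete_iff[OF XE] and tY = tight_delete_iff[OF XY(2)]
  have face: "B \<in> face M ?X ?Y" if "B \<in> face ?N X Y" for B
    using that tX tY base_delete_iff unfolding face_def by blast
  obtain B0 where B0: "B0 \<in> face ?N X Y" by (rule N.covered_obtain[OF XY(4)])
  then have B0N: "B0 \<in> bases ?N" and t0: "tight ?N X B0" "tight ?N Y B0" unfolding face_def by auto
  have eB0: "e \<notin> B0" and B0M: "B0 \<in> bases M" using B0N base_delete_iff by auto
  have fB0: "finite B0" using finite_base[OF B0M] .
  \<comment> \<open>Tightness makes \<open>B0 \<inter> Z\<close> span \<open>Z\<close> and hence
    \<open>e\<close>, so the fundamental circuit of \<open>e\<close> lies in \<open>Z\<close> apart
    from \<open>e\<close> itself.\<close>
  have span: "fundamental B0 e \<subseteq> Z" if Z: "Z \<subseteq> E - {e}" "e \<in> cl Z" "tight ?N Z B0" for Z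
  proof -
    have "mrank ?N Z = r Z" using Z(1) by (intro mrank_delete) blast
    then have "card (B0 \<inter> Z) = r Z" using Z(3) unfolding tight_def by simp
    moreover have "B0 \<inter> Z \<in> indeps M" using indep_subset[OF base_indep[OF B0M]] by blast
    ultimately have "Z \<subseteq> cl (B0 \<inter> Z)" using Z(1) by (intro spans_if_card_eq_rank) auto
    then have "e \<in> cl (B0 \<inter> Z)" using cl_trans Z(2) by blast
    from fundamental_subset[OF this B0M] show ?thesis by blast
  qed
  have moved: "insert e (B0 - {y}) \<in> face M ?X ?Y"
    if y: "y \<in> fundamental B0 e" "y \<in> ?X \<longleftrightarrow> e \<in> ?X" "y \<in> ?Y \<longleftrightarrow> e \<in> ?Y" for y
  proof -
    have yB: "y \<in> B0" "insert e (B0 - {y}) \<in> bases M" using y(1) unfolding fundamental_def by auto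
    from card_swap_Int[OF fB0 yB(1) eB0, of ?X] card_swap_Int[OF fB0 yB(1) eB0, of ?Y]
    show ?thesis using face[OF B0] yB(2) y(2,3) unfolding face_def tight_def by simp
  qed
  have meet: "\<exists>B\<in>face M ?X ?Y. f \<in> B" if f: "f \<in> \<Union>(bases M)" for f
  proof (cases "f = e")
    case False
    obtain B2 where B2: "B2 \<in> bases M" "f \<in> B2" using f by blast
    have "\<exists>B\<in>bases M. e \<notin> B \<and> f \<in> B"
    proof (cases "e \<in> B2")
      case True
      obtain B3 where B3: "B3 \<in> bases M" "e \<notin> B3" using not_coloop by blast
      obtain x where x: "x \<in> B3" "x \<notin> B2" "insert x (B2 - {e}) \<in> bases M"
        by (rule symmetric_exchangeE[OF symmetric_exchange_bases B2(1) B3(1) True B3(2)])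
      then show ?thesis using B2(2) B3(2) False by (intro bexI[of _ "insert x (B2 - {e})"]) auto
    qed (use B2 in blast)
    then have "f \<in> \<Union>(bases ?N)" using base_delete_iff by blast
    then obtain B where "B \<in> face ?N X Y" "f \<in> B" using XY(4) unfolding covered_def by blast
    then show ?thesis using face[of B] by blast
  next
    case True
    obtain B where B: "B \<in> bases M" "e \<in> B" using f True by blast
    then have "{e} \<in> indeps M" using indep_subset[OF base_indep[OF B(1)], of "{e}"] by simp
    then have "e \<notin> cl {}" using insert_indep_iff[OF indep_empty e] by simp
    note FC = in_cl_fundamental[OF B0M e eB0]
    have out: "\<not> fundamental B0 e \<subseteq> Z" if "e \<notin> cl Z" for Z using FC cl_mono[of _ Z] that by blast
    have FB: "fundamental B0 e \<subseteq> B0" unfolding fundamental_def by blast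
    have nX: "e \<notin> X" "e \<notin> Y" using XE XY(2) by auto
    have "\<exists>y\<in>fundamental B0 e. (y \<in> ?X \<longleftrightarrow> e \<in> ?X) \<and> (y \<in> ?Y \<longleftrightarrow> e \<in> ?Y)"
    proof -
      \<comment> \<open>The circuit lies inside every tight set whose closure contains
        \<open>e\<close> and leaves every set whose closure misses \<open>e\<close>. In the first
        case the latter is applied to the empty set, as \<open>e\<close> is no loop.\<close>
      consider "e \<in> cl X" | "e \<notin> cl X" "e \<in> cl Y" | "e \<notin> cl Y" by blast
      then show ?thesis
      proof cases
        case 1
        obtain y where y: "y \<in> fundamental B0 e" using out[OF \<open>e \<notin> cl {}\<close>] by blast
        then have "y \<in> X" using span[OF XE 1 t0(1)] by blast
        then have "e \<in> ?X" "e \<in> ?Y" "y \<in> ?X" "y \<in> ?Y"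
          using 1 XY(1) cl_mono[OF XY(1)] unfolding extend_def by auto
        then show ?thesis using y by blast
      next
        case 2
        obtain y where y: "y \<in> fundamental B0 e" "y \<notin> X" using out[OF 2(1)] by blast
        then have "y \<in> Y" using span[OF XY(2) 2(2) t0(2)] by blast
        then have "y \<notin> ?X" "e \<notin> ?X" "e \<in> ?Y" "y \<in> ?Y" using 2 y nX unfolding extend_def by auto
        then show ?thesis using y by blast
      next
        case 3
        obtain y where y: "y \<in> fundamental B0 e" "y \<notin> Y" using out[OF 3] by blast
        then have "y \<notin> ?X" "e \<notin> ?X" "e \<notin> ?Y" "y \<notin> ?Y"
          using 3 cl_mono[OF XY(1)] nX XY(1) unfolding extend_def by auto
        then show ?thesis using y by blast
      qed
    qed
    then obtain y where "y \<in> fundamental B0 e" "y \<in> ?X \<longleftrightarrow> e \<in> ?X" "y \<in> ?Y \<longleftrightarrow> e \<in> ?Y" by blast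
    from moved[OF this] show ?thesis using True by blast
  qed
  have avoid: "\<exists>B\<in>face M ?X ?Y. f \<notin> B" if f: "f \<notin> \<Inter>(bases M)" for f
  proof (rule ccontr)
    assume no: "\<not> ?thesis"
    have fe: "f \<noteq> e" using no face[OF B0] eB0 by blast
    have "f \<in> \<Inter>(face ?N X Y)" using no face by blast
    then have fN: "f \<in> \<Inter>(bases ?N)" using XY(4) unfolding covered_def by blast
    then have fY: "f \<notin> Y" "f \<notin> X" using XY(1,3) by auto
    have fB: "f \<in> B0" using fN B0N by blast
    obtain B2 where B2: "B2 \<in> bases M" "f \<notin> B2" using f by blast
    obtain x where x: "x \<in> B2" "x \<notin> B0" "insert x (B0 - {f}) \<in> bases M"
      by (rule symmetric_exchangeE[OF symmetric_exchange_bases B0M B2(1) fB B2(2)])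
    have fx: "f \<notin> insert x (B0 - {f})" using x(1) B2(2) by auto
    have "x = e"
    proof (rule ccontr)
      assume "x \<noteq> e"
      then have "insert x (B0 - {f}) \<in> bases ?N" using base_delete_iff x(3) eB0 by simp
      then show False using fN fx by blast
    qed
    \<comment> \<open>Trimming has put \<open>f\<close> outside \<open>Y\<close>; as
      \<open>f\<close> lies on the circuit of \<open>e\<close>, \<open>span\<close> keeps
      \<open>e\<close> out of both closures, so the memberships agree.\<close>
    then have FC: "f \<in> fundamental B0 e" using x(3) fB unfolding fundamental_def by simp
    then have "e \<notin> cl X" "e \<notin> cl Y" using span[OF XE _ t0(1)] span[OF XY(2) _ t0(2)] fY by auto
    then have "f \<in> ?X \<longleftrightarrow> e \<in> ?X" "f \<in> ?Y \<longleftrightarrow> e \<in> ?Y" using fY XE XY(2) unfolding extend_def by auto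
    then have "insert e (B0 - {f}) \<in> face M ?X ?Y" by (rule moved[OF FC])
    moreover have "f \<notin> insert e (B0 - {f})" using fx \<open>x = e\<close> by simp
    ultimately have "\<exists>B\<in>face M ?X ?Y. f \<notin> B" by (rule bexI[rotated])
    with no show False by (rule notE)
  qed
  have cov: "covered M ?X ?Y" by (rule coveredI[OF face[OF B0] meet avoid])
  have up: "degenerate M (extend e A) (extend e C)"
    if "degenerate ?N A C" "A \<subseteq> E - {e}" "C \<subseteq> E - {e}" for A C
    using that(1) tight_delete_iff[OF that(2)] tight_delete_iff[OF that(3)] base_delete_iff
    unfolding degenerate_def by blast
  have "degenerate M ?X ?Y \<or> degenerate M ?Y ?X" using XY(5) up[OF _ XE XY(2)] up[OF _ XY(2) XE] by blast
  then show ?thesis using cov extend_mono[OF XY(1)] unfolding nested_certificate_def by blast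
qed

end

lemma contract_loop:
  assumes e: "e \<in> E" "{e} \<notin> indeps M" shows "contract M {e} = delete M {e}"
proof -
  have "r {e} = 0" using e indep_iff_rank[of "{e}"] rank_le_card[of "{e}"] by auto
  then have "I \<in> indeps (contract M {e}) \<longleftrightarrow> I \<in> indeps (delete M {e})" for I
    using indep_contract_iff[of "{e}" "{}" I] indep_empty e(1) indep_subset_ground[of I]
    by (auto simp: indeps_delete)
  then show ?thesis by (intro matroid.equality) (auto simp: contract_def delete_def)
qed

lemma delete_coloop:
  assumes e: "e \<in> E" "\<not> (\<exists>B\<in>bases M. e \<notin> B)" shows "delete M {e} = contract M {e}"
proof -
  have ins: "insert e I \<in> indeps M" if I: "I \<in> indeps M" for I
  proof -
    obtain B where "B \<in> bases M" "I \<subseteq> B" by (rule base_extend[OF I])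
    then show ?thesis using e(2) indep_subset[OF base_indep, of B "insert e I"] by auto
  qed
  then have "{e} \<in> indeps M" using indep_empty by blast
  then have "I \<in> indeps (contract M {e}) \<longleftrightarrow> I \<in> indeps (delete M {e})" for I
    using indep_contract_iff[of "{e}" "{e}" I] rank_indep[of "{e}"] e(1) indep_subset_ground[of I]
      ins[of I] indep_subset[of "insert e I" I] by (auto simp: indeps_delete)
  then show ?thesis by (intro matroid.equality) (auto simp: contract_def delete_def)
qed

text \<open>Contracting a loop is deleting it, and deleting a coloop is contracting it. As no
  element is both, one of the two lifting lemmas always applies.\<close>

lemma nested_certificate_single:
  assumes e: "e \<in> E"
  shows "nested_certificate (contract M {e}) \<Longrightarrow> nested_certificate M"
    and "nested_certificate (delete M {e}) \<Longrightarrow> nested_certificate M"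
proof -
  have loop: "{e} \<in> indeps M \<or> (\<exists>B\<in>bases M. e \<notin> B)"
    using bases_nonempty base_indep indep_subset[of _ "{e}"] by (metis empty_subsetI ex_in_conv insert_subset)
  show "nested_certificate (contract M {e}) \<Longrightarrow> nested_certificate M"
    using nested_certificate_of_contract[OF e] nested_certificate_of_delete[OF e] contract_loop[OF e] loop
    by fastforce
  show "nested_certificate (delete M {e}) \<Longrightarrow> nested_certificate M"
    using nested_certificate_of_contract[OF e] nested_certificate_of_delete[OF e] delete_coloop[OF e] loop
    by fastforce
qed

end

theorem nested_certificate_minor:
  assumes "is_matroid M" "minor N M" "nested_certificate N"
  shows "nested_certificate M"
  using assms
proof (rule minor_lift_induct)
  fix M :: "'a matroid" and e assume M: "is_matroid M" "e \<in> ground M"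
  interpret fin_matroid M by unfold_locales (rule M)
  show "nested_certificate (contract M {e}) \<Longrightarrow> nested_certificate M"
    "nested_certificate (delete M {e}) \<Longrightarrow> nested_certificate M"
    using nested_certificate_single[OF M(2)] by blast+
qed

section \<open>Splits of hypersimplices\<close>

lemma char_vec_nth [simp]: "char_vec X $ i = of_bool (i \<in> X)"
  by (simp add: char_vec_def)

lemma inner_char_vec: "char_vec X \<bullet> x = (\<Sum>i\<in>X. x $ i)"
proof -
  have "char_vec X \<bullet> x = (\<Sum>i\<in>UNIV. of_bool (i \<in> X) * x $ i)" by (simp add: inner_vec_def)
  also have "\<dots> = (\<Sum>i\<in>X. x $ i)" by (rule sum.mono_neutral_cong_right) auto
  finally show ?thesis .
qed

lemma inner_char_vec_char_vec: "char_vec X \<bullet> char_vec Y = real (card (Y \<inter> X))"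
  unfolding inner_char_vec by (simp add: of_bool_def sum.If_cases Int_commute)

text \<open>One shape for the whole hypersimplex (\<open>F\<close> empty, both bounds 0) and for the
  two halves of a split. Integral bounds are what makes the vertices 0/1 vectors.\<close>

definition slab :: "'a::finite set \<Rightarrow> nat \<Rightarrow> 'a set \<Rightarrow> int \<Rightarrow> int \<Rightarrow> (real ^ 'a) set" where
  "slab E n F a b =
     {x \<in> unit_cube E. char_vec E \<bullet> x = real n \<and> of_int a \<le> char_vec F \<bullet> x \<and> char_vec F \<bullet> x \<le> of_int b}"

lemma unit_cube_iff: "x \<in> unit_cube E \<longleftrightarrow> (\<forall>i. 0 \<le> x $ i \<and> x $ i \<le> of_bool (i \<in> E))"
  unfolding unit_cube_def coord_space_def by (auto simp: order_class.order_eq_iff)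

lemma unit_cube_bounds:
  assumes "x \<in> unit_cube E"
  shows "0 \<le> x $ i" "x $ i \<le> 1" "i \<notin> E \<Longrightarrow> x $ i = 0"
proof -
  have "0 \<le> x $ i" "x $ i \<le> of_bool (i \<in> E)" using assms unfolding unit_cube_iff by auto
  then show "0 \<le> x $ i" "x $ i \<le> 1" "i \<notin> E \<Longrightarrow> x $ i = 0" by (auto simp: of_bool_def split: if_splits)
qed

lemma polytope_slab: "polytope (slab E n F a b)"
proof -
  have "slab E n F a b = (\<Inter>i\<in>UNIV. {x. axis i 1 \<bullet> x \<ge> 0}) \<inter> (\<Inter>i\<in>UNIV. {x. axis i 1 \<bullet> x \<le> of_bool (i \<in> E)}) \<inter>
      {x. char_vec E \<bullet> x = real n} \<inter> {x. char_vec F \<bullet> x \<ge> of_int a} \<inter> {x. char_vec F \<bullet> x \<le> of_int b}"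
    unfolding slab_def unit_cube_iff by (rule set_eqI) (simp add: inner_axis' all_conj_distrib conj_ac)
  moreover have "polyhedron \<dots>"
    by (intro polyhedron_Int polyhedron_Inter polyhedron_hyperplane polyhedron_halfspace_le polyhedron_halfspace_ge)
      (auto intro: polyhedron_halfspace_le polyhedron_halfspace_ge)
  moreover have "slab E n F a b \<subseteq> cbox 0 1"
    unfolding slab_def mem_box_cart subset_iff by (simp add: unit_cube_bounds[where E = E])
  then have "bounded (slab E n F a b)" using bounded_cbox bounded_subset by blast
  ultimately show ?thesis by (simp add: polytope_eq_bounded_polyhedron)
qed

lemma char_vec_in_slab:
  assumes "X \<subseteq> E" "card X = n" "a \<le> int (card (X \<inter> F))" "int (card (X \<inter> F)) \<le> b"
  shows "char_vec X \<in> slab E n F a b"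
proof -
  have "X \<inter> E = X" using assms by blast
  then show ?thesis
    using assms of_int_le_iff[where 'a = real, of a "int (card (X \<inter> F))"]
      of_int_le_iff[where 'a = real, of "int (card (X \<inter> F))" b]
    unfolding slab_def unit_cube_iff by (auto simp: inner_char_vec_char_vec)
qed

text \<open>A single fractional term cannot add up to an integer together with zeros and
  ones.\<close>

lemma second_fractional:
  fixes f :: "'a \<Rightarrow> real"
  assumes "finite S" "i \<in> S" "0 < f i" "f i < 1" "(\<Sum>i\<in>S. f i) \<in> \<int>"
    and box: "\<And>j. j \<in> S \<Longrightarrow> 0 \<le> f j \<and> f j \<le> 1"
  shows "\<exists>j\<in>S. j \<noteq> i \<and> 0 < f j \<and> f j < 1"
proof (rule ccontr)
  assume no: "\<not> ?thesis"
  have "f j \<in> \<int>" if "j \<in> S - {i}" for j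
  proof -
    have "f j = 0 \<or> f j = 1" using no box[of j] that by force
    then show ?thesis by auto
  qed
  then have "(\<Sum>j\<in>S - {i}. f j) \<in> \<int>" by (rule Ints_sum)
  then have "(\<Sum>i\<in>S. f i) - (\<Sum>j\<in>S - {i}. f j) \<in> \<int>" using assms(5) by (rule Ints_diff[rotated])
  then have "f i \<in> \<int>" using sum.remove[OF assms(1,2), of f] by simp
  then obtain k where "f i = of_int k" by (rule Ints_cases)
  then show False using assms(3,4) by simp
qed

text \<open>The cross-section constraints are integral, so a fractional coordinate of a point comes with
  a second one on which mass can be traded in both directions.\<close>

lemma extreme_point_of_slab:
  assumes F: "F \<subseteq> E" and v: "v extreme_point_of slab E n F a b"
  shows "\<exists>X\<subseteq>E. card X = n \<and> v = char_vec X"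
proof -
  have vS: "v \<in> slab E n F a b" and ext: "\<And>p q. p \<in> slab E n F a b \<Longrightarrow> q \<in> slab E n F a b \<Longrightarrow> v \<notin> open_segment p q"
    using v unfolding extreme_point_of_def by auto
  have box: "0 \<le> v $ i" "v $ i \<le> 1" "i \<notin> E \<Longrightarrow> v $ i = 0" for i
    using vS unit_cube_bounds[of v E i] unfolding slab_def by auto
  have sE: "(\<Sum>i\<in>E. v $ i) = real n" and sF: "of_int a \<le> (\<Sum>i\<in>F. v $ i)" "(\<Sum>i\<in>F. v $ i) \<le> of_int b"
    using vS unfolding slab_def inner_char_vec by auto
  have int: "v $ i = 0 \<or> v $ i = 1" for i
  proof (rule ccontr)
    assume "\<not> ?thesis"
    then have i: "0 < v $ i" "v $ i < 1" using box[of i] by auto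
    then have iE: "i \<in> E" using box(3)[of i] by force
    have "\<exists>j\<in>E. j \<noteq> i \<and> 0 < v $ j \<and> v $ j < 1 \<and>
        ((i \<in> F \<longleftrightarrow> j \<in> F) \<or> of_int a < (\<Sum>i\<in>F. v $ i) \<and> (\<Sum>i\<in>F. v $ i) < of_int b)"
    proof (cases "(\<Sum>i\<in>F. v $ i) \<in> \<int>")
      case True
      have "(\<Sum>i\<in>E - F. v $ i) = real n - (\<Sum>i\<in>F. v $ i)" using sum_diff[of E F "\<lambda>i. v $ i"] F sE by simp
      then have "(\<Sum>i\<in>E - F. v $ i) \<in> \<int>" using True by simp
      then have rest: "(\<Sum>i\<in>E - F. v $ i) \<in> \<int>" .
      have "\<exists>j\<in>E. j \<noteq> i \<and> 0 < v $ j \<and> v $ j < 1 \<and> (i \<in> F \<longleftrightarrow> j \<in> F)"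
      proof (cases "i \<in> F")
        case iF: True
        have "\<exists>j\<in>F. j \<noteq> i \<and> 0 < v $ j \<and> v $ j < 1"
          by (rule second_fractional[where f = "\<lambda>i. v $ i", OF _ iF i(1,2) True]) (auto simp: box)
        then show ?thesis using iF F by blast
      next
        case iF: False
        then have "i \<in> E - F" using iE by blast
        have "\<exists>j\<in>E - F. j \<noteq> i \<and> 0 < v $ j \<and> v $ j < 1"
          by (rule second_fractional[where f = "\<lambda>i. v $ i", OF _ \<open>i \<in> E - F\<close> i(1,2) rest]) (auto simp: box)
        then show ?thesis using iF by blast
      qed
      then show ?thesis by blast
    next
      case False
      then have "of_int a \<noteq> (\<Sum>i\<in>F. v $ i)" "of_int b \<noteq> (\<Sum>i\<in>F. v $ i)" by (metis Ints_of_int)+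
      then have "of_int a < (\<Sum>i\<in>F. v $ i)" "(\<Sum>i\<in>F. v $ i) < of_int b" using sF by auto
      moreover have "\<exists>j\<in>E. j \<noteq> i \<and> 0 < v $ j \<and> v $ j < 1"
        by (rule second_fractional[where f = "\<lambda>i. v $ i", OF _ iE i(1,2)]) (auto simp: box sE)
      ultimately show ?thesis by blast
    qed
    then obtain j where j: "j \<in> E" "j \<noteq> i" "0 < v $ j" "v $ j < 1"
        and side: "(i \<in> F \<longleftrightarrow> j \<in> F) \<or> of_int a < (\<Sum>i\<in>F. v $ i) \<and> (\<Sum>i\<in>F. v $ i) < of_int b" by blast
    \<comment> \<open>If \<open>i\<close> and \<open>j\<close> are on the same side of
      \<open>F\<close>, the trade keeps the sum over \<open>F\<close> and any positive value would
      do; otherwise the distance to the nearer bound limits it.\<close>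
    define slack where "slack = (if i \<in> F \<longleftrightarrow> j \<in> F then 1
      else min ((\<Sum>i\<in>F. v $ i) - of_int a) (of_int b - (\<Sum>i\<in>F. v $ i)))"
    have "0 < slack" using side unfolding slack_def by auto
    define t where "t = Min {v $ i, 1 - v $ i, v $ j, 1 - v $ j, slack}"
    have t: "0 < t" "t \<le> v $ i" "t \<le> 1 - v $ i" "t \<le> v $ j" "t \<le> 1 - v $ j" "t \<le> slack"
      unfolding t_def using i j \<open>0 < slack\<close> by auto
    define d where "d = axis i (1::real) - axis j 1"
    have d: "d $ k = of_bool (k = i) - of_bool (k = j)" for k
      unfolding d_def axis_def by auto
    have dS: "(\<Sum>k\<in>S. d $ k) = of_bool (i \<in> S) - of_bool (j \<in> S)" for S
      unfolding d sum_subtractf by (simp add: of_bool_def)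
    have move: "v + s *\<^sub>R d \<in> slab E n F a b" if s: "\<bar>s\<bar> = t" for s
    proof -
      have s2: "\<bar>s\<bar> \<le> v $ i" "\<bar>s\<bar> \<le> 1 - v $ i" "\<bar>s\<bar> \<le> v $ j" "\<bar>s\<bar> \<le> 1 - v $ j" "\<bar>s\<bar> \<le> slack"
        using t s by auto
      have "0 \<le> v $ k + s * d $ k \<and> v $ k + s * d $ k \<le> of_bool (k \<in> E)" for k
        using box[of k] s2 j iE unfolding d by (cases "k = i"; cases "k = j"; cases "k \<in> E"; auto)
      then have "v + s *\<^sub>R d \<in> unit_cube E" unfolding unit_cube_iff by simp
      moreover have sum: "(\<Sum>k\<in>S. (v + s *\<^sub>R d) $ k) = (\<Sum>k\<in>S. v $ k) + s * (of_bool (i \<in> S) - of_bool (j \<in> S))" for S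
        using dS[of S] by (simp add: sum.distrib sum_distrib_left[symmetric])
      moreover have "of_int a \<le> (\<Sum>k\<in>F. (v + s *\<^sub>R d) $ k)" "(\<Sum>k\<in>F. (v + s *\<^sub>R d) $ k) \<le> of_int b"
        unfolding sum using s2(5) sF unfolding slack_def
        by (cases "i \<in> F"; cases "j \<in> F"; auto)+
      ultimately show ?thesis using sE iE j unfolding slab_def inner_char_vec by simp
    qed
    have "d \<noteq> 0" using d[of i] j(2) by auto
    then have "v + t *\<^sub>R d \<noteq> v + (- t) *\<^sub>R d" using t(1) by (simp add: eq_neg_iff_add_eq_0 scaleR_left_distrib[symmetric])
    moreover have "midpoint (v + t *\<^sub>R d) (v + (- t) *\<^sub>R d) = v"
      unfolding midpoint_def by (simp add: algebra_simps scaleR_2[symmetric])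
    ultimately have "v \<in> open_segment (v + t *\<^sub>R d) (v + (- t) *\<^sub>R d)" by (metis midpoint_in_open_segment)
    then show False using ext[OF move move, of t "- t"] t(1) by simp
  qed
  define X where "X = {i. v $ i = 1}"
  have "v = char_vec X" using int unfolding X_def by (auto simp: vec_eq_iff of_bool_def)
  moreover have "X \<subseteq> E" using box(3) unfolding X_def by force
  moreover from this have "X \<inter> E = X" by blast
  then have "card X = n" using sE \<open>v = char_vec X\<close> inner_char_vec_char_vec[of E X] unfolding inner_char_vec by simp
  ultimately show ?thesis by blast
qed

lemma slab_trivial: "slab E n {} 0 0 = {x \<in> unit_cube E. char_vec E \<bullet> x = real n}"
  unfolding slab_def by (simp add: inner_char_vec)

text \<open>Minkowski's theorem, the vertices of the cube section being known from
  \<open>extreme_point_of_slab\<close>.\<close>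

lemma hypersimplex_eq: "hypersimplex n E = {x \<in> unit_cube E. char_vec E \<bullet> x = real n}"
proof
  have "char_vec X \<in> slab E n {} 0 0" if "X \<subseteq> E" "card X = n" for X
    by (rule char_vec_in_slab[OF that]) simp_all
  then have "char_vec ` {X. X \<subseteq> E \<and> card X = n} \<subseteq> slab E n {} 0 0" by blast
  then show "hypersimplex n E \<subseteq> {x \<in> unit_cube E. char_vec E \<bullet> x = real n}"
    unfolding hypersimplex_def slab_trivial[symmetric]
    by (intro hull_minimal polytope_imp_convex polytope_slab)
  have "{x. x extreme_point_of slab E n {} 0 0} \<subseteq> char_vec ` {X. X \<subseteq> E \<and> card X = n}"
    using extreme_point_of_slab[of "{}"] by blast
  then have "convex hull {x. x extreme_point_of slab E n {} 0 0} \<subseteq> hypersimplex n E"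
    unfolding hypersimplex_def by (rule hull_mono)
  then show "{x \<in> unit_cube E. char_vec E \<bullet> x = real n} \<subseteq> hypersimplex n E"
    using Krein_Milman_Minkowski[OF polytope_imp_compact polytope_imp_convex, OF polytope_slab polytope_slab, of E n "{}" 0 0]
    unfolding slab_trivial by simp
qed

lemma char_vec_extreme:
  assumes "X \<subseteq> E" "card X = n"
  shows "char_vec X extreme_point_of hypersimplex n E"
  unfolding extreme_point_of_def
proof (intro conjI ballI notI)
  show "char_vec X \<in> hypersimplex n E" unfolding hypersimplex_def using assms by (intro hull_inc) auto
  fix p q assume pq: "p \<in> hypersimplex n E" "q \<in> hypersimplex n E" and seg: "char_vec X \<in> open_segment p q"
  obtain u where u: "0 < u" "u < 1" "char_vec X = (1 - u) *\<^sub>R p + u *\<^sub>R q" "p \<noteq> q"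
    using seg unfolding in_segment by blast
  have "p $ i = q $ i" for i
  proof -
    have e: "of_bool (i \<in> X) = (1 - u) * p $ i + u * q $ i" using arg_cong[OF u(3), of "\<lambda>v. v $ i"] by simp
    have b: "0 \<le> p $ i" "0 \<le> q $ i" "p $ i \<le> 1" "q $ i \<le> 1"
      using pq unit_cube_bounds[of _ E i] unfolding hypersimplex_eq by auto
    show ?thesis
    proof (cases "i \<in> X")
      case True
      then have "(1 - u) * (1 - p $ i) + u * (1 - q $ i) = 0" using e by (simp add: algebra_simps)
      moreover have "0 \<le> (1 - u) * (1 - p $ i)" "0 \<le> u * (1 - q $ i)" using u b by auto
      ultimately have "(1 - u) * (1 - p $ i) = 0" "u * (1 - q $ i) = 0" by linarith+
      then show ?thesis using u by auto
    next
      case False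
      then have "(1 - u) * p $ i + u * q $ i = 0" using e by simp
      moreover have "0 \<le> (1 - u) * p $ i" "0 \<le> u * q $ i" using u b by auto
      ultimately have "(1 - u) * p $ i = 0" "u * q $ i = 0" by linarith+
      then show ?thesis using u by auto
    qed
  qed
  then show False using u(4) by (simp add: vec_eq_iff)
qed

text \<open>The cells are the two closed halves of the hypersimplex and all their faces. Integrality
  of \<open>k\<close> prevents new vertices; \<open>A\<close> and \<open>C\<close>, strictly on
  either side, show that neither half contains the other, so there are exactly two maximal
  cells.\<close>

lemma hypersimplex_split:
  fixes E F :: "'a::finite set"
  assumes F: "F \<subseteq> E" and A: "A \<subseteq> E" "card A = n" "card (A \<inter> F) < k" and C: "C \<subseteq> E" "card C = n" "k < card (C \<inter> F)"
  shows "split_hyperplane (hypersimplex n E) (affine hull (hypersimplex n E \<inter> {x. char_vec F \<bullet> x = real k}))"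
proof -
  let ?D = "hypersimplex n E"
  define Q where "Q = slab E n F 0 (int k)"
  define R where "R = slab E n F (int k) (int (card F))"
  have bound: "0 \<le> char_vec F \<bullet> x" "char_vec F \<bullet> x \<le> real (card F)" if "x \<in> ?D" for x
  proof -
    have b: "0 \<le> x $ i" "x $ i \<le> 1" for i
      using that unit_cube_bounds[of x E i] unfolding hypersimplex_eq by auto
    show "0 \<le> char_vec F \<bullet> x" unfolding inner_char_vec using b by (intro sum_nonneg) auto
    show "char_vec F \<bullet> x \<le> real (card F)"
      unfolding inner_char_vec using sum_mono[of F "\<lambda>i. x $ i" "\<lambda>_. 1"] b by simp
  qed
  have Q: "Q = ?D \<inter> {x. char_vec F \<bullet> x \<le> real k}" and R: "R = ?D \<inter> {x. char_vec F \<bullet> x \<ge> real k}"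
    using bound unfolding Q_def R_def slab_def hypersimplex_eq by auto
  have QR: "Q \<inter> R = ?D \<inter> {x. char_vec F \<bullet> x = real k}" and union: "Q \<union> R = ?D" unfolding Q R by auto
  have polyQR: "polytope Q" "polytope R" unfolding Q_def R_def by (rule polytope_slab)+
  note conv = polyQR[THEN polytope_imp_convex]
  have "Q \<inter> {x. char_vec F \<bullet> x = real k} face_of Q"
    by (rule face_of_Int_supporting_hyperplane_le[OF conv(1)]) (auto simp: Q)
  moreover have "R \<inter> {x. char_vec F \<bullet> x = real k} face_of R"
    by (rule face_of_Int_supporting_hyperplane_ge[OF conv(2)]) (auto simp: R)
  moreover have "Q \<inter> {x. char_vec F \<bullet> x = real k} = Q \<inter> R" "R \<inter> {x. char_vec F \<bullet> x = real k} = Q \<inter> R"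
    unfolding QR Q R by auto
  ultimately have faceQR: "Q \<inter> R face_of Q" "Q \<inter> R face_of R" by simp_all
  have "char_vec A \<in> ?D" "char_vec C \<in> ?D" using A C unfolding hypersimplex_def by (auto intro!: hull_inc)
  then have nA: "char_vec A \<in> Q" "char_vec A \<notin> R" and nC: "char_vec C \<in> R" "char_vec C \<notin> Q"
    using A C unfolding Q R by (auto simp: inner_char_vec_char_vec)
  define \<C> where "\<C> = {K. K face_of Q \<or> K face_of R}"
  have sub: "K \<subseteq> Q \<or> K \<subseteq> R" if "K \<in> \<C>" for K using that unfolding \<C>_def by (auto dest: face_of_imp_subset)
  have mem: "Q \<in> \<C>" "R \<in> \<C>" unfolding \<C>_def using conv by (auto intro: face_of_refl)
  have max: "maximal_cell \<C> K \<longleftrightarrow> K = Q \<or> K = R" for K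
  proof
    assume K: "maximal_cell \<C> K"
    then have "K \<in> \<C>" unfolding maximal_cell_def by simp
    from sub[OF this] show "K = Q \<or> K = R" using K mem unfolding maximal_cell_def by blast
  next
    have "L = Q" if "L \<in> \<C>" "Q \<subseteq> L" for L using sub[OF that(1)] that(2) nA by blast
    moreover have "L = R" if "L \<in> \<C>" "R \<subseteq> L" for L using sub[OF that(1)] that(2) nC by blast
    moreover assume "K = Q \<or> K = R"
    ultimately show "maximal_cell \<C> K" unfolding maximal_cell_def using mem by blast
  qed
  have extr: "v extreme_point_of ?D" if "v extreme_point_of Q \<or> v extreme_point_of R" for v
  proof -
    have "\<exists>X\<subseteq>E. card X = n \<and> v = char_vec X"
      using that unfolding Q_def R_def by (elim disjE extreme_point_of_slab[OF F])
    then show ?thesis using char_vec_extreme by auto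
  qed
  have meet: "K \<inter> L face_of K" if K: "K \<in> \<C>" and L: "L \<in> \<C>" for K L
  proof -
    have same: "K \<inter> L face_of K" if "K face_of T" "L face_of T" for T
      using face_of_subset[OF face_of_Int[OF that]] face_of_imp_subset[OF that(1)] by blast
    \<comment> \<open>Faces of different halves meet inside the common face
      \<open>T \<inter> U\<close>, where both traces are faces; transitivity of faces carries this
      back to \<open>T\<close>.\<close>
    have cross: "K \<inter> L face_of K"
      if KT: "K face_of T" and LU: "L face_of U" and TU: "T \<inter> U face_of T" "T \<inter> U face_of U" for T U
    proof -
      have "K \<inter> (T \<inter> U) face_of (T \<inter> U)"
        using face_of_subset[OF face_of_Int[OF KT TU(1)]] face_of_imp_subset[OF TU(1)] by blast
      moreover have "L \<inter> (T \<inter> U) face_of (T \<inter> U)"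
        using face_of_subset[OF face_of_Int[OF LU TU(2)]] face_of_imp_subset[OF TU(2)] by blast
      ultimately have "(K \<inter> (T \<inter> U)) \<inter> (L \<inter> (T \<inter> U)) face_of (T \<inter> U)" by (rule face_of_Int)
      moreover have "(K \<inter> (T \<inter> U)) \<inter> (L \<inter> (T \<inter> U)) = K \<inter> L"
        using face_of_imp_subset[OF KT] face_of_imp_subset[OF LU] by blast
      ultimately have "K \<inter> L face_of (T \<inter> U)" by simp
      then have "K \<inter> L face_of T" using TU(1) face_of_trans by blast
      then show ?thesis using face_of_subset face_of_imp_subset[OF KT] by blast
    qed
    have faceRQ: "R \<inter> Q face_of R" "R \<inter> Q face_of Q" using faceQR by (simp_all add: Int_commute)
    from K L show ?thesis
      unfolding \<C>_def mem_Collect_eq using same cross[OF _ _ faceQR] cross[OF _ _ faceRQ] by (elim disjE) simp_all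
  qed
  have "polytope_split ?D \<C>"
    unfolding polytope_split_def
  proof (intro conjI ballI allI impI)
    show "polytope K" if "K \<in> \<C>" for K
      using that polyQR face_of_polytope_polytope unfolding \<C>_def by auto
    show "{} \<in> \<C>" unfolding \<C>_def by simp
    show "v extreme_point_of ?D" if "K \<in> \<C>" "v extreme_point_of K" for K v
      using that extr extreme_point_of_face unfolding \<C>_def by blast
    show "L \<in> \<C>" if "K \<in> \<C>" "L face_of K" for K L
      using that face_of_trans unfolding \<C>_def by blast
    show "K \<inter> L face_of K" if "K \<in> \<C>" "L \<in> \<C>" for K L by (rule meet[OF that])
    show "K \<inter> L face_of L" if "K \<in> \<C>" "L \<in> \<C>" for K L using meet[OF that(2,1)] by (simp add: Int_commute)
    show "\<Union>\<C> = ?D" using union mem sub by blast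
    have "{K. maximal_cell \<C> K} = {Q, R}" using max by auto
    moreover have "Q \<noteq> R" using nA by blast
    ultimately show "card {K. maximal_cell \<C> K} = 2" by simp
  qed
  moreover have "Q \<noteq> R" using nA by blast
  moreover have "maximal_cell \<C> Q" "maximal_cell \<C> R" using max by simp_all
  ultimately show ?thesis unfolding split_hyperplane_def QR[symmetric] by auto
qed

section \<open>The matroid polytope\<close>

lemma convex_unit_cube: "convex (unit_cube E)"
proof (rule convexI)
  fix x y :: "real ^ 'a" and u v :: real
  assume xy: "x \<in> unit_cube E" "y \<in> unit_cube E" and uv: "0 \<le> u" "0 \<le> v" "u + v = 1"
  show "u *\<^sub>R x + v *\<^sub>R y \<in> unit_cube E"
    unfolding unit_cube_iff
  proof
    fix i
    have "x $ i \<le> of_bool (i \<in> E)" "y $ i \<le> of_bool (i \<in> E)" using xy unfolding unit_cube_iff by auto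
    from convex_bound_le[OF this uv] unit_cube_bounds(1)[OF xy(1), of i] unit_cube_bounds(1)[OF xy(2), of i] uv
    show "0 \<le> (u *\<^sub>R x + v *\<^sub>R y) $ i \<and> (u *\<^sub>R x + v *\<^sub>R y) $ i \<le> of_bool (i \<in> E)" by simp
  qed
qed

locale polytope_matroid = fin_matroid M for M :: "'a::finite matroid"
begin

abbreviation "P \<equiv> matroid_polytope M"

definition cut :: "'a set \<Rightarrow> (real ^ 'a) set" where
  "cut X = P \<inter> {x. char_vec X \<bullet> x = real (r X)}"

lemma polytope_P: "polytope P"
  unfolding polytope_def matroid_polytope_def by (intro exI[of _ "char_vec ` bases M"]) simp

lemma convex_P: "convex P" and polyhedron_P: "polyhedron P"
  using polytope_P by (simp_all add: polytope_imp_convex polytope_imp_polyhedron)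

lemma vertex_in_P: "B \<in> bases M \<Longrightarrow> char_vec B \<in> P"
  unfolding matroid_polytope_def by (intro hull_inc) simp

lemma P_subset_hypersimplex: "P \<subseteq> hypersimplex (r E) E"
proof -
  have "B \<in> {X. X \<subseteq> E \<and> card X = r E}" if "B \<in> bases M" for B
    using base_subset_ground[OF that] base_card[OF that] by simp
  then have "bases M \<subseteq> {X. X \<subseteq> E \<and> card X = r E}" by blast
  then show ?thesis
    unfolding matroid_polytope_def hypersimplex_def by (intro hull_mono image_mono)
qed

lemma P_unit_cube: "x \<in> P \<Longrightarrow> x \<in> unit_cube E" and P_total: "x \<in> P \<Longrightarrow> char_vec E \<bullet> x = real (r E)"
  using P_subset_hypersimplex unfolding hypersimplex_eq by auto

lemma P_le:
  assumes "\<And>B. B \<in> bases M \<Longrightarrow> w \<bullet> char_vec B \<le> c" and "x \<in> P" shows "w \<bullet> x \<le> c"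
proof -
  have "P \<subseteq> {x. w \<bullet> x \<le> c}"
    unfolding matroid_polytope_def by (intro hull_minimal convex_halfspace_le) (auto simp: assms)
  then show ?thesis using assms(2) by blast
qed

lemma P_rank_le: "x \<in> P \<Longrightarrow> char_vec X \<bullet> x \<le> real (r X)"
  by (rule P_le) (simp_all add: inner_char_vec_char_vec base_card_Int_le)

lemma affine_P_eq:
  assumes "\<And>B. B \<in> bases M \<Longrightarrow> w \<bullet> char_vec B = c" and "x \<in> affine hull P" shows "w \<bullet> x = c"
proof -
  have "affine hull (char_vec ` bases M) \<subseteq> {x. w \<bullet> x = c}"
    by (intro hull_minimal affine_hyperplane) (auto simp: assms)
  then show ?thesis using assms(2) unfolding matroid_polytope_def by auto
qed

lemma cut_face: "cut X face_of P"
  unfolding cut_def by (rule face_of_Int_supporting_hyperplane_le[OF convex_P P_rank_le])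

lemma vertex_in_cut: "B \<in> bases M \<Longrightarrow> char_vec B \<in> cut X \<longleftrightarrow> tight M X B"
  unfolding cut_def tight_def by (simp add: vertex_in_P inner_char_vec_char_vec)

lemma cut_subset_P: "cut X \<subseteq> P"
  unfolding cut_def by simp

lemma face_hull:
  assumes T: "T face_of P"
  shows "T = convex hull (char_vec ` {B \<in> bases M. char_vec B \<in> T})"
proof
  have "compact (char_vec ` bases M)" by (intro finite_imp_compact) simp
  then obtain S where S: "S \<subseteq> char_vec ` bases M" "T = convex hull S"
    using face_of_convex_hull_subset T unfolding matroid_polytope_def by metis
  have "S \<subseteq> T" unfolding S(2) by (rule hull_subset)
  then have "S \<subseteq> char_vec ` {B \<in> bases M. char_vec B \<in> T}" using S(1) by blast
  then show "T \<subseteq> convex hull (char_vec ` {B \<in> bases M. char_vec B \<in> T})"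
    using S(2) hull_mono by metis
  show "convex hull (char_vec ` {B \<in> bases M. char_vec B \<in> T}) \<subseteq> T"
    by (intro hull_minimal face_of_imp_convex[OF T]) auto
qed

lemma face_vertex:
  assumes T: "T face_of P" "T \<noteq> {}"
  shows "\<exists>B\<in>bases M. char_vec B \<in> T"
proof (rule ccontr)
  assume "\<not> ?thesis"
  then have none: "{B \<in> bases M. char_vec B \<in> T} = {}" by blast
  have "T = {}" by (subst face_hull[OF T(1)]) (simp add: none)
  then show False using T(2) by simp
qed

text \<open>Faces of \<open>P\<close> are hulls of the base vectors they contain, so they can be
  compared on bases alone. This is the bridge from tightness to geometry.\<close>

lemma face_subset:
  assumes "T face_of P" "U face_of P" "\<And>B. B \<in> bases M \<Longrightarrow> char_vec B \<in> T \<Longrightarrow> char_vec B \<in> U"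
  shows "T \<subseteq> U"
proof -
  have "char_vec ` {B \<in> bases M. char_vec B \<in> T} \<subseteq> char_vec ` {B \<in> bases M. char_vec B \<in> U}"
    using assms(3) by blast
  then have "convex hull (char_vec ` {B \<in> bases M. char_vec B \<in> T}) \<subseteq>
      convex hull (char_vec ` {B \<in> bases M. char_vec B \<in> U})" by (rule hull_mono)
  then show ?thesis
    unfolding face_hull[OF assms(1), symmetric] face_hull[OF assms(2), symmetric] .
qed

lemma cut_eq_P_iff: "cut X = P \<longleftrightarrow> (\<forall>B\<in>bases M. tight M X B)"
proof
  show "cut X = P \<Longrightarrow> \<forall>B\<in>bases M. tight M X B" using vertex_in_cut vertex_in_P by blast
  assume "\<forall>B\<in>bases M. tight M X B"
  then have "P \<subseteq> cut X"
    by (intro face_subset[OF face_of_refl[OF convex_P] cut_face]) (simp add: vertex_in_cut)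
  then show "cut X = P" using cut_subset_P by blast
qed

text \<open>Strict cube inequalities, except for the coordinates of loops and coloops, which are
  constant on the affine hull of \<open>P\<close>. It is the relative interior condition in
  coordinates.\<close>

definition spread :: "real ^ 'a \<Rightarrow> bool" where
  "spread z \<longleftrightarrow> (\<forall>i\<in>\<Union>(bases M). 0 < z $ i) \<and> (\<forall>i. i \<notin> \<Inter>(bases M) \<longrightarrow> z $ i < 1)"

lemma affine_P_fixed_coords:
  assumes z: "z \<in> affine hull P"
  shows "i \<notin> \<Union>(bases M) \<Longrightarrow> z $ i = 0" "i \<in> \<Inter>(bases M) \<Longrightarrow> z $ i = 1"
proof -
  have ax: "axis i 1 \<bullet> x = x $ i" for x :: "real ^ 'a" by (simp add: inner_axis')
  show "i \<notin> \<Union>(bases M) \<Longrightarrow> z $ i = 0"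
    using affine_P_eq[of "axis i 1" 0, OF _ z] unfolding ax by auto
  show "i \<in> \<Inter>(bases M) \<Longrightarrow> z $ i = 1"
    using affine_P_eq[of "axis i 1" 1, OF _ z] unfolding ax by auto
qed

lemma spread_unit_cube:
  assumes z: "z \<in> affine hull P" and s: "spread z" shows "z \<in> unit_cube E"
  unfolding unit_cube_iff
proof
  fix i
  have bE: "B \<subseteq> E" if "B \<in> bases M" for B using base_subset_ground[OF that] .
  obtain B where B: "B \<in> bases M" using bases_nonempty by blast
  consider "i \<notin> \<Union>(bases M)" | "i \<in> \<Inter>(bases M)" | "i \<in> \<Union>(bases M)" "i \<notin> \<Inter>(bases M)" by blast
  then show "0 \<le> z $ i \<and> z $ i \<le> of_bool (i \<in> E)"
  proof cases
    case 1
    then show ?thesis using affine_P_fixed_coords(1)[OF z] by simp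
  next
    case 2
    then have "i \<in> E" using B bE by blast
    then show ?thesis using affine_P_fixed_coords(2)[OF z] 2 by simp
  next
    case 3
    then have "i \<in> E" using bE by blast
    moreover have "0 < z $ i" "z $ i < 1" using s 3 unfolding spread_def by blast+
    ultimately show ?thesis by simp
  qed
qed

text \<open>Prolonging the segment from a base vector through an interior point \<open>z\<close>
  stays in the cube, which forces strictness wherever the base vector has the extreme value.
  Conversely, a prolongation by the least positive distance to the walls stays inside.\<close>

lemma rel_interior_cube_iff:
  "z \<in> rel_interior (affine hull P \<inter> unit_cube E) \<longleftrightarrow> z \<in> affine hull P \<and> spread z"
proof -
  let ?Q = "affine hull P \<inter> unit_cube E"
  have conv: "convex ?Q" by (intro convex_Int affine_imp_convex affine_affine_hull convex_unit_cube)
  have vQ: "char_vec B \<in> ?Q" if "B \<in> bases M" for B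
    using hull_inc[OF vertex_in_P[OF that], of affine] P_unit_cube[OF vertex_in_P[OF that]] by simp
  have ne: "?Q \<noteq> {}" using vQ bases_nonempty by blast
  note iff = convex_rel_interior_iff[OF conv ne, of z]
  show ?thesis
  proof
    assume z: "z \<in> rel_interior ?Q"
    then have zQ: "z \<in> ?Q" using rel_interior_subset by blast
    have step: "\<exists>e>1. (1 - e) *\<^sub>R char_vec B + e *\<^sub>R z \<in> ?Q" if "B \<in> bases M" for B
      using iff z vQ[OF that] by blast
    have "0 < z $ i" if i: "i \<in> \<Union>(bases M)" for i
    proof -
      obtain B where B: "B \<in> bases M" "i \<in> B" using i by blast
      obtain e where e: "1 < e" "(1 - e) *\<^sub>R char_vec B + e *\<^sub>R z \<in> ?Q" using step[OF B(1)] by blast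
      have "0 \<le> ((1 - e) *\<^sub>R char_vec B + e *\<^sub>R z) $ i" by (rule unit_cube_bounds(1)[OF IntD2[OF e(2)]])
      then have "0 \<le> (1 - e) + e * z $ i" using B(2) by simp
      then have "0 < e * z $ i" using e(1) by linarith
      then show ?thesis using e(1) by (simp add: zero_less_mult_iff)
    qed
    moreover have "z $ i < 1" if i: "i \<notin> \<Inter>(bases M)" for i
    proof -
      obtain B where B: "B \<in> bases M" "i \<notin> B" using i by blast
      obtain e where e: "1 < e" "(1 - e) *\<^sub>R char_vec B + e *\<^sub>R z \<in> ?Q" using step[OF B(1)] by blast
      have "((1 - e) *\<^sub>R char_vec B + e *\<^sub>R z) $ i \<le> 1" by (rule unit_cube_bounds(2)[OF IntD2[OF e(2)]])
      then have le: "e * z $ i \<le> 1" using B(2) by simp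
      show ?thesis
      proof (rule ccontr)
        assume "\<not> z $ i < 1"
        then have "e * 1 \<le> e * z $ i" using e(1) by (intro mult_left_mono) auto
        then show False using le e(1) by linarith
      qed
    qed
    ultimately show "z \<in> affine hull P \<and> spread z" using zQ unfolding spread_def by blast
  next
    assume z: "z \<in> affine hull P \<and> spread z"
    \<comment> \<open>The entry 1 keeps the minimum defined; the others are the positive distances
      of coordinates to 0 and to 1.\<close>
    define S where "S = insert 1 ((\<lambda>i. z $ i) ` {i. 0 < z $ i} \<union> (\<lambda>i. 1 - z $ i) ` {i. z $ i < 1})"
    define t where "t = Min S"
    have "finite S" "S \<noteq> {}" "\<And>s. s \<in> S \<Longrightarrow> 0 < s" unfolding S_def by auto
    then have t: "0 < t" "\<And>s. s \<in> S \<Longrightarrow> t \<le> s" unfolding t_def by auto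
    show "z \<in> rel_interior ?Q"
      unfolding iff
    proof (intro ballI exI conjI)
      show "1 < 1 + t" using t(1) by simp
      fix x assume x: "x \<in> ?Q"
      let ?y = "(1 - (1 + t)) *\<^sub>R x + (1 + t) *\<^sub>R z"
      have yA: "?y \<in> affine hull P"
        using mem_affine[OF affine_affine_hull[of P], of x z "1 - (1 + t)" "1 + t"] x z by auto
      have y: "?y $ i = z $ i + t * (z $ i - x $ i)" for i by (simp add: algebra_simps)
      have "spread ?y"
        unfolding spread_def
      proof (intro conjI ballI allI impI)
        have xb: "0 \<le> x $ i" "x $ i \<le> 1" for i
          using unit_cube_bounds[OF IntD2[OF x], of i] by auto
        note zb = unit_cube_bounds[OF spread_unit_cube, of z]
        show "0 < ?y $ i" if "i \<in> \<Union>(bases M)" for i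
        proof (cases "z $ i < 1")
          case True
          have z0: "0 < z $ i" using z that unfolding spread_def by blast
          then have "t \<le> z $ i" by (intro t(2)) (auto simp: S_def)
          moreover have "t * (x $ i - z $ i) < t * 1" using xb[of i] z0 t(1) by (intro mult_strict_left_mono) auto
          ultimately show ?thesis unfolding y by (simp add: algebra_simps)
        next
          case False
          then have "z $ i = 1" using zb(2)[of i] z by force
          moreover have "0 \<le> t * (1 - x $ i)" using xb[of i] t(1) by simp
          ultimately show ?thesis unfolding y by simp
        qed
        show "?y $ i < 1" if "i \<notin> \<Inter>(bases M)" for i
        proof -
          have z1: "z $ i < 1" using z that unfolding spread_def by blast
          then have "t \<le> 1 - z $ i" by (intro t(2)) (auto simp: S_def)
          moreover have "t * (z $ i - x $ i) < t * 1" using xb[of i] z1 t(1) by (intro mult_strict_left_mono) auto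
          ultimately show ?thesis unfolding y by (simp add: algebra_simps)
        qed
      qed
      then show "?y \<in> ?Q" using yA spread_unit_cube[OF yA] by simp
    qed
  qed
qed

section \<open>Facets of the matroid polytope come from rank inequalities\<close>

lemma inner_swap:
  assumes "b \<in> B" "e \<notin> B"
  shows "w \<bullet> char_vec (insert e (B - {b})) = w \<bullet> char_vec B - w $ b + w $ e"
proof -
  have "(\<Sum>i\<in>insert e (B - {b}). w $ i) = w $ e + (\<Sum>i\<in>B - {b}. w $ i)" using assms by simp
  also have "(\<Sum>i\<in>B - {b}. w $ i) = (\<Sum>i\<in>B. w $ i) - w $ b" using assms by (simp add: sum_diff1)
  finally show ?thesis by (simp add: inner_commute[of w] inner_char_vec)
qed

text \<open>The greedy principle: if a base of maximal weight were not tight on an upper level set,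
  a crossing swap would bring in a heavier element.\<close>

lemma level_set_tight:
  assumes B: "B \<in> bases M" and max: "\<And>B'. B' \<in> bases M \<Longrightarrow> w \<bullet> char_vec B' \<le> w \<bullet> char_vec B"
  shows "tight M {i \<in> E. t \<le> w $ i} B"
proof (rule ccontr)
  let ?L = "{i \<in> E. t \<le> w $ i}"
  assume "\<not> tight M ?L B"
  then have less: "card (B \<inter> ?L) < r ?L" using base_card_Int_le[OF B, of ?L] unfolding tight_def by simp
  obtain B3 where B3: "B3 \<in> bases M" "card (B3 \<inter> ?L) = r ?L" by (rule base_card_Int_eq)
  have split: "card A = card (A \<inter> ?L) + card (A \<inter> - ?L)" for A :: "'a set"
    using card_Int_Diff[of A ?L] by (simp add: Diff_eq)
  have "card (B3 \<inter> - ?L) < card (B \<inter> - ?L)"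
    using split[of B3] split[of B] less B3 base_card[OF B] base_card[OF B3(1)] by linarith
  from crossing_swap[OF symmetric_exchange_bases subset_refl B B3(1) this]
  obtain b e where be: "b \<in> B" "b \<in> - ?L" "e \<in> E" "e \<notin> B" "e \<notin> - ?L" "insert e (B - {b}) \<in> bases M" by blast
  have "b \<in> E" using be(1) base_subset_ground[OF B] by blast
  then have "w $ b < w $ e" using be by auto
  then show False using max[OF be(6)] inner_swap[OF be(1,4), of w] by simp
qed

text \<open>Exchange an optimal base towards \<open>B\<close>. Equal weights give an optimal base
  closer to \<open>B\<close>; otherwise the other half of the exchange adds to \<open>B\<close> an
  element of the level set of \<open>w $ v\<close> and removes one below it, so \<open>B\<close> was
  not tight there.\<close>

lemma level_set_not_tight:
  assumes B: "B \<in> bases M" and max: "\<And>B'. B' \<in> bases M \<Longrightarrow> w \<bullet> char_vec B' \<le> c"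
    and less: "w \<bullet> char_vec B < c" and B1: "B1 \<in> bases M" "w \<bullet> char_vec B1 = c"
  shows "\<exists>t. \<not> tight M {i \<in> E. t \<le> w $ i} B"
  using B1
proof (induction "card (B1 - B)" arbitrary: B1 rule: less_induct)
  case (less B1)
  have "B1 \<noteq> B" using less.prems assms(3) by auto
  moreover have "card B1 = card B" using base_card[OF B] base_card[OF less.prems(1)] by simp
  ultimately have "\<not> B1 \<subseteq> B" using card_subset_eq[of B B1] by auto
  then obtain v where v: "v \<in> B1" "v \<notin> B" by blast
  obtain e where e: "e \<in> B" "e \<notin> B1" "insert e (B1 - {v}) \<in> bases M" "insert v (B - {e}) \<in> bases M"
    by (rule symmetric_exchangeE[OF symmetric_exchange_bases less.prems(1) B v])
  have w1: "w \<bullet> char_vec (insert e (B1 - {v})) = c - w $ v + w $ e"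
    using inner_swap[OF v(1) e(2), of w] less.prems(2) by simp
  then have "w $ e \<le> w $ v" using max[OF e(3)] by simp
  show ?case
  proof (cases "w $ e = w $ v")
    case True
    have "insert e (B1 - {v}) - B = B1 - B - {v}" using e by blast
    then have "card (insert e (B1 - {v}) - B) < card (B1 - B)"
      using card_Diff1_less[of "B1 - B" v] v by simp
    from less.hyps[OF this e(3)] show ?thesis using w1 True by simp
  next
    case False
    define L where "L = {i \<in> E. w $ v \<le> w $ i}"
    have "v \<in> L" unfolding L_def using v base_subset_ground[OF less.prems(1)] by blast
    moreover have "e \<notin> L" unfolding L_def using False \<open>w $ e \<le> w $ v\<close> by simp
    ultimately have "card (insert v (B - {e}) \<inter> L) = card (B \<inter> L) + 1"
      using card_swap_Int[OF finite_base[OF B] e(1) v(2), of L] by simp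
    then have "\<not> tight M L B" using base_card_Int_le[OF e(4), of L] unfolding tight_def by simp
    then show ?thesis unfolding L_def by blast
  qed
qed

lemma facet_maximal:
  assumes K: "K facet_of P" and T: "T face_of P" "K \<subseteq> T" "T \<noteq> P"
  shows "K = T"
proof (rule ccontr)
  assume ne: "K \<noteq> T"
  have "K face_of T" using face_of_subset[OF facet_of_imp_face_of[OF K] T(2)] face_of_imp_subset[OF T(1)] .
  from face_of_aff_dim_lt[OF face_of_imp_convex[OF T(1)] this ne]
  have "aff_dim K < aff_dim T" .
  moreover have "aff_dim T < aff_dim P" by (rule face_of_aff_dim_lt[OF convex_P T(1,3)])
  ultimately show False using K unfolding facet_of_def by simp
qed

text \<open>The normal vector \<open>w\<close> is replaced by its upper level sets. A base is
  optimal for \<open>w\<close> exactly when it is tight on all of them, so some level set cuts out a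
  proper face containing the facet, which then equals it.\<close>

lemma facet_cut:
  assumes K: "K facet_of P"
  shows "\<exists>X\<subseteq>E. K = cut X"
proof -
  obtain w c where w: "P \<subseteq> {x. w \<bullet> x \<le> c}" "K = P \<inter> {x. w \<bullet> x = c}"
    by (rule facet_of_polyhedron[OF polyhedron_P K])
  have Kf: "K face_of P" and "K \<noteq> P" "K \<noteq> {}" using K unfolding facet_of_def by auto
  have max: "w \<bullet> char_vec B \<le> c" if "B \<in> bases M" for B using w(1) vertex_in_P[OF that] by blast
  have KB: "char_vec B \<in> K \<longleftrightarrow> w \<bullet> char_vec B = c" if "B \<in> bases M" for B
    using w(2) vertex_in_P[OF that] by blast
  let ?L = "\<lambda>t. {i \<in> E. t \<le> w $ i}"
  have sub: "K \<subseteq> cut (?L t)" for t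
  proof (rule face_subset[OF Kf cut_face])
    fix B assume B: "B \<in> bases M" "char_vec B \<in> K"
    have "tight M (?L t) B" by (rule level_set_tight[OF B(1)]) (use max KB[OF B(1)] B(2) in simp)
    then show "char_vec B \<in> cut (?L t)" using vertex_in_cut[OF B(1)] by simp
  qed
  obtain B1 where B1: "B1 \<in> bases M" "w \<bullet> char_vec B1 = c"
    using face_vertex[OF Kf \<open>K \<noteq> {}\<close>] KB by auto
  have "\<not> P \<subseteq> K" using \<open>K \<noteq> P\<close> face_of_imp_subset[OF Kf] by blast
  then obtain B where B: "B \<in> bases M" "char_vec B \<notin> K"
    using face_subset[OF face_of_refl[OF convex_P] Kf] by blast
  then have "w \<bullet> char_vec B < c" using max[OF B(1)] KB[OF B(1)] by simp
  from level_set_not_tight[OF B(1) max this B1] obtain t where "\<not> tight M (?L t) B" by blast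
  then have "cut (?L t) \<noteq> P" using cut_eq_P_iff B(1) by blast
  then have "K = cut (?L t)" by (rule facet_maximal[OF K cut_face sub])
  then show ?thesis by (intro exI[of _ "?L t"]) auto
qed

lemma flat_hyperplane_Int_P: "X \<subseteq> E \<Longrightarrow> flat_hyperplane M X \<inter> P = cut X"
  using P_unit_cube unfolding flat_hyperplane_def cut_def inner_char_vec unit_cube_def by auto

lemma flat_hyperplane_eq: "flat_hyperplane M X = coord_space E \<inter> {x. char_vec X \<bullet> x = real (r X)}"
  unfolding flat_hyperplane_def inner_char_vec by auto

lemma flacet_iff:
  "flacet M F \<longleftrightarrow> flat M F \<and> cut F facet_of P \<and> (\<forall>G. flat M G \<and> G \<subset> F \<longrightarrow> cut G \<noteq> cut F)"
proof -
  have "flat M F \<Longrightarrow> flat_hyperplane M F \<inter> P = cut F" for F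
    by (rule flat_hyperplane_Int_P) (simp add: flat_def)
  then show ?thesis unfolding flacet_def by metis
qed

lemma not_tight_exists: "cut F facet_of P \<Longrightarrow> \<exists>B\<in>bases M. \<not> tight M F B"
proof -
  assume "cut F facet_of P"
  then have "cut F \<noteq> P" by auto
  then show ?thesis using cut_eq_P_iff by blast
qed

text \<open>The spread point \<open>z\<close> shows that passing to the closure does not turn the
  facet into all of \<open>P\<close>, and that the rank of the chosen flat is strictly below both
  its size and the full rank. The last two facts provide a vertex of the hypersimplex beyond the
  hyperplane.\<close>

lemma split_flacet_of_facet:
  assumes K: "K facet_of P" and z: "z \<in> K" "spread z"
  shows "\<exists>F. split_flacet M F \<and> cut F = K"
proof -
  obtain X where X: "X \<subseteq> E" "K = cut X" using facet_cut[OF K] by blast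
  have zP: "z \<in> P" "char_vec X \<bullet> z = real (r X)" using z(1) unfolding X(2) cut_def by auto
  have zaff: "z \<in> affine hull P" using zP(1) by (rule hull_inc)
  have zb: "0 \<le> z $ i" "z $ i \<le> 1" for i using unit_cube_bounds[OF P_unit_cube[OF zP(1)]] by auto
  have XF: "X \<subseteq> cl X" by (rule subset_cl[OF X(1)])
  have rX: "r (cl X) = r X" using rank_Un_cl[of "cl X" X] XF by (simp add: sup.absorb2)
  have Bcl: "tight M (cl X) B" if "B \<in> bases M" "tight M X B" for B
  proof -
    have "card (B \<inter> X) \<le> card (B \<inter> cl X)" using XF by (intro card_mono) auto
    then show ?thesis using that(2) base_card_Int_le[OF that(1), of "cl X"] rX unfolding tight_def by simp
  qed
  have sub: "K \<subseteq> cut (cl X)"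
    unfolding X(2) using Bcl by (intro face_subset[OF cut_face cut_face]) (simp add: vertex_in_cut)
  \<comment> \<open>If the closure cut out all of \<open>P\<close>, then \<open>z\<close> would
    vanish on \<open>cl X - X\<close>; as \<open>z\<close> is spread, these elements are loops, and
    \<open>X\<close> would cut out \<open>P\<close> too.\<close>
  have "cut (cl X) \<noteq> P"
  proof
    assume cP: "cut (cl X) = P"
    have "z \<in> cut (cl X)" using zP(1) cP by simp
    then have "char_vec (cl X) \<bullet> z = real (r X)" using rX unfolding cut_def by simp
    then have "(\<Sum>i\<in>cl X - X. z $ i) = 0"
      using zP(2) XF unfolding inner_char_vec by (simp add: sum_diff)
    then have z0: "z $ i = 0" if "i \<in> cl X - X" for i using sum_nonneg_eq_0_iff[of "cl X - X"] zb that by auto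
    have "tight M X B" if B: "B \<in> bases M" for B
    proof -
      have "i \<notin> B" if "i \<in> cl X - X" for i
        using z0[OF that] z(2) B unfolding spread_def by force
      then have "B \<inter> cl X = B \<inter> X" using XF by blast
      moreover have "tight M (cl X) B" using cP cut_eq_P_iff B by blast
      ultimately show ?thesis using rX unfolding tight_def by simp
    qed
    then have "cut X = P" using cut_eq_P_iff by blast
    then show False using K unfolding X(2) by simp
  qed
  then have "K = cut (cl X)" by (rule facet_maximal[OF K cut_face sub])
  moreover have "flat M (cl X)"
    unfolding flat_def
  proof (intro conjI ballI)
    show "cl X \<subseteq> E" unfolding cl_def by blast
    fix e assume e: "e \<in> E - cl X"
    then have "r (insert e X) \<noteq> r X" unfolding cl_def by blast
    moreover have "r X \<le> r (insert e X)" "r (insert e X) \<le> r (insert e (cl X))"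
      using XF by (auto intro!: rank_mono)
    ultimately show "r (cl X) < r (insert e (cl X))" using rX by simp
  qed
  ultimately have "\<exists>F. flat M F \<and> cut F = K" by blast
  then obtain F where F: "flat M F" "cut F = K" and minimal: "\<And>G. flat M G \<Longrightarrow> cut G = K \<Longrightarrow> card F \<le> card G"
    using ex_has_least_nat[of "\<lambda>F. flat M F \<and> cut F = K" _ card] by metis
  have FE: "F \<subseteq> E" using F(1) unfolding flat_def by simp
  have "flacet M F"
    unfolding flacet_iff
  proof (intro conjI allI impI)
    show "cut F facet_of P" using F(2) K by simp
    fix G assume G: "flat M G \<and> G \<subset> F"
    then have "card G < card F" by (intro psubset_card_mono) auto
    then show "cut G \<noteq> cut F" using minimal[of G] G F(2) by fastforce
  qed (rule F(1))
  have "z \<in> cut F" using z(1) F(2) by simp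
  then have zF: "(\<Sum>i\<in>F. z $ i) = real (r F)" unfolding cut_def inner_char_vec by simp
  obtain A where A: "A \<in> bases M" "\<not> tight M F A" using not_tight_exists[of F] F(2) K by blast
  have A': "card (A \<inter> F) < r F" using A base_card_Int_le[OF A(1), of F] unfolding tight_def by simp
  have "r F < card F"
  proof (rule ccontr)
    assume "\<not> r F < card F"
    then have "r F = card F" using rank_le_card[of F] by simp
    then have "(\<Sum>i\<in>F. 1 - z $ i) = 0" using zF by (simp add: sum_subtractf)
    then have "1 - z $ i = 0" if "i \<in> F" for i using sum_nonneg_eq_0_iff[of F "\<lambda>i. 1 - z $ i"] zb that by simp
    then have "i \<in> A" if "i \<in> F" for i using z(2) that A(1) unfolding spread_def by force
    then have "A \<inter> F = F" by blast
    then show False using A' \<open>r F = card F\<close> by simp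
  qed
  have "r F < r E"
  proof (rule ccontr)
    assume "\<not> r F < r E"
    then have "r F = r E" using rank_mono[OF FE] by simp
    then have "(\<Sum>i\<in>E - F. z $ i) = 0"
      using zF P_total[OF zP(1)] FE unfolding inner_char_vec by (simp add: sum_diff)
    then have z0: "z $ i = 0" if "i \<in> E - F" for i using sum_nonneg_eq_0_iff[of "E - F"] zb that by auto
    have "i \<notin> A" if "i \<in> E - F" for i using z0[OF that] z(2) A(1) unfolding spread_def by force
    then have "A \<inter> F = A" using base_subset_ground[OF A(1)] by blast
    then show False using A' base_card[OF A(1)] \<open>r F = r E\<close> by simp
  qed
  obtain B where B: "B \<in> bases M" "card (B \<inter> F) = r F" by (rule base_card_Int_eq)
  have "\<not> B \<subseteq> F"
  proof
    assume "B \<subseteq> F"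
    then have "B \<inter> F = B" by blast
    then show False using B base_card[OF B(1)] \<open>r F < r E\<close> by simp
  qed
  then obtain b where b: "b \<in> B" "b \<notin> F" by blast
  have "\<not> F \<subseteq> B"
  proof
    assume "F \<subseteq> B"
    then have "B \<inter> F = F" by blast
    then show False using B \<open>r F < card F\<close> by simp
  qed
  then obtain e where e: "e \<in> F" "e \<notin> B" by blast
  \<comment> \<open>Any 0/1 vector with the right sum serves on the far side; \<open>?C\<close>
    exceeds the rank of \<open>F\<close> and thus is not a base.\<close>
  let ?C = "insert e (B - {b})"
  have "card (?C \<inter> F) = Suc (r F)" using card_swap_Int[OF finite_base[OF B(1)] b(1) e(2), of F] b e B(2) by simp
  moreover have "card ?C = r E"
    using card_swap_Int[OF finite_base[OF B(1)] b(1) e(2), of UNIV] base_card[OF B(1)] by simp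
  moreover have "?C \<subseteq> E" using base_subset_ground[OF B(1)] e FE by blast
  ultimately have "split_hyperplane (hypersimplex (r E) E)
      (affine hull (hypersimplex (r E) E \<inter> {x. char_vec F \<bullet> x = real (r F)}))"
    using FE base_subset_ground[OF A(1)] base_card[OF A(1)] A' by (intro hypersimplex_split[of F E A "r E" "r F" ?C]) auto
  moreover have "flat_hyperplane M F \<inter> hypersimplex (r E) E = hypersimplex (r E) E \<inter> {x. char_vec F \<bullet> x = real (r F)}"
    unfolding flat_hyperplane_eq hypersimplex_eq unit_cube_def by auto
  ultimately have "split_flacet M F" using \<open>flacet M F\<close> unfolding split_flacet_def Let_def by simp
  then show ?thesis using F(2) by blast
qed

text \<open>A swap leaving the common facet must leave both sets at once, so the element it removes lies in
  their intersection; hence the intersection defines the same facet.\<close>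

lemma flacet_unique:
  assumes F: "flacet M F" and G: "flacet M G" and eq: "cut F = cut G"
  shows "F = G"
proof -
  have fF: "flat M F" and K: "cut F facet_of P" and minF: "\<And>H. flat M H \<Longrightarrow> H \<subset> F \<Longrightarrow> cut H \<noteq> cut F"
    using F unfolding flacet_iff by auto
  have fG: "flat M G" and minG: "\<And>H. flat M H \<Longrightarrow> H \<subset> G \<Longrightarrow> cut H \<noteq> cut G"
    using G unfolding flacet_iff by auto
  have tFG: "tight M F B \<longleftrightarrow> tight M G B" if "B \<in> bases M" for B
    using vertex_in_cut[OF that] eq by metis
  have "cut F \<noteq> {}" using K unfolding facet_of_def by simp
  then obtain B0 where B0: "B0 \<in> bases M" "tight M F B0"
    using face_vertex[OF cut_face] vertex_in_cut by blast
  have flatI: "flat M (F \<inter> G)"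
    unfolding flat_def
  proof (intro conjI ballI)
    show "F \<inter> G \<subseteq> E" using fF unfolding flat_def by blast
    have grow: "r (F \<inter> G) < r (insert e (F \<inter> G))"
      if H: "flat M H" "F \<inter> G \<subseteq> H" "e \<in> E - H" for e H
    proof -
      have "r H < r (insert e H)" using H unfolding flat_def by blast
      then have "e \<notin> cl H" unfolding cl_def by simp
      then have "e \<notin> cl (F \<inter> G)" using cl_mono[OF H(2)] by blast
      then show ?thesis using H(3) rank_mono[OF subset_insertI, of "F \<inter> G" e] unfolding cl_def by simp
    qed
    fix e assume "e \<in> E - (F \<inter> G)"
    then consider "e \<in> E - F" | "e \<in> E - G" by blast
    then show "r (F \<inter> G) < r (insert e (F \<inter> G))"
      by cases (use grow[OF fF] grow[OF fG] in auto)
  qed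
  have inter: "tight M (F \<inter> G) B" if B: "B \<in> bases M" "tight M F B" for B
  proof -
    have "card (B \<inter> F) + card (B \<inter> G) = card (B \<inter> (F \<union> G)) + card (B \<inter> (F \<inter> G))"
      using card_Un_Int[of "B \<inter> F" "B \<inter> G"] by (simp add: Int_Un_distrib Int_ac)
    then have "r F + r G = card (B \<inter> (F \<union> G)) + card (B \<inter> (F \<inter> G))"
      using B tFG[OF B(1)] unfolding tight_def by simp
    then show ?thesis
      using base_card_Int_le[OF B(1), of "F \<union> G"] base_card_Int_le[OF B(1), of "F \<inter> G"] rank_submodular[of F G]
      unfolding tight_def by linarith
  qed
  have sub: "cut F \<subseteq> cut (F \<inter> G)"
    using inter by (intro face_subset[OF cut_face cut_face]) (simp add: vertex_in_cut)
  obtain B3 where B3: "B3 \<in> bases M" "\<not> tight M F B3" using not_tight_exists[OF K] by blast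
  have "card (B3 \<inter> F) < card (B0 \<inter> F)"
    using base_card_Int_le[OF B3(1), of F] B3(2) B0(2) unfolding tight_def by simp
  from crossing_swap[OF symmetric_exchange_bases subset_refl B0(1) B3(1) this]
  obtain b e where be: "b \<in> B0" "b \<in> F" "e \<in> E" "e \<notin> B0" "e \<notin> F" "insert e (B0 - {b}) \<in> bases M" by blast
  let ?B = "insert e (B0 - {b})"
  note sw = card_swap_Int[OF finite_base[OF B0(1)] be(1,4)]
  have "\<not> tight M F ?B" using sw[of F] be B0(2) unfolding tight_def by simp
  then have "\<not> tight M G ?B" using tFG[OF be(6)] by simp
  then have "b \<in> G"
    using sw[of G] tFG[OF B0(1)] B0(2) base_card_Int_le[OF be(6), of G]
    unfolding tight_def by (auto simp: of_bool_def split: if_splits)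
  then have "\<not> tight M (F \<inter> G) ?B" using sw[of "F \<inter> G"] be inter[OF B0] unfolding tight_def by simp
  then have "cut (F \<inter> G) \<noteq> P" using cut_eq_P_iff be(6) by blast
  then have "cut F = cut (F \<inter> G)" by (rule facet_maximal[OF K cut_face sub])
  then have "\<not> F \<inter> G \<subset> F" "\<not> F \<inter> G \<subset> G" using minF[OF flatI] minG[OF flatI] eq by auto
  then show ?thesis by blast
qed

section \<open>Certificates and split flacets\<close>

lemma covered_of_point:
  assumes z: "z \<in> cut X" "z \<in> cut Y" and s: "spread z"
  shows "covered M X Y"
proof -
  let ?T = "cut X \<inter> cut Y"
  have T: "?T face_of P" by (intro face_of_Int cut_face)
  have eq: "{B \<in> bases M. char_vec B \<in> ?T} = face M X Y" unfolding face_def using vertex_in_cut by blast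
  have hull: "z \<in> convex hull (char_vec ` face M X Y)"
    using z unfolding face_hull[OF T, unfolded eq, symmetric] by blast
  then have "face M X Y \<noteq> {}" by auto
  moreover have ax: "axis i 1 \<bullet> x = x $ i" for x :: "real ^ 'a" and i by (simp add: inner_axis')
  have const: "z $ i = c" if "\<And>B. B \<in> face M X Y \<Longrightarrow> of_bool (i \<in> B) = c" for i c
  proof -
    have "convex hull (char_vec ` face M X Y) \<subseteq> {x. axis i 1 \<bullet> x = c}"
      by (intro hull_minimal convex_hyperplane) (auto simp: ax that)
    then show ?thesis using hull ax by auto
  qed
  have "i \<in> \<Union>(face M X Y)" if "i \<in> \<Union>(bases M)" for i
  proof (rule ccontr)
    assume "i \<notin> \<Union>(face M X Y)"
    then have "z $ i = 0" by (intro const) auto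
    then show False using s that unfolding spread_def by force
  qed
  moreover have "i \<in> \<Inter>(bases M)" if "i \<in> \<Inter>(face M X Y)" for i
  proof (rule ccontr)
    assume "i \<notin> \<Inter>(bases M)"
    moreover have "z $ i = 1" using that by (intro const) auto
    ultimately show False using s unfolding spread_def by force
  qed
  ultimately show ?thesis unfolding covered_def by blast
qed

text \<open>The barycentre of the base vectors in the face works: a coordinate is positive as soon
  as one base of the face contains the element, and below 1 as soon as one avoids it.\<close>

lemma point_of_covered:
  assumes cov: "covered M X Y"
  obtains z where "z \<in> cut X" "z \<in> cut Y" "spread z"
proof -
  let ?G = "face M X Y"
  have ne: "?G \<noteq> {}" and meet: "\<Union>(bases M) \<subseteq> \<Union>?G" and avoid: "\<Inter>?G \<subseteq> \<Inter>(bases M)"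
    using cov unfolding covered_def by auto
  define n where "n = real (card ?G)"
  have n: "0 < n" using ne unfolding n_def by (simp add: card_gt_0_iff)
  define z where "z = (\<Sum>B\<in>?G. (1 / n) *\<^sub>R char_vec B)"
  have GB: "B \<in> bases M" "char_vec B \<in> cut X" "char_vec B \<in> cut Y" if "B \<in> ?G" for B
    using that vertex_in_cut unfolding face_def by auto
  have in_conv: "z \<in> C" if "convex C" "\<And>B. B \<in> ?G \<Longrightarrow> char_vec B \<in> C" for C
    unfolding z_def using that n by (intro convex_sum) (auto simp: n_def)
  have "z \<in> cut X" "z \<in> cut Y" using in_conv GB face_of_imp_convex[OF cut_face] by auto
  moreover have zi: "z $ i = (\<Sum>B\<in>?G. of_bool (i \<in> B) / n)" for i unfolding z_def by simp
  have "spread z"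
    unfolding spread_def
  proof (intro conjI ballI allI impI)
    fix i assume "i \<in> \<Union>(bases M)"
    then obtain B where B: "B \<in> ?G" "i \<in> B" using meet by blast
    show "0 < z $ i" unfolding zi using B n by (intro sum_pos2[of _ B]) auto
  next
    fix i assume "i \<notin> \<Inter>(bases M)"
    then obtain B where B: "B \<in> ?G" "i \<notin> B" using avoid by blast
    have "(\<Sum>B\<in>?G. of_bool (i \<in> B) / n) < (\<Sum>B\<in>?G. 1 / n)"
      using B n by (intro sum_strict_mono_ex1) (auto simp: divide_right_mono intro!: bexI[of _ B])
    also have "\<dots> = n * (1 / n)" by (simp add: n_def)
    also have "\<dots> = 1" using n by simp
    finally show "z $ i < 1" unfolding zi .
  qed
  ultimately show thesis using that by blast
qed

lemma not_split_of_certificate: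
  assumes cov: "covered M X Y" and deg: "degenerate M X Y"
  shows "\<not> split_matroid M"
proof -
  obtain z where z: "z \<in> cut X" "z \<in> cut Y" "spread z" by (rule point_of_covered[OF cov])
  let ?T = "cut X \<inter> cut Y"
  have T: "?T face_of P" "?T face_of cut X"
    using face_of_Int[OF cut_face cut_face] face_of_subset[OF _ _ cut_subset_P] by blast+
  obtain B1 where B1: "B1 \<in> bases M" "\<not> tight M X B1" using deg unfolding degenerate_def by blast
  obtain B2 where B2: "B2 \<in> bases M" "tight M X B2" "\<not> tight M Y B2" using deg unfolding degenerate_def by blast
  have "cut X \<noteq> P" using cut_eq_P_iff B1 by blast
  then have d1: "aff_dim (cut X) < aff_dim P" by (rule face_of_aff_dim_lt[OF convex_P cut_face])
  have "?T \<noteq> cut X" using vertex_in_cut[OF B2(1)] B2 by blast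
  then have d2: "aff_dim ?T < aff_dim (cut X)" by (rule face_of_aff_dim_lt[OF face_of_imp_convex[OF cut_face] T(2)])
  have "?T \<noteq> P" using d1 d2 by auto
  moreover have "?T \<noteq> {}" using z by blast
  \<comment> \<open>A proper face is the intersection of the facets containing it; with a single
    such facet the dimension would have dropped by one only.\<close>
  ultimately have Tint: "?T = \<Inter>{K. K facet_of P \<and> ?T \<subseteq> K}" using face_of_polyhedron[OF polyhedron_P T(1)] by blast
  have "\<exists>K1 K2. K1 facet_of P \<and> K2 facet_of P \<and> ?T \<subseteq> K1 \<and> ?T \<subseteq> K2 \<and> K1 \<noteq> K2"
  proof (rule ccontr)
    assume no: "\<not> ?thesis"
    obtain K1 where K1: "K1 facet_of P" "?T \<subseteq> K1"
      using face_of_polyhedron_subset_facet[OF polyhedron_P T(1) \<open>?T \<noteq> {}\<close> \<open>?T \<noteq> P\<close>] by blast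
    then have "{K. K facet_of P \<and> ?T \<subseteq> K} = {K1}" using no by blast
    then have "?T = K1" using Tint by simp
    then have "aff_dim ?T = aff_dim P - 1" using K1(1) unfolding facet_of_def by simp
    then show False using d1 d2 by simp
  qed
  then obtain K1 K2 where K: "K1 facet_of P" "K2 facet_of P" "?T \<subseteq> K1" "?T \<subseteq> K2" "K1 \<noteq> K2" by blast
  have zK: "z \<in> K1" "z \<in> K2" using z K by auto
  obtain F1 where F1: "split_flacet M F1" "cut F1 = K1" using split_flacet_of_facet[OF K(1) zK(1) z(3)] by blast
  obtain F2 where F2: "split_flacet M F2" "cut F2 = K2" using split_flacet_of_facet[OF K(2) zK(2) z(3)] by blast
  have zP: "z \<in> P" using z(1) cut_subset_P by blast
  then have "z \<in> coord_space E" using P_unit_cube unfolding unit_cube_def by blast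
  then have "z \<in> flat_hyperplane M F1" "z \<in> flat_hyperplane M F2"
    using zK F1(2) F2(2) unfolding flat_hyperplane_eq cut_def by auto
  moreover have "z \<in> rel_interior (affine hull P \<inter> unit_cube E)"
    unfolding rel_interior_cube_iff using hull_inc[OF zP] z(3) by simp
  ultimately have "z \<in> flat_hyperplane M F1 \<inter> flat_hyperplane M F2 \<inter> rel_interior (affine hull P \<inter> unit_cube E)"
    by simp
  moreover have "F1 \<noteq> F2" using F1 F2 K(5) by auto
  ultimately show ?thesis using F1(1) F2(1) unfolding split_matroid_def by blast
qed

lemma certificate_of_point:
  assumes F: "cut F facet_of P" and K: "cut X facet_of P" "cut X \<noteq> cut F" and q: "q \<in> cut F" "q \<in> cut X" "spread q"
  shows "covered M F X \<and> degenerate M F X"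
proof
  show "covered M F X" by (rule covered_of_point[OF q])
  have "cut X \<noteq> P" using K(1) by auto
  have "\<not> cut F \<subseteq> cut X"
  proof
    assume "cut F \<subseteq> cut X"
    from facet_maximal[OF F cut_face this \<open>cut X \<noteq> P\<close>] show False using K(2) by simp
  qed
  then obtain B where "B \<in> bases M" "char_vec B \<in> cut F" "char_vec B \<notin> cut X"
    using face_subset[OF cut_face cut_face] by blast
  then show "degenerate M F X"
    using not_tight_exists[OF F] vertex_in_cut unfolding degenerate_def by blast
qed

lemma certificate_of_not_split:
  assumes "\<not> split_matroid M"
  shows "\<exists>X Y. covered M X Y \<and> degenerate M X Y"
proof -
  obtain F G z where FG: "split_flacet M F" "split_flacet M G" "F \<noteq> G"
      and z: "z \<in> flat_hyperplane M F" "z \<in> flat_hyperplane M G" "z \<in> rel_interior (affine hull P \<inter> unit_cube E)"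
    using assms is_matroid unfolding split_matroid_def by blast
  have fF: "flacet M F" and fG: "flacet M G" using FG unfolding split_flacet_def by auto
  have K: "cut F facet_of P" "cut G facet_of P" using fF fG unfolding flacet_iff by auto
  have neq: "cut G \<noteq> cut F" using flacet_unique[OF fF fG] FG(3) by metis
  have zA: "z \<in> affine hull P" and zs: "spread z" using z(3) rel_interior_cube_iff by blast+
  have zF: "char_vec F \<bullet> z = real (r F)" and zG: "char_vec G \<bullet> z = real (r G)"
    using z unfolding flat_hyperplane_eq by auto
  show ?thesis
  proof (cases "z \<in> P")
    case True
    then have "z \<in> cut F" "z \<in> cut G" using zF zG unfolding cut_def by auto
    from certificate_of_point[OF K neq this zs] show ?thesis by blast
  next
    case False
    \<comment> \<open>\<open>affine hull (cut F)\<close> lies in \<open>?A\<close> and has the same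
      dimension, so \<open>z\<close> is in the affine hull of the facet even though it is outside
      \<open>P\<close>.\<close>
    let ?A = "affine hull P \<inter> {x. char_vec F \<bullet> x = real (r F)}"
    have affA: "affine ?A" by (intro affine_Int affine_affine_hull affine_hyperplane)
    have ne: "cut F \<noteq> {}" and dimF: "aff_dim (cut F) = aff_dim P - 1" using K(1) unfolding facet_of_def by auto
    have "cut F \<subseteq> ?A" unfolding cut_def using hull_subset[of P affine] by blast
    then have sub: "affine hull (cut F) \<subseteq> ?A" using affA by (rule hull_minimal)
    have neA: "affine hull (cut F) \<noteq> {}" using ne by simp
    obtain B3 where B3: "B3 \<in> bases M" "\<not> tight M F B3" using not_tight_exists[OF K(1)] by blast
    have "char_vec B3 \<in> affine hull P" using vertex_in_P[OF B3(1)] by (rule hull_inc)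
    moreover have "char_vec B3 \<notin> ?A" using B3(2) unfolding tight_def by (simp add: inner_char_vec_char_vec)
    ultimately have "?A \<noteq> affine hull P" by blast
    moreover have "?A \<noteq> {}" using sub neA by blast
    ultimately have "aff_dim ?A \<noteq> aff_dim (affine hull P)"
      using affine_dim_equal[OF affA affine_affine_hull[of P]] by blast
    moreover have "aff_dim ?A \<le> aff_dim (affine hull P)" by (intro aff_dim_subset) blast
    ultimately have "aff_dim ?A \<le> aff_dim (cut F)" using dimF by simp
    moreover have "aff_dim (affine hull (cut F)) \<le> aff_dim ?A" by (rule aff_dim_subset[OF sub])
    ultimately have "aff_dim (affine hull (cut F)) = aff_dim ?A" by simp
    from affine_dim_equal[OF affine_affine_hull affA neA sub this]
    have zaff: "z \<in> affine hull (cut F)" using zA zF by blast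
    have convF: "convex (cut F)" by (rule face_of_imp_convex[OF cut_face])
    then obtain p where p: "p \<in> rel_interior (cut F)" using ne rel_interior_eq_empty by blast
    have pF: "p \<in> cut F" using p rel_interior_subset by blast
    then have pP: "p \<in> P" using cut_subset_P by blast
    have l: "z - p \<noteq> 0" using False pP by auto
    have bdd: "bounded (cut F)" using bounded_subset[OF polytope_imp_bounded[OF polytope_P] cut_subset_P] .
    have "p + (z - p) \<in> affine hull (cut F)" using zaff by simp
    \<comment> \<open>The ray from \<open>p\<close> towards \<open>z\<close> leaves the facet at
      parameter \<open>d\<close>; since \<open>z\<close> itself is outside \<open>P\<close>, this
      happens no later than at \<open>z\<close>.\<close>
    from ray_to_rel_frontier[OF bdd p this l] obtain d where d: "0 < d" "p + d *\<^sub>R (z - p) \<in> rel_frontier (cut F)"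
      "\<And>e. 0 \<le> e \<Longrightarrow> e < d \<Longrightarrow> p + e *\<^sub>R (z - p) \<in> rel_interior (cut F)" by metis
    have "d \<le> 1"
    proof (rule ccontr)
      assume "\<not> d \<le> 1"
      then have "p + 1 *\<^sub>R (z - p) \<in> rel_interior (cut F)" by (intro d(3)) auto
      then have "z \<in> cut F" using rel_interior_subset by auto
      then show False using False cut_subset_P by blast
    qed
    define q where "q = p + d *\<^sub>R (z - p)"
    have qi: "q $ i = (1 - d) * p $ i + d * z $ i" for i unfolding q_def by (simp add: algebra_simps)
    have pb: "0 \<le> p $ i" "p $ i \<le> 1" for i using unit_cube_bounds[OF P_unit_cube[OF pP]] by auto
    \<comment> \<open>\<open>q\<close> puts the positive weight \<open>d\<close> on the spread point
      \<open>z\<close> and the rest on a point of the cube, so strict inequalities persist.\<close>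
    have qs: "spread q"
      unfolding spread_def
    proof (intro conjI ballI allI impI)
      fix i assume "i \<in> \<Union>(bases M)"
      then have "0 < z $ i" using zs unfolding spread_def by blast
      then have "0 < d * z $ i" using d(1) by simp
      moreover have "0 \<le> (1 - d) * p $ i" using pb[of i] \<open>d \<le> 1\<close> by simp
      ultimately show "0 < q $ i" unfolding qi by simp
    next
      fix i assume "i \<notin> \<Inter>(bases M)"
      then have "z $ i < 1" using zs unfolding spread_def by blast
      then have "d * z $ i < d * 1" using d(1) by (intro mult_strict_left_mono) auto
      moreover have "(1 - d) * p $ i \<le> (1 - d) * 1" using pb[of i] \<open>d \<le> 1\<close> by (intro mult_left_mono) auto
      ultimately show "q $ i < 1" unfolding qi by simp
    qed
    have polyF: "polyhedron (cut F)" by (rule face_of_polyhedron_polyhedron[OF polyhedron_P cut_face])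
    have "q \<in> rel_frontier (cut F)" using d(2) unfolding q_def .
    then obtain L where L: "L facet_of cut F" "q \<in> L" unfolding rel_frontier_of_polyhedron[OF polyF] by blast
    have Lf: "L face_of P" using face_of_trans[OF facet_of_imp_face_of[OF L(1)] cut_face] .
    have LF: "L \<subseteq> cut F" "L \<noteq> cut F" using facet_of_imp_subset[OF L(1)] L(1) by auto
    have "L \<noteq> {}" "L \<noteq> P" using L(2) LF cut_subset_P by auto
    \<comment> \<open>The exit face \<open>L\<close> is an intersection of facets of
      \<open>P\<close> and strictly smaller than \<open>cut F\<close>, so a second facet contains
      it.\<close>
    then have Lint: "L = \<Inter>{K. K facet_of P \<and> L \<subseteq> K}" using face_of_polyhedron[OF polyhedron_P Lf] by blast
    have "\<exists>K. K facet_of P \<and> L \<subseteq> K \<and> K \<noteq> cut F"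
    proof (rule ccontr)
      assume "\<not> ?thesis"
      then have "{K. K facet_of P \<and> L \<subseteq> K} = {cut F}" using K(1) LF(1) by blast
      then show False using Lint LF(2) by simp
    qed
    then obtain K' where K': "K' facet_of P" "L \<subseteq> K'" "K' \<noteq> cut F" by blast
    obtain X where X: "K' = cut X" using facet_cut[OF K'(1)] by blast
    have "q \<in> cut F" "q \<in> cut X" using L(2) LF(1) K'(2) X by auto
    from certificate_of_point[OF K(1) K'(1,3)[unfolded X] this qs] show ?thesis by blast
  qed
qed

theorem split_matroid_iff: "split_matroid M \<longleftrightarrow> \<not> (\<exists>X Y. covered M X Y \<and> degenerate M X Y)"
  using not_split_of_certificate certificate_of_not_split by blast

end

section \<open>Excluded minors\<close>

lemma coveredI_complementary:
  assumes "B1 \<in> face M X Y" "B2 \<in> face M X Y" "\<Union>(bases M) \<subseteq> B1 \<union> B2" "B1 \<inter> B2 = {}"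
  shows "covered M X Y"
  using assms by (intro coveredI[OF assms(1)]) blast+

context fin_matroid
begin

lemma rank_eqI:
  assumes "I \<in> indeps M" "I \<subseteq> X" "card I = k" "\<And>J. J \<in> indeps M \<Longrightarrow> J \<subseteq> X \<Longrightarrow> card J \<le> k"
  shows "r X = k"
  using card_le_rank[OF assms(1,2)] assms(3,4) rank_witness[of X] by (metis le_antisym)

lemma rank_pair:
  assumes "{u} \<in> indeps M" "{u, v} \<notin> indeps M"
  shows "r {u, v} = 1"
proof (rule rank_eqI[OF assms(1)])
  fix J assume J: "J \<in> indeps M" "J \<subseteq> {u, v}"
  then have "J \<subset> {u, v}" using assms(2) by auto
  then have "card J < card {u, v}" by (intro psubset_card_mono) auto
  moreover have "card {u, v} \<le> 2" by (rule card_insert_le_m1) simp_all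
  ultimately show "card J \<le> 1" by simp
qed auto

text \<open>A form of the definition that evaluates: ranks become numerals, two complementary bases
  provide the covering, and \<open>D1\<close>, \<open>D2\<close> witness degeneracy in one of the
  two orders.\<close>

lemma nested_certificateI:
  assumes X: "r X = m" and Y: "r Y = n" and XY: "X \<subseteq> Y"
    and B: "B1 \<in> bases M" "B2 \<in> bases M" "E \<subseteq> B1 \<union> B2" "B1 \<inter> B2 = {}"
    and t: "card (B1 \<inter> X) = m" "card (B1 \<inter> Y) = n" "card (B2 \<inter> X) = m" "card (B2 \<inter> Y) = n"
    and D: "D1 \<in> bases M" "D2 \<in> bases M"
      "card (D1 \<inter> X) \<noteq> m \<and> card (D2 \<inter> X) = m \<and> card (D2 \<inter> Y) \<noteq> n \<or>
       card (D1 \<inter> Y) \<noteq> n \<and> card (D2 \<inter> Y) = n \<and> card (D2 \<inter> X) \<noteq> m"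
  shows "nested_certificate M"
proof -
  have "\<Union>(bases M) \<subseteq> B1 \<union> B2" using base_subset_ground B(3) by blast
  then have "covered M X Y"
    using coveredI_complementary[of B1 M X Y B2] B t X Y unfolding face_def tight_def by simp
  moreover have "degenerate M X Y \<or> degenerate M Y X"
    using D unfolding degenerate_def tight_def X Y by blast
  ultimately show ?thesis using XY unfolding nested_certificate_def by blast
qed

end

section \<open>Nested certificates of the five matroids\<close>

lemma card_subset_line: "J \<subseteq> L \<Longrightarrow> card (J \<inter> L) \<le> k \<Longrightarrow> card J \<le> k"
  by (simp add: inf.absorb1)

lemma base_rank3:
  assumes "is_matroid S" "ground S = UNIV" "mrank S UNIV = 3" "I \<in> indeps S" "card I = 3"
  shows "I \<in> bases S"
proof -
  interpret fin_matroid S by unfold_locales (rule assms(1))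
  show ?thesis using assms base_iff by simp
qed

text \<open>\<open>?Y\<close> is the union of the two parallel pairs; it is not a line of the
  presentation, so the bound on its rank comes from submodularity.\<close>

lemma nested_certificate_S1: "nested_certificate S1"
proof -
  interpret fin_matroid S1 by unfold_locales (rule is_matroid_S1)
  note b = base_rank3[OF is_matroid_S1 ground_S(3) mrank_S1]
  let ?Y = "{Elt_a, Elt_b, Elt_x, Elt_y}"
  have X: "r {Elt_a, Elt_b} = 1" "r {Elt_x, Elt_y} = 1"
    by (rule rank_pair; simp add: S1_def points_lines_matroid_def)+
  have "r ?Y \<le> 2" using rank_submodular[of "{Elt_a, Elt_b}" "{Elt_x, Elt_y}"] X
    by (simp add: insert_commute)
  moreover have "{Elt_a, Elt_x} \<in> indeps S1" by (simp add: S1_def points_lines_matroid_def)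
  ultimately have Y: "r ?Y = 2" using card_le_rank[of "{Elt_a, Elt_x}" ?Y] by simp
  have bs: "{Elt_a, Elt_x, Elt_c} \<in> bases S1" "{Elt_b, Elt_y, Elt_d} \<in> bases S1" "{Elt_x, Elt_c, Elt_d} \<in> bases S1" "{Elt_a, Elt_c, Elt_d} \<in> bases S1"
    by (rule b; simp add: S1_def points_lines_matroid_def)+
  show ?thesis
    by (rule nested_certificateI[OF X(1) Y, of "{Elt_a, Elt_x, Elt_c}" "{Elt_b, Elt_y, Elt_d}"
          "{Elt_x, Elt_c, Elt_d}" "{Elt_a, Elt_c, Elt_d}"])
      (use bs in \<open>simp_all add: ground_S UNIV_elt6\<close>)
qed

lemma nested_certificate_S2: "nested_certificate S2"
proof -
  interpret fin_matroid S2 by unfold_locales (rule is_matroid_S2)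
  note b = base_rank3[OF is_matroid_S2 ground_S(4) mrank_S2]
  let ?X = "{Elt_c, Elt_d}" and ?Y = "{Elt_c, Elt_d, Elt_a, Elt_b}"
  have X: "r ?X = 1" by (rule rank_pair; simp add: S2_def points_lines_matroid_def)
  have Y: "r ?Y = 2"
    by (rule rank_eqI[of "{Elt_c, Elt_a}"])
      (simp_all add: S2_def points_lines_matroid_def card_subset_line[where L = ?Y])
  have bs: "{Elt_c, Elt_a, Elt_x} \<in> bases S2" "{Elt_d, Elt_b, Elt_y} \<in> bases S2" "{Elt_a, Elt_x, Elt_y} \<in> bases S2" "{Elt_a, Elt_b, Elt_x} \<in> bases S2"
    by (rule b; simp add: S2_def points_lines_matroid_def)+
  \<comment> \<open>Every basis containing \<open>c\<close> or \<open>d\<close> has exactly two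
    elements in \<open>?Y\<close>, so the witnesses are for the reversed order.\<close>
  show ?thesis
    by (rule nested_certificateI[OF X Y, of "{Elt_c, Elt_a, Elt_x}" "{Elt_d, Elt_b, Elt_y}"
          "{Elt_a, Elt_x, Elt_y}" "{Elt_a, Elt_b, Elt_x}"])
      (use bs in \<open>simp_all add: ground_S UNIV_elt6\<close>)
qed

lemma nested_certificate_S3: "nested_certificate S3"
proof -
  interpret fin_matroid S3 by unfold_locales (rule is_matroid_S3)
  note b = base_rank3[OF is_matroid_S3 ground_S(5) mrank_S3]
  let ?X = "{Elt_x, Elt_y}" and ?Y = "{Elt_a, Elt_b, Elt_x, Elt_y}"
  have X: "r ?X = 1" by (rule rank_pair; simp add: S3_def points_lines_matroid_def)
  have Y: "r ?Y = 2"
    by (rule rank_eqI[of "{Elt_x, Elt_a}"])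
      (simp_all add: S3_def points_lines_matroid_def card_subset_line[where L = ?Y])
  have bs: "{Elt_x, Elt_a, Elt_c} \<in> bases S3" "{Elt_y, Elt_b, Elt_d} \<in> bases S3" "{Elt_a, Elt_b, Elt_c} \<in> bases S3" "{Elt_x, Elt_c, Elt_d} \<in> bases S3"
    by (rule b; simp add: S3_def points_lines_matroid_def)+
  show ?thesis
    by (rule nested_certificateI[OF X Y, of "{Elt_x, Elt_a, Elt_c}" "{Elt_y, Elt_b, Elt_d}"
          "{Elt_a, Elt_b, Elt_c}" "{Elt_x, Elt_c, Elt_d}"])
      (use bs in \<open>simp_all add: ground_S UNIV_elt6\<close>)
qed

lemma nested_certificate_S4: "nested_certificate S4"
proof -
  interpret fin_matroid S4 by unfold_locales (rule is_matroid_S4)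
  note b = base_rank3[OF is_matroid_S4 ground_S(6) mrank_S4]
  let ?X = "{Elt_x, Elt_y}" and ?Y = "{Elt_a, Elt_b, Elt_x, Elt_y}"
  have X: "r ?X = 1" by (rule rank_pair; simp add: S4_def points_lines_matroid_def)
  have Y: "r ?Y = 2"
    by (rule rank_eqI[of "{Elt_x, Elt_a}"])
      (simp_all add: S4_def points_lines_matroid_def card_subset_line[where L = ?Y])
  have bs: "{Elt_x, Elt_a, Elt_c} \<in> bases S4" "{Elt_y, Elt_b, Elt_d} \<in> bases S4" "{Elt_a, Elt_b, Elt_c} \<in> bases S4" "{Elt_x, Elt_c, Elt_d} \<in> bases S4"
    by (rule b; simp add: S4_def points_lines_matroid_def)+
  show ?thesis
    by (rule nested_certificateI[OF X Y, of "{Elt_x, Elt_a, Elt_c}" "{Elt_y, Elt_b, Elt_d}"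
          "{Elt_a, Elt_b, Elt_c}" "{Elt_x, Elt_c, Elt_d}"])
      (use bs in \<open>simp_all add: ground_S UNIV_elt6\<close>)
qed

lemma indeps_S0_iff:
  "I <+> J \<in> indeps S0 \<longleftrightarrow> I \<in> indeps MW2 \<and> J \<in> indeps MW2"
proof -
  have "Inl -` (I <+> J) = I" "Inr -` (I <+> J) = J" by auto
  then show ?thesis unfolding S0_def indeps_direct_sum_iff by simp
qed

text \<open>\<open>?X\<close> is the parallel pair of one summand and \<open>?Y\<close> the union of
  both pairs; a basis can miss the pair of one summand independently of the other.\<close>

lemma nested_certificate_S0: "nested_certificate S0"
proof -
  interpret fin_matroid S0 by unfold_locales (rule is_matroid_S0)
  interpret W: fin_matroid MW2 by unfold_locales (rule is_matroid_MW2)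
  have cap: "card I \<le> 2" if "I \<in> indeps MW2" for I
    using W.card_le_rank[OF that, of UNIV] mrank_MW2 by simp
  have top: "mrank S0 UNIV = 4"
  proof (rule mrank_eqI[OF is_matroid_S0, of "{Elt4_p, Elt4_q} <+> {Elt4_p, Elt4_q}"])
    show "{Elt4_p, Elt4_q} <+> {Elt4_p, Elt4_q} \<in> indeps S0"
      unfolding indeps_S0_iff by (simp add: MW2_def points_lines_matroid_def)
    show "card ({Elt4_p, Elt4_q} <+> {Elt4_p, Elt4_q}) = 4" by (simp add: card_Plus)
    fix J assume "J \<in> indeps S0"
    then have "card (Inl -` J) \<le> 2" "card (Inr -` J) \<le> 2" unfolding S0_def indeps_direct_sum_iff using cap by auto
    moreover have "card J = card (Inl -` J) + card (Inr -` J)" by (subst vimage_Plus) (simp add: card_Plus)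
    ultimately show "card J \<le> 4" by simp
  qed
  have b: "I <+> J \<in> bases S0"
    if "I \<in> indeps MW2" "card I = 2" "J \<in> indeps MW2" "card J = 2" for I J
    using that base_iff top indeps_S0_iff[of I J] by (simp add: ground_S card_Plus)
  have par: "r {Inl Elt4_p, Inl Elt4_p'} = 1" "r {Inr Elt4_p, Inr Elt4_p'} = 1"
    by (rule rank_pair; simp add: S0_def indeps_direct_sum_iff MW2_def points_lines_matroid_def vimage_def)+
  let ?X = "{Inl Elt4_p, Inl Elt4_p'}" and ?Y = "{Elt4_p, Elt4_p'} <+> {Elt4_p, Elt4_p'}"
  have Yeq: "?Y = {Inl Elt4_p, Inl Elt4_p'} \<union> {Inr Elt4_p, Inr Elt4_p'}" by auto
  have "r ?Y \<le> 2" unfolding Yeq using rank_submodular[of ?X "{Inr Elt4_p, Inr Elt4_p'}"] par rank_empty by simp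
  moreover have "{Elt4_p} <+> {Elt4_p} \<in> indeps S0"
    unfolding indeps_S0_iff by (simp add: MW2_def points_lines_matroid_def)
  then have "card ({Elt4_p} <+> {Elt4_p}) \<le> r ?Y" by (rule card_le_rank) auto
  ultimately have Y: "r ?Y = 2" by (simp add: card_Plus)
  have Plus: "I <+> J = Inl ` I \<union> Inr ` J" for I :: "elt4 set" and J :: "elt4 set" by (rule Plus_def)
  have bs: "{Elt4_p, Elt4_q} <+> {Elt4_p, Elt4_q} \<in> bases S0"
    "{Elt4_p', Elt4_r} <+> {Elt4_p', Elt4_r} \<in> bases S0"
    "{Elt4_q, Elt4_r} <+> {Elt4_p, Elt4_q} \<in> bases S0"
    "{Elt4_p, Elt4_q} <+> {Elt4_q, Elt4_r} \<in> bases S0"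
    by (intro b; simp add: MW2_def points_lines_matroid_def)+
  show ?thesis
    by (rule nested_certificateI[OF par(1) Y _ bs(1,2) _ _ _ _ _ _ bs(3,4)])
      (auto simp: Plus ground_S UNIV_sum UNIV_elt4)
qed

lemma nested_certificate_iso:
  assumes N: "is_matroid N" and S: "is_matroid S" "ground S = UNIV" and iso: "N \<simeq>\<^sub>m S" and cert: "nested_certificate S"
  shows "nested_certificate N"
proof -
  interpret N: fin_matroid N by unfold_locales (rule N)
  interpret S: fin_matroid S by unfold_locales (rule S(1))
  obtain f where bij: "bij_betw f (ground N) UNIV"
      and iff: "\<And>I. I \<subseteq> ground N \<Longrightarrow> I \<in> indeps N \<longleftrightarrow> f ` I \<in> indeps S"
    using iso unfolding matroid_iso_def S(2) by blast
  \<comment> \<open>Sets are pulled back rather than pushed forward; \<open>f\<close> is arbitrary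
    outside \<open>ground N\<close>, so the preimage is restricted to it.\<close>
  define pre where "pre A = {v \<in> ground N. f v \<in> A}" for A
  have inj: "inj_on f (ground N)" using bij by (rule bij_betw_imp_inj_on)
  have surj: "\<exists>v\<in>ground N. f v = x" for x using bij unfolding bij_betw_def by (metis UNIV_I imageE)
  have img: "f ` pre A = A" for A
  proof
    show "f ` pre A \<subseteq> A" unfolding pre_def by auto
    show "A \<subseteq> f ` pre A"
    proof
      fix x assume "x \<in> A"
      obtain v where "v \<in> ground N" "f v = x" using surj by blast
      then have "v \<in> pre A" "x = f v" using \<open>x \<in> A\<close> unfolding pre_def by auto
      then show "x \<in> f ` pre A" by (rule rev_image_eqI)
    qed
  qed
  have preE: "pre A \<subseteq> ground N" for A unfolding pre_def by blast
  have card: "card (pre A) = card A" for A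
    using card_image[OF inj_on_subset[OF inj preE], of A] unfolding img by simp
  have inv: "pre (f ` I) = I" if "I \<subseteq> ground N" for I
    using that inj unfolding pre_def by (auto dest: inj_onD)
  have ind: "pre A \<in> indeps N \<longleftrightarrow> A \<in> indeps S" for A using iff[OF preE] unfolding img .
  have all: "\<exists>A. I = pre A" if "I \<subseteq> ground N" for I using inv[OF that] by metis
  have mono: "pre A \<subseteq> pre B \<longleftrightarrow> A \<subseteq> B" for A B
  proof
    show "pre A \<subseteq> pre B \<Longrightarrow> A \<subseteq> B" using image_mono[of "pre A" "pre B" f] unfolding img .
    show "A \<subseteq> B \<Longrightarrow> pre A \<subseteq> pre B" unfolding pre_def by auto
  qed
  have "{I \<in> indeps N. I \<subseteq> pre A} = pre ` {J \<in> indeps S. J \<subseteq> A}" for A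
  proof
    show "pre ` {J \<in> indeps S. J \<subseteq> A} \<subseteq> {I \<in> indeps N. I \<subseteq> pre A}" using ind mono by auto
    show "{I \<in> indeps N. I \<subseteq> pre A} \<subseteq> pre ` {J \<in> indeps S. J \<subseteq> A}"
    proof
      fix I assume I: "I \<in> {I \<in> indeps N. I \<subseteq> pre A}"
      then obtain J where J: "I = pre J" using all[OF N.indep_subset_ground] by blast
      then show "I \<in> pre ` {J \<in> indeps S. J \<subseteq> A}" using I ind[of J] mono[of J A] by simp
    qed
  qed
  then have rank: "mrank N (pre A) = mrank S A" for A
    unfolding mrank_def by (simp add: image_image card)
  have gN: "ground N = pre UNIV" unfolding pre_def by simp
  have base: "pre A \<in> bases N \<longleftrightarrow> A \<in> bases S" for A
    unfolding N.base_iff S.base_iff ind card gN rank S(2) ..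
  have bases: "\<exists>A\<in>bases S. B = pre A" if "B \<in> bases N" for B
    using all[OF N.base_subset_ground[OF that]] that base by blast
  have tight: "tight N (pre Z) (pre A) \<longleftrightarrow> tight S Z A" for Z A
  proof -
    have "pre A \<inter> pre Z = pre (A \<inter> Z)" unfolding pre_def by blast
    then show ?thesis unfolding tight_def by (simp add: card rank)
  qed
  obtain X Y where XY: "X \<subseteq> Y" "covered S X Y" "degenerate S X Y \<or> degenerate S Y X"
    using cert unfolding nested_certificate_def by blast
  have face: "pre A \<in> face N (pre X) (pre Y)" if "A \<in> face S X Y" for A
    using that base tight unfolding face_def by simp
  obtain A0 where A0: "A0 \<in> face S X Y" by (rule S.covered_obtain[OF XY(2)])
  have "covered N (pre X) (pre Y)"
  proof (rule coveredI[OF face[OF A0]])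
    fix v assume "v \<in> \<Union>(bases N)"
    then obtain A where A: "A \<in> bases S" "v \<in> pre A" using bases by blast
    then have "f v \<in> \<Union>(bases S)" and v: "v \<in> ground N" unfolding pre_def by auto
    then obtain C where C: "C \<in> face S X Y" "f v \<in> C" using XY(2) unfolding covered_def by blast
    have "v \<in> pre C" using C(2) v unfolding pre_def by simp
    then show "\<exists>B\<in>face N (pre X) (pre Y). v \<in> B" by (rule bexI[OF _ face[OF C(1)]])
  next
    fix v assume v: "v \<notin> \<Inter>(bases N)"
    show "\<exists>B\<in>face N (pre X) (pre Y). v \<notin> B"
    proof (cases "v \<in> ground N")
      case True
      obtain A where A: "A \<in> bases S" "v \<notin> pre A" using v bases by blast
      then have "f v \<notin> \<Inter>(bases S)" using True unfolding pre_def by blast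
      then obtain C where C: "C \<in> face S X Y" "f v \<notin> C" using XY(2) unfolding covered_def by blast
      have "v \<notin> pre C" using C(2) unfolding pre_def by simp
      then show ?thesis by (rule bexI[OF _ face[OF C(1)]])
    next
      case False
      then have "v \<notin> pre A0" unfolding pre_def by simp
      then show ?thesis by (rule bexI[OF _ face[OF A0]])
    qed
  qed
  moreover have "degenerate N (pre A) (pre C)" if deg: "degenerate S A C" for A C
  proof -
    obtain A1 A2 where "A1 \<in> bases S" "\<not> tight S A A1" "A2 \<in> bases S" "tight S A A2" "\<not> tight S C A2"
      using deg unfolding degenerate_def by blast
    then have "pre A1 \<in> bases N" "\<not> tight N (pre A) (pre A1)" "pre A2 \<in> bases N"
      "tight N (pre A) (pre A2)" "\<not> tight N (pre C) (pre A2)" using base tight by simp_all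
    then show ?thesis unfolding degenerate_def by blast
  qed
  moreover have "pre X \<subseteq> pre Y" using mono XY(1) by simp
  ultimately show ?thesis using XY(3) unfolding nested_certificate_def by blast
qed

lemma iso_nested_certificate:
  assumes "is_matroid N" "iso_to_some_S N"
  shows "nested_certificate N"
  using assms(2)
    nested_certificate_iso[OF assms(1) is_matroid_S0 ground_S(2) _ nested_certificate_S0]
    nested_certificate_iso[OF assms(1) is_matroid_S1 ground_S(3) _ nested_certificate_S1]
    nested_certificate_iso[OF assms(1) is_matroid_S2 ground_S(4) _ nested_certificate_S2]
    nested_certificate_iso[OF assms(1) is_matroid_S3 ground_S(5) _ nested_certificate_S3]
    nested_certificate_iso[OF assms(1) is_matroid_S4 ground_S(6) _ nested_certificate_S4]
  unfolding iso_to_some_S_def by blast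

theorem split_iff_no_S_minor:
  fixes M :: "'a::finite matroid"
  assumes M: "is_matroid M"
  shows "split_matroid M \<longleftrightarrow> \<not> (\<exists>N. minor N M \<and> iso_to_some_S N)"
proof -
  interpret polytope_matroid M by unfold_locales (rule M)
  show ?thesis
  proof
    assume split: "split_matroid M"
    show "\<not> (\<exists>N. minor N M \<and> iso_to_some_S N)"
    proof
      assume "\<exists>N. minor N M \<and> iso_to_some_S N"
      then obtain N where N: "minor N M" "iso_to_some_S N" by blast
      have "nested_certificate N" by (rule iso_nested_certificate[OF is_matroid_minor[OF N(1) M] N(2)])
      with M N(1) have "nested_certificate M" by (rule nested_certificate_minor)
      then obtain X Y where "covered M X Y" "degenerate M X Y \<or> degenerate M Y X"
        unfolding nested_certificate_def by blast
      \<comment> \<open>\<open>covered\<close> is symmetric in its two sets, so degeneracy in the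
        reversed order also yields a certificate in the sense of
        \<open>split_matroid_iff\<close>.\<close>
      moreover have "covered M Y X" if "covered M X Y"
        using that unfolding covered_def face_def by (simp add: conj_commute)
      ultimately show False using split split_matroid_iff by blast
    qed
  next
    assume no: "\<not> (\<exists>N. minor N M \<and> iso_to_some_S N)"
    show "split_matroid M"
    proof (rule ccontr)
      assume "\<not> split_matroid M"
      then obtain X Y where XY: "covered M X Y" "degenerate M X Y" using split_matroid_iff by blast
      interpret covered_face M X Y by unfold_locales (rule XY(1))
      show False using degenerate_minor[OF XY(2)] no by blast
    qed
  qed
qed

section \<open>Connectivity and proper minors of the five matroids\<close>

text \<open>\<open>Z\<close> may contain elements outside the ground set, so that one and the same
  \<open>Z\<close> serves a matroid and all its minors.\<close>

definition separation :: "'a matroid \<Rightarrow> 'a set \<Rightarrow> bool" where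
  "separation M Z \<longleftrightarrow>
     (\<forall>I\<subseteq>ground M. I \<inter> Z \<in> indeps M \<longrightarrow> I - Z \<in> indeps M \<longrightarrow> I \<in> indeps M)"

text \<open>The basis \<open>K\<close> of the contracted set may be spread over both sides of
  \<open>Z\<close>; each part of \<open>I \<union> K\<close> is still contained in one of the two
  given independent sets.\<close>

lemma separation_minor:
  assumes M: "is_matroid M" and N: "minor N M" and sep: "separation M Z"
  shows "separation N Z"
proof -
  interpret fin_matroid M by unfold_locales (rule M)
  obtain C D where CD: "C \<subseteq> E" "D \<subseteq> E" "N = delete (contract M C) D"
    using N unfolding minor_def by blast
  obtain K where K: "K \<in> indeps M" "K \<subseteq> C" "card K = r C" by (rule rank_witness)
  have N_iff: "I \<in> indeps N \<longleftrightarrow> I \<subseteq> E - C \<and> I \<inter> D = {} \<and> I \<union> K \<in> indeps M" for I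
    unfolding CD(3) indeps_delete indep_contract_iff[OF CD(1) K] by blast
  show ?thesis
    unfolding separation_def
  proof (intro allI impI)
    fix I assume I: "I \<subseteq> ground N" "I \<inter> Z \<in> indeps N" "I - Z \<in> indeps N"
    have IE: "I \<subseteq> E - C" "I \<inter> D = {}" using I(1) unfolding CD(3) by auto
    have 1: "(I \<inter> Z) \<union> K \<in> indeps M" "(I - Z) \<union> K \<in> indeps M" using I(2,3) N_iff by auto
    have "(I \<union> K) \<inter> Z \<in> indeps M" by (rule indep_subset[OF 1(1)]) blast
    moreover have "(I \<union> K) - Z \<in> indeps M" by (rule indep_subset[OF 1(2)]) blast
    moreover have "I \<union> K \<subseteq> E" using IE(1) K(2) CD(1) by blast
    ultimately have "I \<union> K \<in> indeps M" using sep unfolding separation_def by blast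
    then show "I \<in> indeps N" using IE N_iff by blast
  qed
qed

lemma separation_iso:
  assumes bij: "bij_betw f (ground M) (ground N)"
    and iff: "\<And>I. I \<subseteq> ground M \<Longrightarrow> I \<in> indeps M \<longleftrightarrow> f ` I \<in> indeps N"
    and sep: "separation M Z"
  shows "separation N (f ` (Z \<inter> ground M))"
proof -
  have inj: "inj_on f (ground M)" and surj: "f ` ground M = ground N" using bij unfolding bij_betw_def by auto
  have parts: "f ` (I \<inter> Z) = f ` I \<inter> f ` (Z \<inter> ground M)" "f ` (I - Z) = f ` I - f ` (Z \<inter> ground M)"
    if "I \<subseteq> ground M" for I
  proof -
    have "I \<inter> Z = I \<inter> (Z \<inter> ground M)" "I - Z = I - (Z \<inter> ground M)" using that by auto
    then show "f ` (I \<inter> Z) = f ` I \<inter> f ` (Z \<inter> ground M)" "f ` (I - Z) = f ` I - f ` (Z \<inter> ground M)"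
      using inj_on_image_Int[OF inj that, of "Z \<inter> ground M"] inj_on_image_set_diff[OF inj, of I "Z \<inter> ground M"] that
      by auto
  qed
  have one: "(I \<inter> Z \<in> indeps M \<longrightarrow> I - Z \<in> indeps M \<longrightarrow> I \<in> indeps M) \<longleftrightarrow>
      (f ` I \<inter> f ` (Z \<inter> ground M) \<in> indeps N \<longrightarrow> f ` I - f ` (Z \<inter> ground M) \<in> indeps N \<longrightarrow> f ` I \<in> indeps N)"
    if I: "I \<subseteq> ground M" for I
  proof -
    have "I \<inter> Z \<subseteq> ground M" "I - Z \<subseteq> ground M" using I by auto
    then show ?thesis using iff I parts[OF I] by metis
  qed
  show ?thesis
    unfolding separation_def
  proof (intro allI impI)
    fix J assume J: "J \<subseteq> ground N" "J \<inter> f ` (Z \<inter> ground M) \<in> indeps N" "J - f ` (Z \<inter> ground M) \<in> indeps N"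
    obtain I where I: "I \<subseteq> ground M" "J = f ` I" using J(1) unfolding surj[symmetric] by (rule subset_imageE)
    have "I \<inter> Z \<in> indeps M \<longrightarrow> I - Z \<in> indeps M \<longrightarrow> I \<in> indeps M"
      using sep I(1) unfolding separation_def by simp
    then show "J \<in> indeps N" using one[OF I(1)] J(2,3) unfolding I(2) by simp
  qed
qed

lemma separation_S0: "separation S0 (range Inl)"
  unfolding separation_def S0_def indeps_direct_sum_iff
proof (intro allI impI)
  fix I :: "(elt4 + elt4) set"
  have "Inl -` (I \<inter> range Inl) = Inl -` I" "Inr -` (I - range Inl) = Inr -` I" by auto
  then show "Inl -` (I \<inter> range Inl) \<in> indeps MW2 \<and> Inr -` (I \<inter> range Inl) \<in> indeps MW2 \<Longrightarrow>
      Inl -` (I - range Inl) \<in> indeps MW2 \<and> Inr -` (I - range Inl) \<in> indeps MW2 \<Longrightarrow>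
      Inl -` I \<in> indeps MW2 \<and> Inr -` I \<in> indeps MW2" by simp
qed

text \<open>A circuit split by \<open>Z\<close> would have two proper, hence independent, parts, and
  the separation would make their union independent.\<close>

lemma circuit_not_separated:
  assumes "is_matroid M" "separation M Z" "C \<subseteq> ground M" "C \<notin> indeps M"
    and circuit: "\<And>c. c \<in> C \<Longrightarrow> C - {c} \<in> indeps M" and "u \<in> C" "v \<in> C"
  shows "u \<in> Z \<longleftrightarrow> v \<in> Z"
proof -
  interpret fin_matroid M by unfold_locales (rule assms(1))
  have "\<not> (u \<in> Z \<and> v \<notin> Z)" if "u \<in> C" "v \<in> C" for u v
  proof
    assume uv: "u \<in> Z \<and> v \<notin> Z"
    have "C \<inter> Z \<in> indeps M" by (rule indep_subset[OF circuit[OF that(2)]]) (use uv in blast)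
    moreover have "C - Z \<in> indeps M" by (rule indep_subset[OF circuit[OF that(1)]]) (use uv in blast)
    ultimately show False using assms(2-4) unfolding separation_def by blast
  qed
  then show ?thesis using assms(6,7) by blast
qed

text \<open>A few circuits chain all six elements together, parallel pairs being circuits of size
  two.\<close>

lemma connected_S:
  assumes "S = S1 \<or> S = S2 \<or> S = S3 \<or> S = S4" and sep: "separation S Z"
  shows "Z = {} \<or> Z = UNIV"
proof -
  have S: "is_matroid S" "ground S = UNIV"
    using assms(1) is_matroid_S1 is_matroid_S2 is_matroid_S3 is_matroid_S4 ground_S by auto
  have c: "u \<in> Z \<longleftrightarrow> v \<in> Z"
    if "C \<notin> indeps S" "\<forall>c\<in>C. C - {c} \<in> indeps S" "u \<in> C" "v \<in> C" for C u v
    using circuit_not_separated[OF S(1) sep _ that(1) _ that(3,4)] that(2) S(2) by blast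
  note ev = points_lines_matroid_def insert_Diff_if
  from assms(1) have "\<forall>v. v \<in> Z \<longleftrightarrow> Elt_a \<in> Z"
  proof (elim disjE)
    assume S: "S = S1"
    have "Elt_a \<in> Z \<longleftrightarrow> Elt_b \<in> Z" by (rule c[of "{Elt_a, Elt_b}"]) (simp_all add: S S1_def ev)
    moreover have "Elt_x \<in> Z \<longleftrightarrow> Elt_y \<in> Z" by (rule c[of "{Elt_x, Elt_y}"]) (simp_all add: S S1_def ev)
    moreover have "Elt_a \<in> Z \<longleftrightarrow> v \<in> Z" if "v \<in> {Elt_x, Elt_c, Elt_d}" for v
      by (rule c[of "{Elt_a, Elt_x, Elt_c, Elt_d}"]) (use that in \<open>auto simp: S S1_def ev\<close>)
    ultimately show ?thesis using elt6.exhaust by (metis insertI1 insertI2)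
  next
    assume S: "S = S2"
    have "Elt_c \<in> Z \<longleftrightarrow> Elt_d \<in> Z" by (rule c[of "{Elt_c, Elt_d}"]) (simp_all add: S S2_def ev)
    moreover have "Elt_a \<in> Z \<longleftrightarrow> v \<in> Z" if "v \<in> {Elt_b, Elt_c}" for v
      by (rule c[of "{Elt_a, Elt_b, Elt_c}"]) (use that in \<open>auto simp: S S2_def ev\<close>)
    moreover have "Elt_c \<in> Z \<longleftrightarrow> v \<in> Z" if "v \<in> {Elt_x, Elt_y}" for v
      by (rule c[of "{Elt_c, Elt_x, Elt_y}"]) (use that in \<open>auto simp: S S2_def ev\<close>)
    ultimately show ?thesis using elt6.exhaust by (metis insertI1 insertI2)
  next
    assume S: "S = S3"
    have "Elt_x \<in> Z \<longleftrightarrow> Elt_y \<in> Z" by (rule c[of "{Elt_x, Elt_y}"]) (simp_all add: S S3_def ev)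
    moreover have "Elt_a \<in> Z \<longleftrightarrow> v \<in> Z" if "v \<in> {Elt_b, Elt_x}" for v
      by (rule c[of "{Elt_a, Elt_b, Elt_x}"]) (use that in \<open>auto simp: S S3_def ev\<close>)
    moreover have "Elt_a \<in> Z \<longleftrightarrow> v \<in> Z" if "v \<in> {Elt_c, Elt_d}" for v
      by (rule c[of "{Elt_a, Elt_c, Elt_d}"]) (use that in \<open>auto simp: S S3_def ev\<close>)
    ultimately show ?thesis using elt6.exhaust by (metis insertI1 insertI2)
  next
    assume S: "S = S4"
    have "Elt_x \<in> Z \<longleftrightarrow> Elt_y \<in> Z" by (rule c[of "{Elt_x, Elt_y}"]) (simp_all add: S S4_def ev)
    moreover have "Elt_a \<in> Z \<longleftrightarrow> v \<in> Z" if "v \<in> {Elt_b, Elt_x}" for v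
      by (rule c[of "{Elt_a, Elt_b, Elt_x}"]) (use that in \<open>auto simp: S S4_def ev\<close>)
    moreover have "Elt_a \<in> Z \<longleftrightarrow> v \<in> Z" if "v \<in> {Elt_c, Elt_d}" for v
      by (rule c[of "{Elt_a, Elt_x, Elt_c, Elt_d}"]) (use that in \<open>auto simp: S S4_def ev\<close>)
    ultimately show ?thesis using elt6.exhaust by (metis insertI1 insertI2)
  qed
  then show ?thesis by blast
qed

lemma iso_card: "M \<simeq>\<^sub>m N \<Longrightarrow> card (ground M) = card (ground N)"
  unfolding matroid_iso_def by (blast dest: bij_betw_same_card)

lemma card_UNIV_elt: "CARD(elt6) = 6" "CARD(elt4) = 4"
  by (simp_all add: UNIV_elt6 UNIV_elt4)

lemma iso_S_card:
  "M \<simeq>\<^sub>m S0 \<Longrightarrow> card (ground M) = 8" "M \<simeq>\<^sub>m S1 \<Longrightarrow> card (ground M) = 6"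
  "M \<simeq>\<^sub>m S2 \<Longrightarrow> card (ground M) = 6" "M \<simeq>\<^sub>m S3 \<Longrightarrow> card (ground M) = 6"
  "M \<simeq>\<^sub>m S4 \<Longrightarrow> card (ground M) = 6"
  using iso_card[of M S0] iso_card[of M S1] iso_card[of M S2] iso_card[of M S3] iso_card[of M S4]
  by (simp_all add: ground_S card_UNIV_elt)

text \<open>The five matroids have 8 or 6 elements, so one inside a larger one must be a six-element
  matroid in \<open>S0\<close>. It inherits the separation of \<open>S0\<close> into two sets of
  four elements, but being connected it would have to fit into one of them.\<close>

lemma no_small_S_minor:
  fixes M :: "'a matroid"
  assumes M: "is_matroid M" "iso_to_some_S M" and N: "minor N M" "ground N \<noteq> ground M"
    and K: "minor K N" "iso_to_some_S K"
  shows False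
proof -
  interpret fin_matroid M by unfold_locales (rule M(1))
  have Nm: "is_matroid N" by (rule is_matroid_minor[OF N(1) M(1)])
  have "ground N \<subset> E" using N unfolding minor_def by auto
  then have KE: "ground K \<subset> E" using K(1) unfolding minor_def by auto
  then have less: "card (ground K) < card E" using finite_ground by (rule psubset_card_mono[rotated])
  have K6: "6 \<le> card (ground K)"
    using K(2) iso_S_card[of K] unfolding iso_to_some_S_def by auto
  have M0: "M \<simeq>\<^sub>m S0"
    using M(2) iso_S_card[of M] less K6 unfolding iso_to_some_S_def by auto
  then have E8: "card E = 8" by (rule iso_S_card(1))
  then obtain S where S: "S = S1 \<or> S = S2 \<or> S = S3 \<or> S = S4" "K \<simeq>\<^sub>m S"
    using K(2) iso_S_card(1)[of K] less unfolding iso_to_some_S_def by auto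
  have gS: "ground S = UNIV" using S(1) ground_S by auto
  then have Kc: "card (ground K) = 6" using iso_card[OF S(2)] by (simp add: card_UNIV_elt)
  obtain f where f: "bij_betw f E UNIV" "\<And>I. I \<subseteq> E \<Longrightarrow> I \<in> indeps M \<longleftrightarrow> f ` I \<in> indeps S0"
    using M0 unfolding matroid_iso_def ground_S by blast
  define Z where "Z = {v \<in> E. f v \<in> range Inl}"
  have inj: "inj_on f E" and surj: "f ` E = UNIV" using f(1) unfolding bij_betw_def by auto
  have hit: "f ` {v \<in> E. f v \<in> A} = A" for A
  proof
    show "A \<subseteq> f ` {v \<in> E. f v \<in> A}"
    proof
      fix x assume "x \<in> A"
      have "x \<in> f ` E" unfolding surj by simp
      then obtain v where "v \<in> E" "x = f v" by blast
      then show "x \<in> f ` {v \<in> E. f v \<in> A}" using \<open>x \<in> A\<close> by blast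
    qed
  qed auto
  have "- range Inl = (range Inr :: (elt4 + elt4) set)" by (auto simp: image_iff) (metis sum.exhaust)
  moreover have "E - Z = {v \<in> E. f v \<in> - range Inl}" unfolding Z_def by blast
  ultimately have fZ: "f ` Z = range Inl" "f ` (E - Z) = range Inr"
    using hit[of "range Inl"] hit[of "- range Inl"] unfolding Z_def by simp_all
  have ZE: "Z \<subseteq> E" unfolding Z_def by blast
  have "card Z = 4" "card (E - Z) = 4"
    using card_image[OF inj_on_subset[OF inj ZE]] card_image[OF inj_on_subset[OF inj Diff_subset], of Z]
    unfolding fZ by (simp_all add: card_image UNIV_elt4)
  have "separation M Z"
    unfolding separation_def
  proof (intro allI impI)
    fix I assume I: "I \<subseteq> E" "I \<inter> Z \<in> indeps M" "I - Z \<in> indeps M"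
    have "f ` (I \<inter> Z) = f ` I \<inter> range Inl" "f ` (I - Z) = f ` I - range Inl"
      using I(1) unfolding Z_def by auto
    moreover have "I \<inter> Z \<subseteq> E" "I - Z \<subseteq> E" using I(1) by auto
    ultimately have "f ` I \<inter> range Inl \<in> indeps S0" "f ` I - range Inl \<in> indeps S0"
      using I(2,3) f(2) by metis+
    then have "f ` I \<in> indeps S0" using separation_S0 unfolding separation_def ground_S by simp
    then show "I \<in> indeps M" using f(2)[OF I(1)] by simp
  qed
  then have sepK: "separation K Z" using separation_minor[OF Nm K(1)] separation_minor[OF M(1) N(1)] by blast
  obtain h where h: "bij_betw h (ground K) UNIV" "\<And>I. I \<subseteq> ground K \<Longrightarrow> I \<in> indeps K \<longleftrightarrow> h ` I \<in> indeps S"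
    using S(2) unfolding matroid_iso_def gS by blast
  have "separation S (h ` (Z \<inter> ground K))" by (rule separation_iso[OF _ h(2) sepK]) (simp add: gS h(1))
  from connected_S[OF S(1) this] show False
  proof
    assume "h ` (Z \<inter> ground K) = {}"
    then have "ground K \<subseteq> E - Z" using KE by auto
    then have "card (ground K) \<le> card (E - Z)" using finite_ground by (intro card_mono) auto
    then show False using Kc \<open>card (E - Z) = 4\<close> by simp
  next
    assume "h ` (Z \<inter> ground K) = UNIV"
    then have "6 \<le> card (Z \<inter> ground K)"
      using card_image_le[of "Z \<inter> ground K" h] finite_subset[OF ZE finite_ground] card_UNIV_elt(1) by simp
    also have "\<dots> \<le> card Z" using finite_subset[OF ZE finite_ground] by (intro card_mono) auto
    finally show False using \<open>card Z = 4\<close> by simp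
  qed
qed

text \<open>A nonsplit matroid has one of the five as a minor, and that minor is itself nonsplit. If
  all proper minors are split, it keeps the whole ground set, so nothing was deleted or contracted.
  The converse rests on \<open>no_small_S_minor\<close>.\<close>

lemma excluded_minor_iff:
  fixes M :: "'a::finite matroid"
  assumes M: "is_matroid M"
  shows "excluded_minor M \<longleftrightarrow> iso_to_some_S M"
proof
  assume ex: "excluded_minor M"
  then have "\<not> split_matroid M" unfolding excluded_minor_def by simp
  then obtain N where N: "minor N M" "iso_to_some_S N" using split_iff_no_S_minor[OF M] by blast
  have Nm: "is_matroid N" by (rule is_matroid_minor[OF N(1) M])
  have "\<not> split_matroid N" using split_iff_no_S_minor[OF Nm] minor_refl[OF Nm] N(2) by blast
  then have g: "ground N = ground M" using ex N(1) unfolding excluded_minor_def proper_minor_def by blast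
  interpret fin_matroid M by unfold_locales (rule M)
  obtain C D where CD: "C \<subseteq> E" "D \<subseteq> E" "N = delete (contract M C) D" using N(1) unfolding minor_def by blast
  then have "C = {}" "D = {}" using g by auto
  then have "I \<in> indeps N \<longleftrightarrow> I \<in> indeps M" for I
    unfolding CD(3) indeps_delete
    using indep_contract_iff[of "{}" "{}" I] indep_empty rank_empty indep_subset_ground by auto
  then have "indeps N = indeps M" by blast
  then have "N = M" using g by (intro matroid.equality) simp_all
  then show "iso_to_some_S M" using N(2) by simp
next
  assume iso: "iso_to_some_S M"
  have "\<not> split_matroid M" using split_iff_no_S_minor[OF M] minor_refl[OF M] iso by blast
  moreover have "split_matroid N" if N: "proper_minor N M" for N
  proof -
    have N': "minor N M" "ground N \<noteq> ground M" using N unfolding proper_minor_def by auto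
    then show ?thesis
      using split_iff_no_S_minor[OF is_matroid_minor[OF N'(1) M]] no_small_S_minor[OF M iso N'] by blast
  qed
  ultimately show "excluded_minor M" using M unfolding excluded_minor_def by blast
qed

lemma matroid_iso_refl: "M \<simeq>\<^sub>m M"
  unfolding matroid_iso_def by (intro exI[of _ id]) simp

theorem theorem4:
  fixes M :: "'a::finite matroid"
  assumes "is_matroid M"
  shows "(excluded_minor M \<longleftrightarrow> iso_to_some_S M) \<and>
    (split_matroid M \<longleftrightarrow> \<not> (\<exists>N. minor N M \<and> iso_to_some_S N)) \<and>
    excluded_minor S0 \<and> excluded_minor S1 \<and> excluded_minor S2 \<and>
    excluded_minor S3 \<and> excluded_minor S4"
proof -
  have "excluded_minor S0" "excluded_minor S1" "excluded_minor S2" "excluded_minor S3" "excluded_minor S4"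
    using excluded_minor_iff[OF is_matroid_S0] excluded_minor_iff[OF is_matroid_S1]
      excluded_minor_iff[OF is_matroid_S2] excluded_minor_iff[OF is_matroid_S3]
      excluded_minor_iff[OF is_matroid_S4] matroid_iso_refl
    unfolding iso_to_some_S_def by blast+
  then show ?thesis using excluded_minor_iff[OF assms] split_iff_no_S_minor[OF assms] by blast
qed

end
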